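(* Let $n\ge1$ and let $h_t(r,\phi)$ be the subelliptic heat kernel of the sub-Laplacian $\mathcal{L}$ on $\mathbb{CP}^{2n+1}$. For $t>0$, $r\in[0,\pi/2)$, $\phi\in[0,\pi/2]$, $$h_t(r,\phi)=\frac{e^{-t}}{2\pi\sqrt{\pi t}}\int_0^\pi\int_0^{+\infty}\frac{\sinh y\,\sin\left(\frac{y\arccos(\cos\phi\cos\theta)}{2t}\right)}{\sqrt{1-\cos^2\phi\cos^2\theta}}\,e^{-\frac{y^2-\arccos(\cos\phi\cos\theta)^2}{4t}}\,q_t(\cos r\cosh y)\,dy\,d\theta,$$ where $q_t$ is the Riemannian heat kernel on $\mathbb{S}^{4n+3}$.
   Context: $\mathbb{S}^{4n+3}=\{q\in\mathbb{H}^{n+1}:\|q\|=1\}$ ($\mathbb{H}$ the quaternions) with its round metric. The unit quaternions $\mathbf{SU}(2)$ act isometrically by $g\cdot(q_1,\dots,q_{n+1})=(gq_1,\dots,gq_{n+1})$ with quotient $\mathbb{HP}^n$; the subgroup $\mathbb{S}^1=\{e^{I\theta}\}$ has quotient $\mathbb{CP}^{2n+1}$, which induces the fibration $\mathbf{SU}(2)/\mathbb{S}^1=\mathbb{CP}^1\to\mathbb{CP}^{2n+1}\to\mathbb{HP}^n$ (quotient metrics making the projections Riemannian submersions). $\mathcal{L}$ is the lift to $\mathbb{CP}^{2n+1}$ of the Laplace–Beltrami operator of $\mathbb{HP}^n$. Coordinates: $r\in[0,\pi/2)$ with $|q_{n+1}|=\cos r$; $\phi\in[0,\pi/2]$ is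 the distance on $\mathbb{CP}^1$ from the class of the identity to the class of $q_{n+1}/|q_{n+1}|$ (writing $q_{n+1}/|q_{n+1}|=a+bJ$ with $a,b\in\mathrm{span}_{\mathbb{R}}(1,I)$, $|a|=\cos\phi$). $h_t(r,\phi)$ is the heat kernel of $e^{t\mathcal{L}}$ issued from the image of the north pole $(0,\dots,0,1)$; it depends only on $(r,\phi)$ and is taken with respect to the multiple of the Riemannian measure which on functions of $(r,\phi)$ reads $\frac{8\pi^{2n+2}}{\Gamma(2n)}(\sin r)^{4n-1}(\cos r)^3\sin2\phi\,dr\,d\phi$. $q_t(\cos\delta)$ is the heat kernel of the Laplace–Beltrami operator of $\mathbb{S}^{4n+3}$ with respect to the Riemannian volume, $\delta$ being the distance from the north pole; as a function of its argument $$q_t(x)=\frac{\Gamma(2n+1)}{2\pi^{2n+2}}\sum_{m=0}^{+\infty}(m+2n+1)e^{-m(m+4n+2)t}C_m^{2n+1}(x),$$ with $C_m^{2n+1}$ the Gegenbauer polynomials, and this series defines $q_t(x)$ also for $x>1$. *)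

theory Defs
  imports "HOL-Analysis.Analysis"
begin

text \<open>The pair \<open>(a, b)\<close> of complex numbers stands for the quaternion \<open>a + bJ\<close>, where \<open>a\<close> and
  \<open>b\<close> lie in the real span of \<open>1\<close> and \<open>I\<close>; thus \<open>J c = cnj c J\<close> and \<open>J J = -1\<close>.\<close>

type_synonym quat = "complex \<times> complex"

definition qmult :: "quat \<Rightarrow> quat \<Rightarrow> quat" where
  "qmult p q = (fst p * fst q - snd p * cnj (snd q), fst p * snd q + snd p * cnj (fst q))"

text \<open>With \<open>n = CARD('n)\<close>, the space \<open>H^(n+1)\<close> is \<open>(quat ^ 'n) \<times> quat\<close>; the second factor is the
  last coordinate \<open>q_(n+1)\<close>. Since \<open>'n\<close> is an arbitrary finite type, \<open>n\<close> is an arbitrary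
  number \<open>\<ge> 1\<close>.\<close>

type_synonym 'n qspace = "(quat ^ 'n) \<times> quat"

definition left_act :: "quat \<Rightarrow> 'n::finite qspace \<Rightarrow> 'n qspace" where
  "left_act g q = ((\<chi> i. qmult g (fst q $ i)), qmult g (snd q))"


subsection \<open>The complex projective space \<open>CP^(2n+1)\<close> as the quotient of the unit sphere\<close>

type_synonym 'n cp_point = "'n qspace set"

definition circle_orbit :: "'n::finite qspace \<Rightarrow> 'n cp_point" where
  "circle_orbit q = {left_act (cis \<theta>, 0) q |\<theta>. True}"

definition cp_space :: "'n::finite cp_point set" where
  "cp_space = circle_orbit ` sphere 0 1"

definition cp_north :: "'n::finite cp_point" where
  "cp_north = circle_orbit (0, (1, 0))"

text \<open>Continuity for the quotient topology.\<close>

definition cp_continuous :: "('n::finite cp_point \<Rightarrow> real) \<Rightarrow> bool" where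
  "cp_continuous f \<longleftrightarrow> continuous_on (sphere 0 1) (\<lambda>q. f (circle_orbit q))"

text \<open>\<open>Ck_on k S g\<close> is used for open \<open>S\<close> only.\<close>

fun Ck_on :: "nat \<Rightarrow> 'a::euclidean_space set \<Rightarrow> ('a \<Rightarrow> real) \<Rightarrow> bool" where
  "Ck_on 0 S g \<longleftrightarrow> continuous_on S g"
| "Ck_on (Suc k) S g \<longleftrightarrow>
     (\<exists>g'. (\<forall>x\<in>S. (g has_derivative g' x) (at x)) \<and> (\<forall>v. Ck_on k S (\<lambda>x. g' x v)))"

text \<open>As the projection of the sphere onto \<open>CP^(2n+1)\<close> is a submersion, a function on the quotient
  is smooth iff its pullback to the sphere is, i.e. iff the pullback is the restriction of a
  smooth function defined near the sphere.\<close>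

definition cp_smooth :: "('n::finite cp_point \<Rightarrow> real) \<Rightarrow> bool" where
  "cp_smooth f \<longleftrightarrow>
     (\<exists>U g. open U \<and> sphere 0 1 \<subseteq> U \<and> (\<forall>k. Ck_on k U g) \<and>
            (\<forall>q\<in>sphere 0 1. g q = f (circle_orbit q)))"


subsection \<open>Riemannian measures\<close>

text \<open>Polar coordinates: the Riemannian volume of a part of the unit sphere of a \<open>d\<close>-dimensional
  Euclidean space is \<open>d\<close> times the Lebesgue measure of the cone over it in the unit ball.\<close>

definition sphere_measure :: "'a::euclidean_space measure" where
  "sphere_measure = scale_measure (of_nat DIM('a))
     (distr (restrict_space lborel (ball 0 1 - {0})) (restrict_space borel (sphere 0 1)) sgn)"

text \<open>The projection of the sphere onto \<open>CP^(2n+1)\<close> is a Riemannian submersion whose fibres are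
  circles of length \<open>2\<pi>\<close>, hence the factor \<open>1/(2\<pi>)\<close>. The \<open>\<sigma>\<close>-algebra is the Borel algebra of the
  quotient topology.\<close>

definition cp_riemannian_measure :: "'n::finite cp_point measure" where
  "cp_riemannian_measure = scale_measure (ennreal (1 / (2 * pi)))
     (distr sphere_measure
       (sigma cp_space
         {U. U \<subseteq> cp_space \<and>
             openin (top_of_set (sphere 0 1)) {q \<in> sphere 0 1. circle_orbit q \<in> U}})
       circle_orbit)"

text \<open>The multiple of the Riemannian measure that on functions of \<open>(r, \<phi>)\<close> (see \<open>has_coords\<close> below) reads
  \<open>8 \<pi>^(2n+2) / \<Gamma>(2n) (sin r)^(4n-1) (cos r)^3 sin 2\<phi> dr d\<phi>\<close>. The factor is found by comparing
  total masses: the density has mass \<open>4 \<pi>^(2n+2) / \<Gamma>(2n+2)\<close>, twice the volume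
  \<open>2 \<pi>^(2n+2) / \<Gamma>(2n+2)\<close> of the sphere, hence \<open>4\<pi>\<close> times that of \<open>CP^(2n+1)\<close>.\<close>

definition cp_measure :: "'n::finite cp_point measure" where
  "cp_measure = scale_measure (ennreal (4 * pi)) cp_riemannian_measure"


subsection \<open>The sub-Laplacian\<close>

text \<open>The horizontal space at a point \<open>q\<close> of the sphere: the tangent vectors orthogonal to the
  \<open>SU(2)\<close>-orbit of \<open>q\<close>, whose tangent space consists of the \<open>u q\<close> with \<open>u\<close> imaginary.\<close>

definition horizontal_space :: "'n::finite qspace \<Rightarrow> 'n qspace set" where
  "horizontal_space q =
     {v. v \<bullet> q = 0 \<and> (\<forall>u. Re (fst u) = 0 \<longrightarrow> v \<bullet> left_act u q = 0)}"

definition horizontal_frame :: "'n::finite qspace \<Rightarrow> 'n qspace set" where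
  "horizontal_frame q =
     (SOME B. pairwise orthogonal B \<and> (\<forall>v\<in>B. norm v = 1) \<and> span B = horizontal_space q)"

text \<open>At a point of a Riemannian manifold the Laplace--Beltrami operator is the sum of the second
  derivatives along the unit speed geodesics in the directions of an orthonormal basis. The lift
  of the Laplace--Beltrami operator of \<open>HP^n\<close> uses the horizontal lifts of these geodesics. On the
  sphere they are the great circles through \<open>q\<close> with horizontal initial velocity \<open>v\<close>, and their
  images are the horizontal geodesics of \<open>CP^(2n+1)\<close>. For smooth functions the choice of the
  frame, and in \<open>sub_laplacian\<close> that of the representative \<open>q\<close>, is immaterial.\<close>

definition horizontal_laplacian :: "('n::finite qspace \<Rightarrow> real) \<Rightarrow> 'n qspace \<Rightarrow> real" where
  "horizontal_laplacian F q =
     (\<Sum>v\<in>horizontal_frame q. (deriv ^^ 2) (\<lambda>s. F (cos s *\<^sub>R q + sin s *\<^sub>R v)) 0)"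

definition sub_laplacian :: "('n::finite cp_point \<Rightarrow> real) \<Rightarrow> 'n cp_point \<Rightarrow> real" where
  "sub_laplacian f x = horizontal_laplacian (\<lambda>q. f (circle_orbit q)) (SOME q. q \<in> x)"


subsection \<open>The heat semigroup and its kernel\<close>

text \<open>\<open>T t = e^(t L)\<close>: the strongly continuous contraction semigroup on the continuous functions
  with the sup norm whose generator extends the sub-Laplacian on smooth functions. It is unique,
  the smooth functions being a core.\<close>

definition is_heat_semigroup ::
    "(real \<Rightarrow> ('n::finite cp_point \<Rightarrow> real) \<Rightarrow> 'n cp_point \<Rightarrow> real) \<Rightarrow> bool" where
  "is_heat_semigroup T \<longleftrightarrow>
     (\<forall>t\<ge>0. \<forall>f. cp_continuous f \<longrightarrow> cp_continuous (T t f)) \<and>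
     (\<forall>t\<ge>0. \<forall>f g a b. cp_continuous f \<longrightarrow> cp_continuous g \<longrightarrow>
        (\<forall>x\<in>cp_space. T t (\<lambda>y. a * f y + b * g y) x = a * T t f x + b * T t g x)) \<and>
     (\<forall>t\<ge>0. \<forall>f c. cp_continuous f \<longrightarrow> (\<forall>x\<in>cp_space. \<bar>f x\<bar> \<le> c) \<longrightarrow>
        (\<forall>x\<in>cp_space. \<bar>T t f x\<bar> \<le> c)) \<and>
     (\<forall>f. cp_continuous f \<longrightarrow> (\<forall>x\<in>cp_space. T 0 f x = f x)) \<and>
     (\<forall>s\<ge>0. \<forall>t\<ge>0. \<forall>f. cp_continuous f \<longrightarrow>
        (\<forall>x\<in>cp_space. T (s + t) f x = T s (T t f) x)) \<and>
     (\<forall>f. cp_continuous f \<longrightarrow> uniform_limit cp_space (\<lambda>t. T t f) f (at_right 0)) \<and>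
     (\<forall>f. cp_smooth f \<longrightarrow>
        uniform_limit cp_space (\<lambda>t x. (T t f x - f x) / t) (sub_laplacian f) (at_right 0))"

text \<open>\<open>h t\<close> is the continuous kernel of \<open>T t\<close> issued from \<open>x\<^sub>0\<close>, with respect to \<open>cp_measure\<close>.\<close>

definition is_heat_kernel_from ::
    "'n::finite cp_point \<Rightarrow> (real \<Rightarrow> ('n cp_point \<Rightarrow> real) \<Rightarrow> 'n cp_point \<Rightarrow> real) \<Rightarrow>
     (real \<Rightarrow> 'n cp_point \<Rightarrow> real) \<Rightarrow> bool" where
  "is_heat_kernel_from x\<^sub>0 T h \<longleftrightarrow>
     (\<forall>t>0. cp_continuous (h t) \<and>
        (\<forall>f. cp_continuous f \<longrightarrow> T t f x\<^sub>0 = (\<integral>x. h t x * f x \<partial>cp_measure)))"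

definition is_subelliptic_heat_kernel :: "(real \<Rightarrow> 'n::finite cp_point \<Rightarrow> real) \<Rightarrow> bool" where
  "is_subelliptic_heat_kernel h \<longleftrightarrow>
     (\<exists>T. is_heat_semigroup T \<and> is_heat_kernel_from cp_north T h)"

text \<open>The point \<open>x\<close>, with representative \<open>q\<close>, has the coordinates \<open>(r, \<phi>)\<close>, where
  \<open>q_(n+1) / |q_(n+1)| = a + bJ\<close> and \<open>|a| = cos \<phi>\<close>.\<close>

definition has_coords :: "'n::finite cp_point \<Rightarrow> real \<Rightarrow> real \<Rightarrow> bool" where
  "has_coords x r \<phi> \<longleftrightarrow>
     (\<exists>q\<in>sphere 0 1. x = circle_orbit q \<and>
        norm (snd q) = cos r \<and> norm (fst (snd q /\<^sub>R norm (snd q))) = cos \<phi>)"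


subsection \<open>The heat kernel of \<open>S^(4n+3)\<close>\<close>

fun gegenbauer :: "real \<Rightarrow> nat \<Rightarrow> real \<Rightarrow> real" where
  "gegenbauer l 0 x = 1"
| "gegenbauer l (Suc 0) x = 2 * l * x"
| "gegenbauer l (Suc (Suc m)) x =
     (2 * (real m + 1 + l) * x * gegenbauer l (Suc m) x - (real m + 2 * l) * gegenbauer l m x)
       / (real m + 2)"

text \<open>The heat kernel of \<open>S^(4n+3)\<close> as a function of \<open>x = cos \<delta>\<close>, continued to \<open>x > 1\<close>.\<close>

definition sphere_heat_kernel :: "nat \<Rightarrow> real \<Rightarrow> real \<Rightarrow> real" where
  "sphere_heat_kernel n t x =
     Gamma (2 * real n + 1) / (2 * pi ^ (2 * n + 2)) *
     (\<Sum>m. (real m + 2 * real n + 1) * exp (- (real m * (real m + 4 * real n + 2) * t)) *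
           gegenbauer (2 * real n + 1) m x)"

end

theory Submission
  imports Defs "HOL-Probability.Characteristic_Functions"
begin

text \<open>On the sphere the sub-Laplacian is the difference of the Laplacian of \<open>S^(4n+3)\<close> and the Casimir
  operator of \<open>SU(2)\<close>, and these commute. Let \<open>w\<close> be the quaternionic inner product of \<open>q\<close> with a
  fixed pole \<open>p\<close> and expand the zonal harmonic \<open>C_m(Re w)\<close>, \<open>C_m = C_m^(2n+1)\<close>, in the homogeneous
  Chebyshev polynomials \<open>|w|^j U_j(Re w / |w|)\<close>, whose Casimir eigenvalues are \<open>- j (j + 2)\<close>. The
  components are eigenfunctions of the sub-Laplacian with eigenvalues
  \<open>- (m (m + 4n + 2) - j (j + 2))\<close>, and so are their averages over the circle, which live on
  \<open>CP^(2n+1)\<close>. Hence the semigroup acts on them by scalars, which gives the integral of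
  \<open>h_t(q) C_m(q \<bullet> p)\<close> over the sphere for every \<open>p\<close> and \<open>m\<close>. Summing these against \<open>s^m\<close> produces the Poisson
  kernel, an approximate identity as \<open>s\<close> tends to \<open>1\<close>, so \<open>h_t(p)\<close> is recovered as a series.

  The integral over \<open>y\<close> turns \<open>sinh ((j + 1) y)\<close> into \<open>exp ((j + 1)^2 t) sin ((j + 1) \<delta>)\<close>, which
  inserts exactly the Casimir factors into the series of \<open>q_t\<close>, and the integral over \<open>\<theta>\<close> is the
  average over the circle.\<close>


subsection \<open>Gegenbauer polynomials and their expansion in Chebyshev polynomials\<close>

text \<open>The semigroup is given by axioms only and the sub-Laplacian by second derivatives in an
  unspecified frame, so the eigenvalue equation is checked by hand on monomials in \<open>zS\<close>
  and \<open>zY\<close>. It reduces to three two-term recursions between coefficients: the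
  Gegenbauer equation (\<open>geg_coeff_ODE\<close>), the radial step \<open>ballot_step\<close>,
  and the Legendre equation (\<open>leg_coeff_Suc\<close>). Legendre polynomials appear because they
  are the circle averages of the Chebyshev polynomials of even degree; those of odd degree average
  to zero. The obstacle to convergence is that the eigenvalue grows only linearly, like 4nm, when j
  = m: the factor exp((j+1)^2 t) from the y-integral uses up the quadratic decay of the series of
  q_t. What remains, exp(-4nmt), must beat the coefficients. Polynomial bounds on these come from
  orthogonality and generating functions, as the explicit formulas alternate in sign. Since (j+1)^2
  = j(j+2) + 1, the y-integral also leaves a factor e^t, the origin of the prefactor e^(-t).\<close>

fun hgegenbauer :: "real \<Rightarrow> nat \<Rightarrow> real \<Rightarrow> real \<Rightarrow> real" where
  "hgegenbauer l 0 x Y = 1"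
| "hgegenbauer l (Suc 0) x Y = 2 * l * x"
| "hgegenbauer l (Suc (Suc m)) x Y =
     (2 * (real m + 1 + l) * x * hgegenbauer l (Suc m) x Y - (real m + 2 * l) * Y * hgegenbauer l m x Y)
       / (real m + 2)"

text \<open>Setting \<open>Y = 1\<close> undoes the homogenization. With \<open>x\<close> of weight
  one and \<open>Y\<close> of weight two, \<open>hgegenbauer\<close> is homogeneous of weight
  \<open>m\<close>; for Y = |w|^2 it is therefore polynomial in the coordinates of w, also where w =
  0.\<close>

lemma gegenbauer_eq_hgegenbauer: "gegenbauer l m x = hgegenbauer l m x 1"
  by (induction l m x rule: gegenbauer.induct) simp_all

text \<open>The value zero above the degree and for the wrong parity lets all sums run over full
  ranges and makes the rounding in \<open>(m - i) div 2\<close> harmless.\<close>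

definition geg_coeff :: "real \<Rightarrow> nat \<Rightarrow> nat \<Rightarrow> real" where
  "geg_coeff l m i =
     (if i \<le> m \<and> even (m - i)
      then (- 1) ^ ((m - i) div 2) * pochhammer l (i + (m - i) div 2) * 2 ^ i /
           (fact ((m - i) div 2) * fact i)
      else 0)"

lemma geg_coeff_simps:
  "geg_coeff l (i + 2 * k) i = (- 1) ^ k * pochhammer l (i + k) * 2 ^ i / (fact k * fact i)"
  "m < i \<Longrightarrow> geg_coeff l m i = 0"
  "odd (m + i) \<Longrightarrow> geg_coeff l m i = 0"
  by (auto simp: geg_coeff_def)

text \<open>Coefficient identities are checked in these four regions: the tables vanish in the first
  two, the diagonal is the boundary case, and \<open>Suc k\<close> in the last leaves a predecessor
  from which the ratio recursions start.\<close>

lemma parity_cases: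
  fixes m i :: nat
  obtains "m < i" | "odd (m + i)" | "m = i" | k where "m = i + 2 * Suc k"
proof (cases "i \<le> m \<and> even (m - i)")
  case True
  then obtain k where "m - i = 2 * k" by blast
  with True have "m = i + 2 * k" by linarith
  then show thesis using that by (cases k) auto
qed (use that in force)

text \<open>Ratios of neighbours, with \<open>i\<close> fixed and along the diagonal. They turn each
  coefficient identity into one between rational functions times a single common
  coefficient.\<close>

lemma geg_coeff_rec:
  "geg_coeff l (i + 2 * Suc k) i = - (l + real i + real k) / (real k + 1) * geg_coeff l (i + 2 * k) i"
  "geg_coeff l (Suc i + 2 * k) (Suc i) = 2 * (l + real i + real k) / (real i + 1) * geg_coeff l (i + 2 * k) i"
  unfolding geg_coeff_simps(1) by (simp_all add: pochhammer_Suc divide_simps) (simp_all add: algebra_simps)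

lemma geg_coeff_Suc_Suc:
  "(real m + 2) * geg_coeff l (Suc (Suc m)) i =
   2 * (real m + 1 + l) * (if i = 0 then 0 else geg_coeff l (Suc m) (i - 1)) -
   (real m + 2 * l) * geg_coeff l m i"
proof -
  show ?thesis
  proof (cases rule: parity_cases[of "m + 2" i])
    case 2
    then have "odd (m + i)" by presburger
    moreover from this have "odd (Suc m + (i - 1))" if "i > 0" using that by presburger
    ultimately show ?thesis by (simp add: geg_coeff_simps(3))
  next
    case 3
    have diag: "geg_coeff l i i = pochhammer l i * 2 ^ i / fact i" for i
      by (simp add: geg_coeff_def)
    show ?thesis using 3[symmetric] by (simp add: diag geg_coeff_simps(2) pochhammer_Suc divide_simps)
      (simp add: algebra_simps)
  next
    case (4 k)
    then have m: "m = i + 2 * k" by simp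
    show ?thesis
    proof (cases i)
      case 0
      have eq: "geg_coeff l (Suc (Suc m)) i = - (l + real k) / (real k + 1) * geg_coeff l m i"
        using geg_coeff_rec(1)[of l 0 k] m 0 by simp
      show ?thesis unfolding eq using m 0 by (simp add: divide_simps) (simp add: algebra_simps)
    next
      case (Suc a)
      \<comment> \<open>All three coefficients are multiples of this one, the entry at (m - 1, i -
        1).\<close>
      obtain c where c: "c = geg_coeff l (a + 2 * k) a" by simp
      have e1: "geg_coeff l m i = 2 * (l + real a + real k) / (real a + 1) * c"
        using geg_coeff_rec(2)[of l a k] m Suc c by simp
      have e2: "geg_coeff l (Suc (Suc m)) i = - (l + real i + real k) / (real k + 1) * geg_coeff l m i"
        using geg_coeff_rec(1)[of l i k] m by simp
      have e3: "geg_coeff l (Suc m) (i - 1) = - (l + real a + real k) / (real k + 1) * c"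
        using geg_coeff_rec(1)[of l a k] m Suc c by simp
      have "real m = real a + 1 + 2 * real k" "real i = real a + 1" using m Suc by auto
      then show ?thesis unfolding e2 e1 e3 using Suc
        by (simp add: divide_simps del: of_nat_Suc of_nat_add) (simp add: algebra_simps)
    qed
  qed (auto simp: geg_coeff_simps)
qed

lemma hgegenbauer_expansion:
  "hgegenbauer l m x Y = (\<Sum>i\<le>m. geg_coeff l m i * x ^ i * Y ^ ((m - i) div 2))"
proof (induction l m x Y rule: hgegenbauer.induct)
  case (2 l x Y)
  then show ?case by (simp add: geg_coeff_def)
next
  case (3 l m x Y)
  \<comment> \<open>Multiplication by \<open>x\<close> shifts the coefficients by one place and
    moves a zero in at \<open>i = 0\<close>.\<close>
  define c where "c i = (if i = 0 then 0 else geg_coeff l (Suc m) (i - 1))" for i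
  have A: "x * hgegenbauer l (Suc m) x Y = (\<Sum>i\<le>Suc (Suc m). c i * x ^ i * Y ^ ((Suc (Suc m) - i) div 2))"
    unfolding 3 sum_distrib_left
    by (simp only: c_def sum.atMost_Suc_shift[of _ "Suc m"] diff_Suc_1 diff_Suc_Suc power_Suc nat.simps if_False if_True mult_zero_left mult_zero_right add_0_left mult_ac simp_thms)
  have "Y * hgegenbauer l m x Y = (\<Sum>i\<le>m. geg_coeff l m i * x ^ i * Y ^ ((Suc (Suc m) - i) div 2))"
    unfolding 3 by (simp add: sum_distrib_left mult_ac Suc_diff_le)
  then have B: "Y * hgegenbauer l m x Y =
      (\<Sum>i\<le>Suc (Suc m). geg_coeff l m i * x ^ i * Y ^ ((Suc (Suc m) - i) div 2))"
    by (simp add: geg_coeff_simps)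
  have "(real m + 2) * hgegenbauer l (Suc (Suc m)) x Y =
      2 * (real m + 1 + l) * (x * hgegenbauer l (Suc m) x Y) - (real m + 2 * l) * (Y * hgegenbauer l m x Y)"
    by simp
  also have "\<dots> = (\<Sum>i\<le>Suc (Suc m). (2 * (real m + 1 + l) * c i - (real m + 2 * l) * geg_coeff l m i)
        * x ^ i * Y ^ ((Suc (Suc m) - i) div 2))"
    unfolding A B sum_distrib_left sum_subtractf[symmetric]
    by (intro sum.cong refl) (simp only: algebra_simps)
  also have "\<dots> = (real m + 2) * (\<Sum>i\<le>Suc (Suc m). geg_coeff l (Suc (Suc m)) i * x ^ i * Y ^ ((Suc (Suc m) - i) div 2))"
    unfolding sum_distrib_left c_def geg_coeff_Suc_Suc[symmetric] by (intro sum.cong refl) (simp only: mult_ac)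
  finally show ?case by simp
qed (simp add: geg_coeff_def)

text \<open>The differential equation (1 - x^2) y'' - (2l + 1) x y' + m (m + 2l) y = 0 of the
  Gegenbauer polynomials, read off coefficient by coefficient.\<close>

lemma geg_coeff_ODE:
  "(real i + 2) * (real i + 1) * geg_coeff l m (i + 2) =
   (real i * (real i + 2 * l) - real m * (real m + 2 * l)) * geg_coeff l m i"
proof -
  show ?thesis
  proof (cases rule: parity_cases[of m i])
    case 2
    then have "odd (m + i)" by presburger
    then show ?thesis by (simp add: geg_coeff_simps(3))
  next
    case (4 k)
    obtain c where c: "c = geg_coeff l (i + 2 * k) i" by simp
    have e1: "geg_coeff l m i = - (l + real i + real k) / (real k + 1) * c"
      using geg_coeff_rec(1)[of l i k] 4 c by simp
    have "geg_coeff l (Suc i + 2 * k) (Suc i) = 2 * (l + real i + real k) / (real i + 1) * c"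
      using geg_coeff_rec(2)[of l i k] c by simp
    then have e2: "geg_coeff l m (i + 2) =
        2 * (l + (real i + 1) + real k) / ((real i + 1) + 1) * (2 * (l + real i + real k) / (real i + 1) * c)"
      using geg_coeff_rec(2)[of l "Suc i" k] 4 by simp
    have "real m = real i + 2 * (real k + 1)" using 4 by simp
    then show ?thesis unfolding e1 e2
      by (simp add: divide_simps del: of_nat_Suc of_nat_add) (auto simp: algebra_simps)
  qed (auto simp: geg_coeff_simps)
qed

section \<open>Homogeneous Chebyshev polynomials of the second kind\<close>

abbreviation chebH :: "nat \<Rightarrow> real \<Rightarrow> real \<Rightarrow> real" where
  "chebH \<equiv> hgegenbauer 1"

lemma chebH_Suc_Suc: "chebH (Suc (Suc m)) x Y = 2 * x * chebH (Suc m) x Y - Y * chebH m x Y"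
  by (simp add: field_simps)

text \<open>Ballot numbers divided by 2^i: they count the lattice paths from 0 to j with i unit
  steps that stay nonnegative. They occur because multiplying U_j by x gives half the sum of its two
  neighbours.\<close>

definition ballot :: "nat \<Rightarrow> nat \<Rightarrow> real" where
  "ballot i j =
     (if j \<le> i \<and> even (i - j)
      then fact i * (real j + 1) / (2 ^ i * fact ((i - j) div 2) * fact (j + (i - j) div 2 + 1))
      else 0)"

lemma ballot_simps:
  "ballot (j + 2 * k) j = fact (j + 2 * k) * (real j + 1) / (2 ^ (j + 2 * k) * fact k * fact (j + k + 1))"
  "i < j \<Longrightarrow> ballot i j = 0"
  "odd (i + j) \<Longrightarrow> ballot i j = 0"
  by (auto simp: ballot_def)

lemma ballot_rec:
  "ballot (j + 2 * Suc k) j = (real j + 2 * real k + 2) * (real j + 2 * real k + 1) /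
     (4 * (real k + 1) * (real j + real k + 2)) * ballot (j + 2 * k) j"
  "ballot (Suc j + 2 * k) (Suc j) = (real j + 2 * real k + 1) * (real j + 2) /
     (2 * (real j + 1) * (real j + real k + 2)) * ballot (j + 2 * k) j"
proof -
  have nz: "real j + real k + 2 \<noteq> 0" "real j + 2 * real k + 2 \<noteq> 0" "real k + 1 \<noteq> 0"
     "real j + real k + 1 \<noteq> 0" "real j + 1 \<noteq> 0" by linarith+
  obtain F where F: "F = (fact (j + 2 * k) :: real)" by simp
  obtain G where G: "G = (fact (j + k) :: real)" by simp
  have f: "(fact (j + 2 * Suc k) :: real) = (real j + 2 * real k + 2) * (real j + 2 * real k + 1) * F"
    "(fact (Suc j + 2 * k) :: real) = (real j + 2 * real k + 1) * F"
    "(fact (j + k + 1) :: real) = (real j + real k + 1) * G"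
    "(fact (Suc j + k + 1) :: real) = (real j + real k + 2) * ((real j + real k + 1) * G)"
    "(fact (j + Suc k + 1) :: real) = (real j + real k + 2) * ((real j + real k + 1) * G)"
    "(fact (Suc k) :: real) = (real k + 1) * fact k"
    "(2 :: real) ^ (j + 2 * Suc k) = 4 * 2 ^ (j + 2 * k)" "(2 :: real) ^ (Suc j + 2 * k) = 2 * 2 ^ (j + 2 * k)"
    "real (Suc j) + 1 = real j + 2"
    by (simp_all add: F G algebra_simps)
  have pos: "F > 0" "G > 0" "(fact k :: real) > 0" "(2::real) ^ (j + 2 * k) > 0" by (simp_all add: F G)
  show "ballot (j + 2 * Suc k) j = (real j + 2 * real k + 2) * (real j + 2 * real k + 1) /
     (4 * (real k + 1) * (real j + real k + 2)) * ballot (j + 2 * k) j"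
    unfolding ballot_simps(1) f F[symmetric] using nz pos by (simp add: divide_simps)
  show "ballot (Suc j + 2 * k) (Suc j) = (real j + 2 * real k + 1) * (real j + 2) /
     (2 * (real j + 1) * (real j + real k + 2)) * ballot (j + 2 * k) j"
    unfolding ballot_simps(1) f F[symmetric] using nz pos by (simp add: divide_simps)
qed

text \<open>The last step of a path ending at j comes from j + 1 or from j - 1, the latter only if j
  > 0.\<close>

lemma ballot_Suc: "ballot (Suc i) j = (ballot i (Suc j) + (if j = 0 then 0 else ballot i (j - 1))) / 2"
proof -
  show ?thesis
  proof (cases rule: parity_cases[of "Suc i" j])
    case 2
    then have "odd (Suc i + j)" by presburger
    moreover from this have "odd (i + (j - 1))" if "j > 0" using that by presburger
    ultimately show ?thesis by (simp add: ballot_simps(3))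
  next
    case 3
    have "ballot i i = 1 / 2 ^ i" for i
      by (simp add: ballot_def divide_simps)
    then show ?thesis using 3 by (auto simp: ballot_simps(2))
  next
    case (4 k)
    show ?thesis
    proof (cases j)
      case 0
      obtain c :: real where c: "c = ballot (0 + 2 * k) 0" by simp
      have e1: "ballot (Suc i) j = (2 * real k + 2) * (2 * real k + 1) / (4 * (real k + 1) * (real k + 2)) * c"
        using ballot_rec(1)[of 0 k] 4 0 c by simp
      have e2: "ballot i (Suc j) = (2 * real k + 1) * 2 / (2 * (real k + 2)) * c"
        using ballot_rec(2)[of 0 k] 4 0 c by simp
      show ?thesis unfolding e1 e2 using 0
        by (simp add: divide_simps) (auto simp: algebra_simps)
    next
      case (Suc a)
      obtain c where c: "c = ballot (a + 2 * k) a" by simp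
      have e0: "ballot (j + 2 * k) j =
          (real a + 2 * real k + 1) * (real a + 2) / (2 * (real a + 1) * (real a + real k + 2)) * c"
        using ballot_rec(2)[of a k] Suc c by simp
      have e1: "ballot (Suc i) j = (real a + 1 + 2 * real k + 2) * (real a + 1 + 2 * real k + 1) /
          (4 * (real k + 1) * (real a + 1 + real k + 2)) * ballot (j + 2 * k) j"
        using ballot_rec(1)[of j k] 4 Suc by (simp add: add_ac)
      have e2: "ballot i (Suc j) = (real a + 1 + 2 * real k + 1) * (real a + 1 + 2) /
          (2 * (real a + 1 + 1) * (real a + 1 + real k + 2)) * ballot (j + 2 * k) j"
        using ballot_rec(2)[of j k] 4 Suc by (simp add: add_ac)
      have e3: "ballot i (j - 1) = (real a + 2 * real k + 2) * (real a + 2 * real k + 1) /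
          (4 * (real k + 1) * (real a + real k + 2)) * c"
        using ballot_rec(1)[of a k] 4 Suc c by simp
      have nz: "real a + 1 \<noteq> 0" "real a + real k + 2 \<noteq> 0" "real k + 1 \<noteq> 0"
        "real a + 1 + real k + 2 \<noteq> 0" "real a + 1 + 1 \<noteq> 0" by linarith+
      show ?thesis unfolding e1 e2 e3 e0 using Suc nz
        by (simp add: divide_simps) (auto simp: algebra_simps)
    qed
  qed (auto simp: ballot_simps)
qed

lemma power_expand_chebH: "x ^ i = (\<Sum>j\<le>i. ballot i j * Y ^ ((i - j) div 2) * chebH j x Y)"
proof (induction i)
  case (Suc i)
  have x: "x * chebH j x Y = (chebH (Suc j) x Y + (if j = 0 then 0 else Y * chebH (j - 1) x Y)) / 2" for j
    by (cases j) (simp_all only: chebH_Suc_Suc, simp_all)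
  define A where "A = (\<Sum>j\<le>i. ballot i j * Y ^ ((i - j) div 2) * chebH (Suc j) x Y)"
  define B where "B = (\<Sum>j\<le>i. ballot i j * Y ^ ((i - j) div 2) * (if j = 0 then 0 else Y * chebH (j - 1) x Y))"
  have "x ^ Suc i = (\<Sum>j\<le>i. ballot i j * Y ^ ((i - j) div 2) * (x * chebH j x Y))"
    using Suc by (simp add: sum_distrib_left mult_ac)
  also have "\<dots> = (A + B) / 2"
    unfolding x A_def B_def sum.distrib[symmetric] sum_divide_distrib
    by (intro sum.cong refl) (simp add: field_simps)
  finally have x_AB: "x ^ Suc i = (A + B) / 2" .
  have A: "A = (\<Sum>j\<le>Suc i. (if j = 0 then 0 else ballot i (j - 1)) * Y ^ ((Suc i - j) div 2) * chebH j x Y)"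
    unfolding A_def sum.atMost_Suc_shift[of _ i] by simp
  have B: "B = (\<Sum>j\<le>Suc i. ballot i (Suc j) * Y ^ ((Suc i - j) div 2) * chebH j x Y)"
  proof -
    have "B = (\<Sum>j\<le>Suc i. ballot i j * Y ^ ((i - j) div 2) * (if j = 0 then 0 else Y * chebH (j - 1) x Y))"
      unfolding B_def by (simp add: ballot_simps)
    also have "\<dots> = (\<Sum>j\<le>i. ballot i (Suc j) * Y ^ ((i - Suc j) div 2) * (Y * chebH j x Y))"
      by (subst sum.atMost_Suc_shift) simp
    also have "\<dots> = (\<Sum>j\<le>i. ballot i (Suc j) * Y ^ ((Suc i - j) div 2) * chebH j x Y)"
    proof (intro sum.cong refl)
      fix j assume "j \<in> {..i}"
      show "ballot i (Suc j) * Y ^ ((i - Suc j) div 2) * (Y * chebH j x Y) =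
            ballot i (Suc j) * Y ^ ((Suc i - j) div 2) * chebH j x Y"
      proof (cases "Suc j \<le> i")
        case True
        then have "(Suc i - j) div 2 = Suc ((i - Suc j) div 2)" by (simp add: Suc_diff_le flip: Suc_diff_Suc)
        then show ?thesis by simp
      qed (simp add: ballot_simps)
    qed
    finally show ?thesis by (simp add: ballot_simps)
  qed
  show ?case unfolding x_AB A B sum.distrib[symmetric] sum_divide_distrib ballot_Suc
    by (intro sum.cong refl) (simp only: ring_distribs add_divide_distrib times_divide_eq_left)
qed (simp add: ballot_def)

text \<open>The factor on the left is (i + 2) (i + 4) - j (j + 2), up to sign a difference of
  Casimir eigenvalues. This recursion is the source of the term j (j + 2) in
  \<open>eigval\<close>.\<close>

lemma ballot_step:
  "(real i + 2 - real j) * (real i + real j + 4) * ballot (i + 2) j = (real i + 2) * (real i + 1) * ballot i j"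
proof -
  show ?thesis
  proof (cases rule: parity_cases[of "i + 2" j])
    case 2
    then have "odd (i + j)" by presburger
    then show ?thesis by (simp add: ballot_simps(3))
  next
    case (4 k')
    then obtain k where 4: "i = j + 2 * k" by auto
    obtain c where c: "c = ballot (j + 2 * k) j" by simp
    have e: "ballot (i + 2) j = (real j + 2 * real k + 2) * (real j + 2 * real k + 1) /
        (4 * (real k + 1) * (real j + real k + 2)) * c" "ballot i j = c"
      using ballot_rec(1)[of j k] 4 c by simp_all
    have "real i = real j + 2 * real k" "real k + 1 \<noteq> 0" "real j + real k + 2 \<noteq> 0" using 4 by auto
    then show ?thesis unfolding e by (simp add: divide_simps) (auto simp: algebra_simps)
  qed (auto simp: ballot_simps)
qed

text \<open>The classical quotient sin ((j + 1) \<eta>) / sin \<eta> for U_j, multiplied out so that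
  zeros of the sine need no separate treatment.\<close>

lemma chebH_cos: "chebH j (\<rho> * cos \<eta>) (\<rho>^2) * sin \<eta> = \<rho> ^ j * sin (real (j + 1) * \<eta>)"
proof (induction j rule: induct_nat_012)
  case 1
  then show ?case by (simp add: sin_double)
next
  case (ge2 j)
  have "2 * cos \<eta> * sin (real (Suc j + 1) * \<eta>) - sin (real (j + 1) * \<eta>) = sin (real (Suc (Suc j) + 1) * \<eta>)"
    using sin_add[of "real (Suc j + 1) * \<eta>" \<eta>] sin_diff[of "real (Suc j + 1) * \<eta>" \<eta>]
    by (simp add: algebra_simps)
  note trig = this
  have "chebH (Suc (Suc j)) (\<rho> * cos \<eta>) (\<rho>^2) * sin \<eta> =
      2 * \<rho> * cos \<eta> * (chebH (Suc j) (\<rho> * cos \<eta>) (\<rho>^2) * sin \<eta>) - \<rho>\<^sup>2 * (chebH (j) (\<rho> * cos \<eta>) (\<rho>^2) * sin \<eta>)"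
    unfolding chebH_Suc_Suc by (simp add: algebra_simps)
  also have "\<dots> = \<rho> ^ Suc (Suc j) * (2 * cos \<eta> * sin (real (Suc j + 1) * \<eta>) - sin (real (j + 1) * \<eta>))"
    unfolding ge2 by (simp only: power_Suc power2_eq_square right_diff_distrib mult_ac)
  finally show ?case unfolding trig .
qed simp

text \<open>The hyperbolic counterpart; the factor \<open>sinh y\<close> is the one in the integrand
  of the theorem.\<close>

lemma chebH_cosh: "chebH j (\<rho> * cosh y) (\<rho>^2) * sinh y = \<rho> ^ j * sinh (real (j + 1) * y)"
proof (induction j rule: induct_nat_012)
  case 1
  then show ?case by (simp add: sinh_double)
next
  case (ge2 j)
  have "2 * cosh y * sinh (real (Suc j + 1) * y) - sinh (real (j + 1) * y) = sinh (real (Suc (Suc j) + 1) * y)"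
    using sinh_add[of "real (Suc j + 1) * y" y] sinh_diff[of "real (Suc j + 1) * y" y]
    by (simp add: algebra_simps)
  note trig = this
  have "chebH (Suc (Suc j)) (\<rho> * cosh y) (\<rho>^2) * sinh y =
      2 * \<rho> * cosh y * (chebH (Suc j) (\<rho> * cosh y) (\<rho>^2) * sinh y) - \<rho>\<^sup>2 * (chebH (j) (\<rho> * cosh y) (\<rho>^2) * sinh y)"
    unfolding chebH_Suc_Suc by (simp add: algebra_simps)
  also have "\<dots> = \<rho> ^ Suc (Suc j) * (2 * cosh y * sinh (real (Suc j + 1) * y) - sinh (real (j + 1) * y))"
    unfolding ge2 by (simp only: power_Suc power2_eq_square right_diff_distrib mult_ac)
  finally show ?case unfolding trig .
qed simp

text \<open>Arises from inserting \<open>power_expand_chebH\<close> into the power expansion of C_m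
  and collecting the multiples of \<open>chebH j\<close>.\<close>

definition rad_coeff :: "real \<Rightarrow> nat \<Rightarrow> nat \<Rightarrow> real \<Rightarrow> real" where
  "rad_coeff l m j Y = (\<Sum>i\<le>m. geg_coeff l m i * ballot i j * Y ^ ((i - j) div 2))"

text \<open>The left side does not contain \<open>Y\<close>, so the expansion holds for every value
  of it. Later it is |w|^2, which varies with the point of the sphere.\<close>

lemma gegenbauer_decomposition:
  "gegenbauer l m x = (\<Sum>j\<le>m. rad_coeff l m j Y * chebH j x Y)"
proof -
  have "gegenbauer l m x = (\<Sum>i\<le>m. geg_coeff l m i * x ^ i)"
    by (simp add: gegenbauer_eq_hgegenbauer hgegenbauer_expansion)
  also have "\<dots> = (\<Sum>i\<le>m. \<Sum>j\<le>m. geg_coeff l m i * ballot i j * Y ^ ((i - j) div 2) * chebH j x Y)"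
  proof (intro sum.cong refl)
    fix i assume i: "i \<in> {..m}"
    have "x ^ i = (\<Sum>j\<le>m. ballot i j * Y ^ ((i - j) div 2) * chebH j x Y)"
      unfolding power_expand_chebH[of x i Y] using i
      by (intro sum.mono_neutral_left) (auto simp: ballot_simps)
    then show "geg_coeff l m i * x ^ i =
        (\<Sum>j\<le>m. geg_coeff l m i * ballot i j * Y ^ ((i - j) div 2) * chebH j x Y)"
      by (simp add: sum_distrib_left mult_ac)
  qed
  also have "\<dots> = (\<Sum>j\<le>m. rad_coeff l m j Y * chebH j x Y)"
    unfolding rad_coeff_def sum_distrib_right by (rule sum.swap)
  finally show ?thesis .
qed

lemma integral_sin_mult_sin:
  assumes "j \<ge> 1" "k \<ge> 1"
  shows "((\<lambda>x. sin (real j * x) * sin (real k * x)) has_integral (if j = k then pi / 2 else 0)) {0..pi}"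
proof -
  have cos_int: "((\<lambda>x. cos (of_int a * x)) has_integral (if a = 0 then pi else 0)) {0..pi}" for a :: int
  proof (cases "a = 0")
    case False
    have "((\<lambda>x. cos (of_int a * x)) has_integral (sin (of_int a * pi) / of_int a - sin (of_int a * 0) / of_int a)) {0..pi}"
      using False by (intro fundamental_theorem_of_calculus)
        (auto intro!: derivative_eq_intros simp: has_real_derivative_iff_has_vector_derivative[symmetric])
    then show ?thesis using False sin_int_times_real[of a] by (simp add: mult.commute)
  next
    case True
    have "((\<lambda>x::real. 1::real) has_integral (pi - 0) *\<^sub>R 1) {0..pi}"
      by (rule has_integral_eq_rhs[OF has_integral_const_real]) simp
    then show ?thesis using True by simp
  qed
  have "((\<lambda>x. (cos (of_int (int j - int k) * x) - cos (of_int (int j + int k) * x)) / 2) has_integral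
      ((if int j - int k = 0 then pi else 0) - (if int j + int k = 0 then pi else 0)) / 2) {0..pi}"
    by (intro has_integral_divide has_integral_diff cos_int)
  moreover have "(cos (of_int (int j - int k) * x) - cos (of_int (int j + int k) * x)) / 2 =
      sin (real j * x) * sin (real k * x)" for x :: real
    by (simp add: algebra_simps cos_add cos_diff)
  ultimately show ?thesis using assms by (simp only:) (auto split: if_splits)
qed

text \<open>Multiplied by sin x, the expansion of C_m(\<rho> cos x) is a finite sine series with
  coefficients \<open>rad_coeff l m j (\<rho>^2) * \<rho> ^ j\<close>. Each is thus a Fourier
  coefficient and inherits the bound M, times pi / (pi / 2) = 2.\<close>

lemma rad_coeff_bound:
  assumes bound: "\<And>x. \<bar>x\<bar> \<le> 1 \<Longrightarrow> \<bar>gegenbauer l m x\<bar> \<le> M" and \<rho>: "\<bar>\<rho>\<bar> \<le> 1" and j: "j \<le> m"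
  shows "\<bar>rad_coeff l m j (\<rho>^2) * \<rho> ^ j\<bar> \<le> 2 * M"
proof -
  define f where "f k = rad_coeff l m k (\<rho>^2) * \<rho> ^ k" for k
  define g where "g x = gegenbauer l m (\<rho> * cos x) * sin x * sin (real (j + 1) * x)" for x
  have eq: "g x = (\<Sum>k\<le>m. f k * (sin (real (k + 1) * x) * sin (real (j + 1) * x)))" for x
  proof -
    have "gegenbauer l m (\<rho> * cos x) * sin x = (\<Sum>k\<le>m. rad_coeff l m k (\<rho>^2) * (chebH k (\<rho> * cos x) (\<rho>^2) * sin x))"
      unfolding gegenbauer_decomposition[of l m "\<rho> * cos x" "\<rho>^2"] sum_distrib_right by (simp only: mult.assoc)
    also have "\<dots> = (\<Sum>k\<le>m. f k * sin (real (k + 1) * x))"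
      unfolding chebH_cos f_def by (simp add: mult_ac)
    finally have e: "gegenbauer l m (\<rho> * cos x) * sin x = (\<Sum>k\<le>m. f k * sin (real (k + 1) * x))" .
    show ?thesis unfolding g_def e sum_distrib_right by (simp only: mult.assoc)
  qed
  have "(g has_integral (\<Sum>k\<le>m. f k * (if k + 1 = j + 1 then pi / 2 else 0))) {0..pi}"
    unfolding eq by (intro has_integral_sum has_integral_mult_right integral_sin_mult_sin) auto
  also have "(\<Sum>k\<le>m. f k * (if k + 1 = j + 1 then pi / 2 else 0)) = f j * (pi / 2)"
    using j by (simp add: if_distrib[of "(*) _"] cong: if_cong)
  finally have g: "(g has_integral f j * (pi / 2)) (cbox 0 pi)" by simp
  have M: "M \<ge> 0" using bound[of 0] by simp
  have "norm (f j * (pi / 2)) \<le> M * measure lborel (cbox 0 pi)"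
  proof (rule has_integral_bound[OF M g])
    fix x :: real
    have "\<bar>\<rho> * cos x\<bar> \<le> 1" using \<rho> by (simp add: abs_mult mult_le_one)
    then have "\<bar>gegenbauer l m (\<rho> * cos x)\<bar> * (\<bar>sin x\<bar> * \<bar>sin (real (j + 1) * x)\<bar>) \<le> M * 1"
      by (intro mult_mono bound mult_le_one) (auto intro: M)
    then show "norm (g x) \<le> M" by (simp add: g_def abs_mult mult.assoc)
  qed
  then show ?thesis by (simp add: f_def abs_mult) 
qed

section \<open>Averages over a circle and Legendre polynomials\<close>

definition avg_coeff :: "nat \<Rightarrow> real" where
  "avg_coeff i = (if even i then fact i / (2 ^ i * (fact (i div 2))^2) else 0)"

lemma avg_coeff_Suc_Suc: "avg_coeff (Suc (Suc i)) = (real i + 1) / (real i + 2) * avg_coeff i"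
proof (cases "even i")
  case True
  then obtain k where k: "i = 2 * k" by blast
  have "(fact (Suc k) :: real) = (real k + 1) * fact k" by simp
  moreover have "real k + 1 \<noteq> 0" "(fact k :: real) \<noteq> 0" by simp_all
  ultimately show ?thesis unfolding k avg_coeff_def
    by (simp add: divide_simps del: fact_Suc of_nat_Suc) (simp add: algebra_simps power2_eq_square)
qed (simp add: avg_coeff_def)

text \<open>Integration by parts: since u' = v, v' = - u and u^2 + v^2 is constant, the derivative
  of u^(i+1) v involves only u^i and u^(i+2). The hypothesis \<open>per\<close> removes the boundary
  terms both for a full turn and for half a turn with b = 0.\<close>

lemma circle_average_power:
  fixes a b c :: real
  defines "u \<equiv> (\<lambda>\<theta>. a * cos \<theta> + b * sin \<theta>)" and "v \<equiv> (\<lambda>\<theta>. b * cos \<theta> - a * sin \<theta>)"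
  assumes per: "\<And>i. u 0 ^ i * v 0 = u c ^ i * v c" and "c \<ge> 0"
  shows "((\<lambda>\<theta>. u \<theta> ^ i) has_integral c * avg_coeff i * (a^2 + b^2) ^ (i div 2)) {0..c}"
proof (induction i rule: induct_nat_012)
  case 0
  have "((\<lambda>x::real. 1::real) has_integral (c - 0) *\<^sub>R 1) {0..c}"
    using \<open>c \<ge> 0\<close> by (intro has_integral_eq_rhs[OF has_integral_const_real]) simp
  then show ?case by (simp add: avg_coeff_def)
next
  case 1
  have "(u has_integral (- v c - (- v 0))) {0..c}"
    unfolding u_def v_def using \<open>c \<ge> 0\<close> by (intro fundamental_theorem_of_calculus)
        (auto intro!: derivative_eq_intros simp: has_real_derivative_iff_has_vector_derivative[symmetric])
  then show ?case using per[of 0] by (simp add: avg_coeff_def)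
next
  case (ge2 i)
  have uv: "(u \<theta>)^2 + (v \<theta>)^2 = a^2 + b^2" for \<theta>
  proof -
    have "(u \<theta>)^2 + (v \<theta>)^2 = (a^2 + b^2) * ((sin \<theta>)^2 + (cos \<theta>)^2)"
      unfolding u_def v_def by (simp only: power2_eq_square algebra_simps)
    then show ?thesis by simp
  qed
  have du: "(u has_real_derivative v \<theta>) (at \<theta> within T)" for \<theta> T
    unfolding u_def v_def by (auto intro!: derivative_eq_intros)
  have dv: "(v has_real_derivative - u \<theta>) (at \<theta> within T)" for \<theta> T
    unfolding u_def v_def by (auto intro!: derivative_eq_intros)
  have "((\<lambda>\<theta>. u \<theta> ^ (i + 1) * v \<theta>) has_real_derivative
      (real i + 1) * (a^2 + b^2) * u \<theta> ^ i - (real i + 2) * u \<theta> ^ Suc (Suc i)) (at \<theta> within T)" for \<theta> T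
  proof -
    have "(real i + 1) * u \<theta> ^ i * v \<theta> * v \<theta> - u \<theta> * u \<theta> ^ (i + 1) =
        (real i + 1) * ((u \<theta>)^2 + (v \<theta>)^2) * u \<theta> ^ i - (real i + 2) * u \<theta> ^ Suc (Suc i)"
      by (simp add: algebra_simps power2_eq_square)
    then have *: "(real i + 1) * u \<theta> ^ i * v \<theta> * v \<theta> - u \<theta> * u \<theta> ^ (i + 1) =
        (real i + 1) * (a^2 + b^2) * u \<theta> ^ i - (real i + 2) * u \<theta> ^ Suc (Suc i)" by (simp only: uv)
    show ?thesis
      by (rule derivative_eq_intros du dv refl)+ (use * in \<open>simp add: algebra_simps\<close>)
  qed
  then have "((\<lambda>\<theta>. (real i + 1) * (a^2 + b^2) * u \<theta> ^ i - (real i + 2) * u \<theta> ^ Suc (Suc i)) has_integral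
     (u c ^ (i + 1) * v c - u 0 ^ (i + 1) * v 0)) {0..c}"
    using \<open>c \<ge> 0\<close> by (intro fundamental_theorem_of_calculus)
      (auto simp: has_real_derivative_iff_has_vector_derivative[symmetric])
  then have "((\<lambda>\<theta>. (real i + 1) * (a^2 + b^2) * u \<theta> ^ i - (real i + 2) * u \<theta> ^ Suc (Suc i)) has_integral 0) {0..c}"
    using per[of "i + 1"] by simp
  from has_integral_diff[OF has_integral_mult_right[OF ge2(1), of "(real i + 1) * (a^2 + b^2)"] this]
  have "((\<lambda>\<theta>. (real i + 2) * u \<theta> ^ Suc (Suc i)) has_integral
     (real i + 1) * (a^2 + b^2) * (c * avg_coeff i * (a^2 + b^2) ^ (i div 2))) {0..c}"
    by simp
  from has_integral_divide[OF this, of "real i + 2"]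
  have "((\<lambda>\<theta>. u \<theta> ^ Suc (Suc i)) has_integral
     (real i + 1) * (a^2 + b^2) * (c * avg_coeff i * (a^2 + b^2) ^ (i div 2)) / (real i + 2)) {0..c}"
    by (simp del: power_Suc)
  then show ?case unfolding avg_coeff_Suc_Suc by (simp add: field_simps del: power_Suc) (simp add: field_simps)
qed

text \<open>Odd powers average to zero, so the amplitude enters through its square S only. For j = 2
  J and nonzero Y this is Y^J P_J(2 S / Y - 1) with the Legendre polynomial P_J.\<close>

definition chebAvg :: "nat \<Rightarrow> real \<Rightarrow> real \<Rightarrow> real" where
  "chebAvg j S Y = (\<Sum>i\<le>j. geg_coeff 1 j i * avg_coeff i * S ^ (i div 2) * Y ^ ((j - i) div 2))"

lemma circle_average_chebH:
  fixes a :: real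
  shows "((\<lambda>\<theta>. chebH j (a * cos \<theta>) Y) has_integral pi * chebAvg j (a^2) Y) {0..pi}"
proof -
  have "((\<lambda>\<theta>. (a * cos \<theta>) ^ i) has_integral pi * avg_coeff i * (a^2) ^ (i div 2)) {0..pi}" for i
    using circle_average_power[of a 0 pi i] by simp
  then have "((\<lambda>\<theta>. \<Sum>i\<le>j. geg_coeff 1 j i * Y ^ ((j - i) div 2) * (a * cos \<theta>) ^ i) has_integral
    (\<Sum>i\<le>j. geg_coeff 1 j i * Y ^ ((j - i) div 2) * (pi * avg_coeff i * (a^2) ^ (i div 2)))) {0..pi}"
    by (intro has_integral_sum has_integral_mult_right) auto
  then show ?thesis unfolding hgegenbauer_expansion chebAvg_def
    by (simp add: sum_distrib_left mult_ac)
qed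

text \<open>Coefficients of the shifted Legendre polynomial P_J(2 s - 1).\<close>

definition leg_coeff :: "nat \<Rightarrow> nat \<Rightarrow> real" where
  "leg_coeff J p = (- 1) ^ (J - p) * fact (J + p) / (fact (J - p) * (fact p)^2)"

lemma chebAvg_odd: "odd j \<Longrightarrow> chebAvg j S Y = 0"
  unfolding chebAvg_def by (intro sum.neutral) (auto simp: avg_coeff_def geg_coeff_def)

lemma chebAvg_even: "chebAvg (2 * J) S Y = (\<Sum>p\<le>J. leg_coeff J p * S ^ p * Y ^ (J - p))"
proof -
  have "chebAvg (2 * J) S Y = (\<Sum>i\<in>(\<lambda>p. 2 * p) ` {..J}. geg_coeff 1 (2 * J) i * avg_coeff i * S ^ (i div 2) * Y ^ ((2 * J - i) div 2))"
    unfolding chebAvg_def by (intro sum.mono_neutral_right) (auto simp: avg_coeff_def image_iff elim!: evenE)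
  also have "\<dots> = (\<Sum>p\<le>J. geg_coeff 1 (2 * J) (2 * p) * avg_coeff (2 * p) * S ^ p * Y ^ (J - p))"
    by (subst sum.reindex) (auto simp: inj_on_def diff_mult_distrib2[symmetric])
  also have "\<dots> = (\<Sum>p\<le>J. leg_coeff J p * S ^ p * Y ^ (J - p))"
  proof (intro sum.cong refl)
    fix p assume p: "p \<in> {..J}"
    have "geg_coeff 1 (2 * J) (2 * p) = (- 1) ^ (J - p) * fact (J + p) * 2 ^ (2 * p) / (fact (J - p) * fact (2 * p))"
      using p geg_coeff_simps(1)[of 1 "2 * p" "J - p"] by (simp add: pochhammer_fact[symmetric] algebra_simps)
    then have "geg_coeff 1 (2 * J) (2 * p) * avg_coeff (2 * p) = leg_coeff J p"
      by (simp add: avg_coeff_def leg_coeff_def)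
    then show "geg_coeff 1 (2 * J) (2 * p) * avg_coeff (2 * p) * S ^ p * Y ^ (J - p) = leg_coeff J p * S ^ p * Y ^ (J - p)"
      by simp
  qed
  finally show ?thesis .
qed

text \<open>Legendre's differential equation for P_J(2 s - 1) on the level of coefficients.\<close>

lemma leg_coeff_Suc:
  assumes "p < J"
  shows "(real p + 1)^2 * leg_coeff J (Suc p) = - (real J - real p) * (real J + real p + 1) * leg_coeff J p"
proof -
  obtain k where k: "J = p + Suc k" using assms less_iff_Suc_add by auto
  have f: "(fact (p + Suc k + Suc p) :: real) = (2 * real p + real k + 2) * fact (p + Suc k + p)"
     "(fact (Suc p) :: real) = (real p + 1) * fact p" "(fact (Suc k) :: real) = (real k + 1) * fact k"
     "p + Suc k - Suc p = k" "p + Suc k - p = Suc k"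
    by (simp_all add: algebra_simps)
  have nz: "(fact p :: real) > 0" "(fact k :: real) > 0" "real p + 1 > 0" "real k + 1 > 0" by simp_all
  obtain F G H :: real where "F = fact p" "G = fact k" "H = fact (p + Suc k + p)" by simp
  then show ?thesis using nz unfolding k leg_coeff_def f
    by (simp add: divide_simps del: fact_Suc of_nat_Suc) (simp add: algebra_simps power2_eq_square)
qed

subsection \<open>The generating function and the Poisson kernel\<close>

unbundle fps_syntax

lemma power_le_fact_exp:
  assumes "x \<ge> (0::real)"
  shows "x ^ k \<le> fact k * exp x"
proof -
  have "(\<Sum>n\<in>{k}. x ^ n /\<^sub>R fact n) \<le> (\<Sum>n. x ^ n /\<^sub>R fact n)"
    using assms by (intro sum_le_suminf summable_exp_generic) auto
  then show ?thesis by (simp add: exp_def field_simps)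
qed

text \<open>Half of the exponent absorbs the power of m + 1, the other half leaves a geometric
  series.\<close>

lemma summable_poly_exp:
  assumes "(c::real) > 0"
  shows "summable (\<lambda>m. (real m + 1) ^ k * exp (- c * real m))"
proof (rule summable_comparison_test')
  let ?C = "fact k / (c / 2) ^ k * exp (c / 2)"
  have "summable (\<lambda>m. exp (- (c / 2)) ^ m)" using assms by (intro summable_geometric) simp
  then show "summable (\<lambda>m. ?C * exp (- (c / 2)) ^ m)" by (rule summable_mult)
  fix m :: nat assume "m \<ge> 0"
  have "(c / 2 * (real m + 1)) ^ k \<le> fact k * exp (c / 2 * (real m + 1))"
    using assms by (intro power_le_fact_exp) simp
  then have "(real m + 1) ^ k \<le> fact k / (c / 2) ^ k * exp (c / 2 * (real m + 1))"
    using assms unfolding power_mult_distrib by (simp add: pos_le_divide_eq mult.commute)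
  then have "(real m + 1) ^ k * exp (- c * real m) \<le>
      fact k / (c / 2) ^ k * exp (c / 2 * (real m + 1)) * exp (- c * real m)"
    by (intro mult_right_mono) auto
  also have "\<dots> = fact k / (c / 2) ^ k * exp (c / 2 + - (c / 2) * real m)"
    unfolding mult.assoc exp_add[symmetric]
    by (intro arg_cong2[where f = "(*)"] arg_cong[where f = exp] refl) (simp add: field_simps)
  also have "\<dots> = ?C * exp (- (c / 2)) ^ m"
    by (simp only: exp_add exp_of_nat_mult[symmetric] mult.assoc) (simp add: mult.commute)
  finally show "norm ((real m + 1) ^ k * exp (- c * real m)) \<le> ?C * exp (- (c / 2)) ^ m" by simp
qed

lemma summable_poly_power:
  assumes "0 < z" "z < (1::real)"
  shows "summable (\<lambda>m. (real m + 1) ^ k * z ^ m)"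
proof -
  have "z ^ m = exp (- (- ln z) * real m)" for m
    using assms by (simp add: powr_realpow[symmetric] powr_def mult.commute)
  then show ?thesis using summable_poly_exp[of "- ln z" k] assms by simp
qed

section \<open>Generating functions as formal power series\<close>

definition geg_fps :: "real \<Rightarrow> real \<Rightarrow> real fps" where
  "geg_fps l x = Abs_fps (\<lambda>m. gegenbauer l m x)"

definition geg_quad :: "real \<Rightarrow> real fps" where
  "geg_quad x = 1 - fps_const (2 * x) * fps_X + fps_X\<^sup>2"

lemma geg_quad_nth_0 [simp]: "geg_quad x $ 0 = 1"
  by (simp add: geg_quad_def fps_X_power_iff)

text \<open>The three-term recurrence in the form Q G' = 2 l (x - z) G with Q = 1 - 2 x z +
  z^2.\<close>

lemma geg_fps_ODE:
  "geg_quad x * fps_deriv (geg_fps l x) = fps_const (2 * l) * (fps_const x - fps_X) * geg_fps l x"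
proof (rule fps_ext)
  fix k
  have "geg_quad x * F = F - fps_const (2 * x) * (fps_X * F) + fps_X\<^sup>2 * F" for F
    by (simp add: geg_quad_def algebra_simps)
  then have Q: "(geg_quad x * F) $ k = F $ k - 2 * x * (if k = 0 then 0 else F $ (k - 1)) +
      (if k < 2 then 0 else F $ (k - 2))" for F
    by (simp add: fps_X_power_mult_nth)
  have "fps_const (2 * l) * (fps_const x - fps_X) * geg_fps l x =
      fps_const (2 * l) * (fps_const x * geg_fps l x - fps_X * geg_fps l x)"
    by (simp add: algebra_simps)
  then have "(fps_const (2 * l) * (fps_const x - fps_X) * geg_fps l x) $ k =
      (fps_const (2 * l) * (fps_const x * geg_fps l x - fps_X * geg_fps l x)) $ k" by (rule arg_cong)
  then have R: "(fps_const (2 * l) * (fps_const x - fps_X) * geg_fps l x) $ k =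
      2 * l * (x * gegenbauer l k x - (if k = 0 then 0 else gegenbauer l (k - 1) x))"
    by (simp only: fps_mult_left_const_nth fps_sub_nth fps_X_mult_nth) (simp add: geg_fps_def)
  consider "k = 0" | "k = 1" | m where "k = Suc (Suc m)"
    by (metis One_nat_def not0_implies_Suc)
  then show "(geg_quad x * fps_deriv (geg_fps l x)) $ k =
      (fps_const (2 * l) * (fps_const x - fps_X) * geg_fps l x) $ k"
  proof cases
    case 2
    have "gegenbauer l 2 x * 2 = 2 * (1 + l) * x * (2 * l * x) - 2 * l"
      by (simp add: numeral_2_eq_2 del: One_nat_def)
    with 2 show ?thesis unfolding Q R
      by (simp add: geg_fps_def algebra_simps numeral_2_eq_2)
  next
    case (3 m)
    have "gegenbauer l (Suc (Suc (Suc m))) x * (real (Suc m) + 2) =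
      2 * (real (Suc m) + 1 + l) * x * gegenbauer l (Suc (Suc m)) x - (real (Suc m) + 2 * l) * gegenbauer l (Suc m) x"
      by simp
    with 3 show ?thesis unfolding Q R
      by (simp add: geg_fps_def del: gegenbauer.simps) (simp add: algebra_simps del: gegenbauer.simps)
  qed (simp add: Q R geg_fps_def)
qed

lemma geg_quad_nonzero [simp]: "geg_quad x \<noteq> 0"
  using geg_quad_nth_0[of x] by (metis fps_zero_nth zero_neq_one)

text \<open>By the differential equation the product has derivative zero, so it equals its constant
  term. The index is natural because powers of formal series are taken; the application has L = 2 n
  + 1.\<close>

lemma geg_fps_mult_quad_power: "geg_fps (real L) x * geg_quad x ^ L = 1"
proof -
  define G where "G = geg_fps (real L) x"
  define Q where "Q = geg_quad x"
  have Q': "fps_deriv Q = - (2 * (fps_const x - fps_X))"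
    unfolding Q_def geg_quad_def by (rule fps_ext) (auto simp: fps_X_power_iff numeral_fps_const)
  have L: "Q * (of_nat L * Q ^ (L - 1)) = of_nat L * Q ^ L" by (cases L) (auto simp: algebra_simps)
  have "Q * fps_deriv (G * Q ^ L) = (Q * fps_deriv G) * Q ^ L + G * (Q * (of_nat L * Q ^ (L - 1))) * fps_deriv Q"
    by (simp add: fps_deriv_power' algebra_simps)
  also have "\<dots> = 0"
    unfolding L Q' unfolding G_def Q_def geg_fps_ODE
    by (simp add: fps_of_nat[symmetric] numeral_fps_const fps_const_mult[symmetric] algebra_simps
             del: fps_const_mult)
  finally have "fps_deriv (G * Q ^ L) = 0" using geg_quad_nonzero[of x] by (simp add: Q_def)
  then have "G * Q ^ L = fps_const ((G * Q ^ L) $ 0)" using fps_deriv_eq_0_iff by blast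
  also have "(G * Q ^ L) $ 0 = 1" by (simp add: G_def Q_def geg_fps_def fps_power_zeroth)
  finally show ?thesis by (simp add: G_def Q_def)
qed

lemma geg_fps_eq_power: "geg_fps (real L) x = geg_fps 1 x ^ L"
proof -
  have "geg_fps 1 x ^ L * geg_quad x ^ L = 1"
    using geg_fps_mult_quad_power[of 1 x] by (simp add: power_mult_distrib[symmetric])
  then have "geg_fps (real L) x * geg_quad x ^ L = geg_fps 1 x ^ L * geg_quad x ^ L"
    by (simp add: geg_fps_mult_quad_power)
  then show ?thesis by simp
qed

text \<open>U_(m+1) = x U_m + T_(m+1), where T_(m+1) is a cosine, so the bound grows by at most one
  per step.\<close>

lemma gegenbauer_1_bound:
  assumes "\<bar>x\<bar> \<le> 1"
  shows "\<bar>gegenbauer 1 m x\<bar> \<le> real m + 1"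
proof -
  obtain \<eta> where x: "x = cos \<eta>" using assms cos_arccos_abs by metis
  have G: "gegenbauer 1 (Suc (Suc m)) x = 2 * x * gegenbauer 1 (Suc m) x - gegenbauer 1 m x" for m
    by (simp add: field_simps)
  have rec: "gegenbauer 1 (Suc m) x = x * gegenbauer 1 m x + cos (real (m + 1) * \<eta>)" for m
  proof (induction m rule: induct_nat_012)
    case 1
    have "cos (\<eta> * 2) = 2 * (cos \<eta>)^2 - 1" using cos_double_cos[of \<eta>] by (simp add: mult.commute)
    then show ?case by (simp add: x algebra_simps power2_eq_square)
  next
    case (ge2 m)
    have "2 * cos \<eta> * cos (real (Suc m + 1) * \<eta>) - cos (real (m + 1) * \<eta>) = cos (real (Suc (Suc m) + 1) * \<eta>)"
      using cos_add[of "real (Suc m + 1) * \<eta>" \<eta>] cos_diff[of "real (Suc m + 1) * \<eta>" \<eta>]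
      by (simp add: algebra_simps)
    then have c: "cos (real (Suc (Suc m) + 1) * \<eta>) = 2 * x * cos (real (Suc m + 1) * \<eta>) - cos (real (m + 1) * \<eta>)"
      by (simp add: x)
    have "gegenbauer 1 (Suc (Suc (Suc m))) x = 2 * x * gegenbauer 1 (Suc (Suc m)) x - gegenbauer 1 (Suc m) x"
      by (rule G)
    also have "\<dots> = x * (2 * x * gegenbauer 1 (Suc m) x - gegenbauer 1 m x) +
        (2 * x * cos (real (Suc m + 1) * \<eta>) - cos (real (m + 1) * \<eta>))"
      using ge2 by (simp add: algebra_simps del: gegenbauer.simps)
    also have "\<dots> = x * gegenbauer 1 (Suc (Suc m)) x + cos (real (Suc (Suc m) + 1) * \<eta>)"
      by (simp only: c G)
    finally show ?case .
  qed (simp add: x)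
  show ?thesis
  proof (induction m)
    case (Suc m)
    have "\<bar>gegenbauer 1 (Suc m) x\<bar> \<le> \<bar>x\<bar> * \<bar>gegenbauer 1 m x\<bar> + \<bar>cos (real (m + 1) * \<eta>)\<bar>"
      unfolding rec by (metis abs_mult abs_triangle_ineq)
    also have "\<dots> \<le> 1 * (real m + 1) + 1"
      using assms Suc by (intro add_mono mult_mono) auto
    finally show ?case by simp
  qed simp
qed

text \<open>The generating function is the L-th power of that of the U_m. Each factor costs (m +
  1)^2: a convolution has at most m + 1 terms, and each contains some U_i bounded by m + 1.\<close>

lemma gegenbauer_bound:
  assumes "\<bar>x\<bar> \<le> 1"
  shows "\<bar>gegenbauer (real L) m x\<bar> \<le> (real m + 1) ^ (2 * L)"
proof -
  have "\<bar>(geg_fps 1 x ^ L) $ m\<bar> \<le> (real m + 1) ^ (2 * L)"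
  proof (induction L arbitrary: m)
    case (Suc L)
    have "\<bar>(geg_fps 1 x ^ Suc L) $ m\<bar> = \<bar>\<Sum>i=0..m. gegenbauer 1 i x * (geg_fps 1 x ^ L) $ (m - i)\<bar>"
      by (simp add: fps_mult_nth geg_fps_def)
    also have "\<dots> \<le> (\<Sum>i=0..m. \<bar>gegenbauer 1 i x\<bar> * \<bar>(geg_fps 1 x ^ L) $ (m - i)\<bar>)"
      by (metis (no_types, lifting) sum_abs abs_mult sum.cong)
    also have "\<dots> \<le> (\<Sum>i=0..m. (real m + 1) * (real m + 1) ^ (2 * L))"
    proof (intro sum_mono mult_mono)
      fix i assume i: "i \<in> {0..m}"
      show "\<bar>gegenbauer 1 i x\<bar> \<le> real m + 1"
        using gegenbauer_1_bound[OF assms, of i] i by auto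
      show "\<bar>(geg_fps 1 x ^ L) $ (m - i)\<bar> \<le> (real m + 1) ^ (2 * L)"
        using Suc[of "m - i"] by (rule order_trans) (intro power_mono, auto)
    qed auto
    also have "\<dots> = (real m + 1) ^ (2 * Suc L)" by (simp add: power2_eq_square)
    finally show ?case .
  qed simp
  then show ?thesis unfolding geg_fps_eq_power[symmetric] by (simp add: geg_fps_def)
qed

lemma geg_fps_conv_radius:
  assumes "\<bar>x\<bar> \<le> 1" "\<bar>r\<bar> < 1"
  shows "ereal \<bar>r\<bar> < fps_conv_radius (Abs_fps (\<lambda>m. (real m + real L) * gegenbauer (real L) m x))"
proof -
  obtain z where z: "\<bar>r\<bar> < z" "z < 1" using dense[OF assms(2)] by blast
  have "summable (\<lambda>m. (real m + real L) * gegenbauer (real L) m x * z ^ m)"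
  proof (rule summable_comparison_test')
    show "summable (\<lambda>m. (1 + real L) * ((real m + 1) ^ Suc (2 * L) * z ^ m))"
      using z by (intro summable_mult summable_poly_power) auto
    fix m :: nat assume "m \<ge> 0"
    have "\<bar>(real m + real L) * gegenbauer (real L) m x\<bar> \<le> ((1 + real L) * (real m + 1)) * (real m + 1) ^ (2 * L)"
      unfolding abs_mult using gegenbauer_bound[OF assms(1), of L m]
      by (intro mult_mono) (auto simp: algebra_simps)
    then show "norm ((real m + real L) * gegenbauer (real L) m x * z ^ m) \<le>
        (1 + real L) * ((real m + 1) ^ Suc (2 * L) * z ^ m)"
      using z by (simp add: abs_mult mult.assoc[symmetric] mult_right_mono power_abs[symmetric])
  qed
  then have "conv_radius (\<lambda>m. (real m + real L) * gegenbauer (real L) m x) \<ge> norm z"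
    by (rule conv_radius_geI)
  moreover have "ereal \<bar>r\<bar> < ereal (norm z)" using z by simp
  ultimately show ?thesis unfolding fps_conv_radius_def by (metis (no_types, lifting) ext fps_nth_Abs_fps less_le_trans)
qed

text \<open>Poisson kernel of the unit ball in dimension 2 L + 2, not normalized by the area of the
  sphere.\<close>

definition poisson_kernel :: "nat \<Rightarrow> real \<Rightarrow> real \<Rightarrow> real" where
  "poisson_kernel L r x = (1 - r\<^sup>2) / (1 - 2 * r * x + r^2) ^ (L + 1)"

text \<open>For A = z G' + L G the equation of G gives Q A = L (1 - z^2) G, and multiplying by Q^L
  yields Q^(L+1) A = L (1 - z^2). This formal identity is then evaluated at r inside the radius of
  convergence.\<close>

lemma poisson_kernel_sums:
  assumes "\<bar>x\<bar> \<le> 1" "\<bar>r\<bar> < 1"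
  shows "(\<lambda>m. (real m + real L) * gegenbauer (real L) m x * r ^ m) sums
     (real L * poisson_kernel L r x)"
proof -
  define A where "A = Abs_fps (\<lambda>m. (real m + real L) * gegenbauer (real L) m x)"
  define G where "G = geg_fps (real L) x"
  define Q where "Q = geg_quad x"
  have A: "A = fps_X * fps_deriv G + fps_const (real L) * G"
    by (rule fps_ext) (auto simp: A_def G_def geg_fps_def algebra_simps of_nat_diff)
  have "Q * A = fps_X * (Q * fps_deriv G) + fps_const (real L) * Q * G"
    unfolding A by (simp add: algebra_simps)
  also have "Q * fps_deriv G = fps_const (2 * real L) * (fps_const x - fps_X) * G"
    unfolding Q_def G_def by (rule geg_fps_ODE)
  also have "fps_X * (fps_const (2 * real L) * (fps_const x - fps_X) * G) + fps_const (real L) * Q * G =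
     fps_const (real L) * (1 - fps_X\<^sup>2) * G"
    unfolding Q_def geg_quad_def
    by (simp add: algebra_simps power2_eq_square numeral_fps_const fps_const_mult[symmetric] del: fps_const_mult)
  finally have QA: "Q * A = fps_const (real L) * (1 - fps_X\<^sup>2) * G" .
  have "Q ^ (L + 1) * A = fps_const (real L) * (1 - fps_X\<^sup>2) * (G * Q ^ L)"
    using QA by (simp add: mult_ac)
  also have "\<dots> = fps_const (real L) * (1 - fps_X\<^sup>2)"
    unfolding G_def Q_def geg_fps_mult_quad_power by simp
  also have "\<dots> = fps_of_poly (smult (real L) (1 - [:0, 1:]\<^sup>2))"
    by (simp add: fps_of_poly_smult fps_of_poly_diff fps_of_poly_power fps_of_poly_fps_X flip: fps_of_poly_1)
  finally have eq: "Q ^ (L + 1) * A = fps_of_poly (smult (real L) (1 - [:0, 1:]\<^sup>2))" .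
  have Q: "Q ^ (L + 1) = fps_of_poly ([:1, - 2 * x, 1:] ^ (L + 1))"
  proof -
    have "Q = fps_of_poly [:1, - 2 * x, 1:]"
      by (rule fps_ext) (auto simp: Q_def geg_quad_def fps_X_power_iff coeff_pCons split: nat.splits)
    then show ?thesis by (simp only: fps_of_poly_power)
  qed
  have r: "ereal \<bar>r\<bar> < fps_conv_radius A" unfolding A_def by (rule geg_fps_conv_radius[OF assms])
  have "eval_fps (Q ^ (L + 1)) r * eval_fps A r = eval_fps (Q ^ (L + 1) * A) r"
  proof (rule eval_fps_mult[symmetric])
    show "ereal (norm r) < fps_conv_radius (Q ^ (L + 1))" unfolding Q by simp
    show "ereal (norm r) < fps_conv_radius A" using r by simp
  qed
  then have eval: "(1 - 2 * r * x + r^2) ^ (L + 1) * eval_fps A r = real L * (1 - r\<^sup>2)"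
    unfolding eq unfolding Q by (simp add: algebra_simps power2_eq_square)
  \<comment> \<open>The expression is at least (1 - |r|)^2.\<close>
  have "1 - 2 * r * x + r^2 > 0"
  proof -
    have "r * x \<le> \<bar>r\<bar> * \<bar>x\<bar>" by (metis abs_ge_self abs_mult)
    moreover have "\<bar>r\<bar> * \<bar>x\<bar> \<le> \<bar>r\<bar> * 1" using assms by (intro mult_left_mono) auto
    moreover have "(1 - \<bar>r\<bar>)^2 > 0" using assms by simp
    ultimately show ?thesis by (simp add: power2_eq_square algebra_simps)
  qed
  then have "(1 - 2 * r * x + r^2) ^ (L + 1) \<noteq> 0" by simp
  from nonzero_mult_div_cancel_left[OF this, of "eval_fps A r"]
  have "eval_fps A r = real L * (1 - r\<^sup>2) / (1 - 2 * r * x + r^2) ^ (L + 1)"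
    unfolding eval by simp
  moreover have "(\<lambda>m. A $ m * r ^ m) sums eval_fps A r" using r by (intro sums_eval_fps) auto
  ultimately show ?thesis by (simp add: A_def poisson_kernel_def)
qed

unbundle no fps_syntax

subsection \<open>Invariance of the measure on the sphere\<close>

lemma orthogonal_transformation_exists_euclidean:
  fixes p p' :: "'a::real_inner"
  assumes "norm p = norm p'"
  obtains f where "orthogonal_transformation f" "f p = p'"
proof (cases "p = p'")
  case False
  define u where "u = p - p'"
  \<comment> \<open>The reflection in the hyperplane orthogonal to p - p'; it exchanges p and p' as
    these have equal norm.\<close>
  define f where "f x = x - (2 * (x \<bullet> u) / (u \<bullet> u)) *\<^sub>R u" for x
  have uu: "u \<bullet> u \<noteq> 0" using False by (simp add: u_def)
  have "p \<bullet> p = p' \<bullet> p'" using assms by (simp add: dot_square_norm)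
  then have "2 * (p \<bullet> u) = u \<bullet> u" by (simp add: u_def inner_diff inner_commute algebra_simps)
  then have "f p = p'" using uu by (simp add: f_def u_def)
  moreover have "linear f"
    by (rule linearI) (simp_all add: f_def inner_add_left algebra_simps add_divide_distrib)
  moreover have "f v \<bullet> f w = v \<bullet> w" for v w
    using uu by (simp add: f_def inner_diff inner_commute field_simps)
  ultimately show thesis by (intro that[of f]) (simp_all add: orthogonal_transformation_def)
qed (use that[of "\<lambda>x. x"] in auto)

lemma borel_measurable_orthogonal_transformation:
  fixes f :: "'a::euclidean_space \<Rightarrow> 'a"
  assumes "orthogonal_transformation f"
  shows "f \<in> borel_measurable borel"
  using assms by (intro borel_measurable_continuous_onI linear_continuous_on)
    (simp add: linear_conv_bounded_linear[symmetric] orthogonal_transformation_linear)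

text \<open>Uniqueness of Haar measure: integrating \<open>1_A (x + y) 1_B (y)\<close> in both orders compares the two
  translation invariant measures on \<open>A\<close> up to their values on the ball \<open>B\<close>, where they agree.\<close>

lemma lborel_distr_orthogonal_transformation:
  fixes f :: "'a::euclidean_space \<Rightarrow> 'a"
  assumes f: "orthogonal_transformation f"
  shows "distr lborel borel f = lborel"
proof (rule measure_eqI)
  define \<nu> where "\<nu> = distr lborel borel f"
  define g where "g = inv f"
  define B where "B = ball (0::'a) 1"
  have f_meas [measurable]: "f \<in> borel_measurable borel" by (rule borel_measurable_orthogonal_transformation[OF f])
  have lin: "linear f" using f by (rule orthogonal_transformation_linear)
  have fg: "f (g x) = x" for x
    using orthogonal_transformation_surj[OF f] by (simp add: g_def surj_f_inv_f)
  have sets_\<nu> [measurable_cong]: "sets \<nu> = sets borel" by (simp add: \<nu>_def)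
  fix A assume "A \<in> sets (distr lborel borel f)"
  then have [measurable]: "A \<in> sets borel" by simp
  have [measurable]: "B \<in> sets borel" by (simp add: B_def)
  have \<nu>B: "emeasure \<nu> B = emeasure lborel B"
  proof -
    have "f -` B = B" unfolding B_def using orthogonal_transformation_norm[OF f] by auto
    then show ?thesis by (simp add: \<nu>_def emeasure_distr)
  qed
  have transl: "(\<integral>\<^sup>+ y. h (y + x) \<partial>\<nu>) = (\<integral>\<^sup>+ y. h y \<partial>\<nu>)"
    if [measurable]: "h \<in> borel_measurable borel" for h :: "'a \<Rightarrow> ennreal" and x
  proof -
    have "(\<integral>\<^sup>+ y. h (y + x) \<partial>\<nu>) = (\<integral>\<^sup>+ y. h (f (y + g x)) \<partial>lborel)"
      unfolding \<nu>_def by (subst nn_integral_distr) (simp_all add: linear_add[OF lin] fg)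
    also have "\<dots> = (\<integral>\<^sup>+ y. h (f y) \<partial>(distr lborel borel ((+) (g x))))"
      by (subst nn_integral_distr) (simp_all add: add.commute)
    also have "\<dots> = (\<integral>\<^sup>+ y. h y \<partial>\<nu>)"
      unfolding lborel_distr_plus \<nu>_def by (subst nn_integral_distr) simp_all
    finally show ?thesis .
  qed
  have sfin: "sigma_finite_measure \<nu>"
  proof
    show "\<exists>\<A>. countable \<A> \<and> \<A> \<subseteq> sets \<nu> \<and> \<Union>\<A> = space \<nu> \<and> (\<forall>a\<in>\<A>. emeasure \<nu> a \<noteq> \<infinity>)"
    proof (intro exI conjI ballI)
      let ?A = "(\<lambda>n. ball (0::'a) (real n)) ` UNIV"
      show "countable ?A" by simp
      show "?A \<subseteq> sets \<nu>" by (auto simp: sets_\<nu>)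
      show "\<Union> ?A = space \<nu>"
        using reals_Archimedean2 by (auto simp: \<nu>_def)
      fix a assume "a \<in> ?A"
      then obtain n where a: "a = ball 0 (real n)" by auto
      have "f -` a = a" unfolding a using orthogonal_transformation_norm[OF f] by auto
      then show "emeasure \<nu> a \<noteq> \<infinity>" using emeasure_bounded_finite[of a] by (simp add: \<nu>_def emeasure_distr a)
    qed
  qed
  interpret \<nu>: sigma_finite_measure \<nu> by (rule sfin)
  interpret pair_sigma_finite lborel \<nu> ..
  have "emeasure lborel A * emeasure \<nu> B = (\<integral>\<^sup>+ y. \<integral>\<^sup>+ x. indicator A (x + y) * indicator B y \<partial>lborel \<partial>\<nu>)"
  proof -
    have "(\<integral>\<^sup>+ x. indicator A (x + y) \<partial>lborel) = emeasure lborel A" for y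
    proof -
      have "(\<integral>\<^sup>+ x. indicator A (x + y) \<partial>lborel) = (\<integral>\<^sup>+ x. indicator A x \<partial>(distr lborel borel ((+) y)))"
        by (subst nn_integral_distr) (simp_all add: add.commute)
      then show ?thesis by (simp add: lborel_distr_plus)
    qed
    then show ?thesis
      by (simp add: nn_integral_multc nn_integral_cmult)
  qed
  also have "\<dots> = (\<integral>\<^sup>+ x. \<integral>\<^sup>+ y. indicator A (x + y) * indicator B y \<partial>\<nu> \<partial>lborel)"
    by (rule Fubini') measurable
  also have "\<dots> = (\<integral>\<^sup>+ x. \<integral>\<^sup>+ y. indicator A y * indicator B (y - x) \<partial>\<nu> \<partial>lborel)"
  proof (rule nn_integral_cong)
    fix x :: 'a
    show "(\<integral>\<^sup>+ y. indicator A (x + y) * indicator B y \<partial>\<nu>) = (\<integral>\<^sup>+ y. indicator A y * indicator B (y - x) \<partial>\<nu>)"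
      using transl[of "\<lambda>y. indicator A y * indicator B (y - x)" x] by (simp add: add.commute)
  qed
  also have "\<dots> = (\<integral>\<^sup>+ y. \<integral>\<^sup>+ x. indicator A y * indicator B (y - x) \<partial>lborel \<partial>\<nu>)"
    by (rule Fubini'[symmetric]) measurable
  also have "\<dots> = (\<integral>\<^sup>+ y. indicator A y * emeasure lborel B \<partial>\<nu>)"
  proof (rule nn_integral_cong)
    fix y :: 'a
    have "(\<integral>\<^sup>+ x. indicator B (y - x) \<partial>lborel) = (\<integral>\<^sup>+ x. indicator (ball y 1) x \<partial>(lborel :: 'a measure))"
      by (intro nn_integral_cong) (auto simp: B_def dist_norm norm_minus_commute indicator_def)
    also have "\<dots> = emeasure lborel B" by (simp add: B_def emeasure_ball)
    finally show "(\<integral>\<^sup>+ x. indicator A y * indicator B (y - x) \<partial>lborel) = indicator A y * emeasure lborel B"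
      by (simp add: nn_integral_cmult)
  qed
  also have "\<dots> = emeasure \<nu> A * emeasure lborel B"
    by (simp add: nn_integral_multc)
  finally have "emeasure lborel A * emeasure lborel B = emeasure \<nu> A * emeasure lborel B"
    by (simp add: \<nu>B)
  moreover have "emeasure lborel B \<noteq> 0" "emeasure lborel B \<noteq> \<infinity>"
    using less_imp_neq[OF unit_ball_vol_pos[of "real DIM('a)"]] by (simp_all add: B_def emeasure_ball)
  ultimately show "emeasure (distr lborel borel f) A = emeasure lborel A"
    by (simp add: \<nu>_def mult.commute[of _ "emeasure lborel B"] ennreal_mult_cancel_left)
qed simp


section \<open>The surface measure of the unit sphere\<close>

lemma scale_measure_eq_density: "scale_measure r M = density M (\<lambda>_. r)"
  by (rule measure_eqI) (auto simp: emeasure_density_const)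

lemma space_sphere_measure [simp]: "space (sphere_measure :: 'a::euclidean_space measure) = sphere 0 1"
  by (simp add: sphere_measure_def space_scale_measure space_restrict_space)

lemma sets_sphere_measure [measurable_cong]:
  "sets (sphere_measure :: 'a::euclidean_space measure) = sets (restrict_space borel (sphere 0 1))"
  by (simp add: sphere_measure_def)

lemma measurable_sgn_sphere:
  "sgn \<in> restrict_space lborel (ball 0 1 - {0}) \<rightarrow>\<^sub>M restrict_space borel (sphere (0::'a::euclidean_space) 1)"
proof (rule measurable_restrict_space2)
  show "sgn \<in> space (restrict_space lborel (ball 0 1 - {0})) \<rightarrow> sphere (0::'a) 1"
    by (auto simp: space_restrict_space norm_sgn)
  have "sgn \<in> borel_measurable (borel :: 'a measure)" unfolding sgn_div_norm[abs_def] by measurable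
  then show "sgn \<in> borel_measurable (restrict_space lborel (ball 0 1 - {0::'a}))"
    by (intro measurable_restrict_space1) simp
qed

lemma emeasure_sphere_measure:
  assumes "A \<in> sets (sphere_measure :: 'a::euclidean_space measure)"
  shows "emeasure sphere_measure A = of_nat DIM('a) * emeasure lborel {x \<in> ball 0 1 - {0}. sgn x \<in> A}"
proof -
  have "emeasure sphere_measure A =
      of_nat DIM('a) * emeasure (restrict_space lborel (ball 0 1 - {0})) (sgn -` A \<inter> (ball 0 1 - {0}))"
    using assms unfolding sphere_measure_def
    by (subst emeasure_scale_measure, subst emeasure_distr[OF measurable_sgn_sphere]) (auto simp: space_restrict_space)
  also have "emeasure (restrict_space lborel (ball 0 1 - {0::'a})) (sgn -` A \<inter> (ball 0 1 - {0})) =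
      emeasure lborel (sgn -` A \<inter> (ball 0 1 - {0}))"
    by (rule emeasure_restrict_space) auto
  also have "sgn -` A \<inter> (ball 0 1 - {0}) = {x \<in> ball 0 1 - {0}. sgn x \<in> A}" by auto
  finally show ?thesis .
qed

lemma emeasure_sphere_measure_space:
  "emeasure (sphere_measure :: 'a::euclidean_space measure) (sphere 0 1) = ennreal (real DIM('a) * unit_ball_vol DIM('a))"
proof -
  have "emeasure (sphere_measure :: 'a measure) (sphere 0 1) =
      of_nat DIM('a) * emeasure lborel {x \<in> ball (0::'a) 1 - {0}. sgn x \<in> sphere 0 1}"
    by (rule emeasure_sphere_measure) (metis space_sphere_measure sets.top)
  also have "{x \<in> ball (0::'a) 1 - {0}. sgn x \<in> sphere 0 1} = ball 0 1 - {0}"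
    by (auto simp: norm_sgn)
  also have "emeasure lborel (ball (0::'a) 1 - {0}) = emeasure lborel (ball (0::'a) 1)"
    by (rule emeasure_Diff_null_set) auto
  also have "\<dots> = ennreal (unit_ball_vol DIM('a))" by (simp add: emeasure_ball)
  finally show ?thesis by (simp add: ennreal_mult' ennreal_of_nat_eq_real_of_nat)
qed

lemma finite_measure_sphere_measure: "finite_measure (sphere_measure :: 'a::euclidean_space measure)"
  by (rule finite_measureI) (simp add: emeasure_sphere_measure_space)

lemma measure_sphere_measure:
  "measure (sphere_measure :: 'a::euclidean_space measure) (sphere 0 1) = real DIM('a) * unit_ball_vol DIM('a)"
  by (simp add: measure_def emeasure_sphere_measure_space)

lemma borel_measurable_sphere:
  fixes g :: "'a::euclidean_space \<Rightarrow> 'b::topological_space"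
  assumes "continuous_on (sphere 0 1) g"
  shows "g \<in> borel_measurable sphere_measure"
  using borel_measurable_continuous_on_restrict[OF assms] measurable_cong_sets[OF sets_sphere_measure refl] by blast

lemma continuous_on_sphere_bounded:
  fixes g :: "'a::euclidean_space \<Rightarrow> real"
  assumes "continuous_on (sphere 0 1) g"
  obtains M where "M \<ge> 0" "\<And>x. x \<in> sphere 0 1 \<Longrightarrow> \<bar>g x\<bar> \<le> M"
proof -
  have "bounded (g ` sphere 0 1)"
    using assms by (intro compact_imp_bounded compact_continuous_image) auto
  then obtain M where "\<forall>y\<in>g ` sphere 0 1. norm y \<le> M" unfolding bounded_iff by blast
  then have "\<bar>g x\<bar> \<le> max 0 M" if "x \<in> sphere 0 1" for x using that by (simp add: max.coboundedI2)
  then show thesis by (intro that[of "max 0 M"]) simp_all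
qed

lemma integrable_sphere:
  fixes g :: "'a::euclidean_space \<Rightarrow> real"
  assumes "continuous_on (sphere 0 1) g"
  shows "integrable sphere_measure g"
proof -
  obtain M where M: "\<And>x. x \<in> sphere 0 1 \<Longrightarrow> \<bar>g x\<bar> \<le> M"
    using continuous_on_sphere_bounded[OF assms] by metis
  interpret finite_measure "sphere_measure :: 'a measure" by (rule finite_measure_sphere_measure)
  show ?thesis
    by (rule integrable_const_bound[of _ M]) (use M in \<open>auto intro!: AE_I2 borel_measurable_sphere[OF assms]\<close>)
qed

text \<open>A linear isometry commutes with \<open>sgn\<close>, so it maps the cone over a set to
  the cone over its image; the claim is thereby reduced to Lebesgue measure.\<close>

lemma sphere_measure_orthogonal_transformation:
  fixes f :: "'a::euclidean_space \<Rightarrow> 'a"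
  assumes f: "orthogonal_transformation f"
  shows "distr sphere_measure sphere_measure f = sphere_measure"
proof (rule measure_eqI)
  have [measurable]: "f \<in> borel_measurable borel" by (rule borel_measurable_orthogonal_transformation[OF f])
  have f_S: "f \<in> sphere_measure \<rightarrow>\<^sub>M sphere_measure"
  proof -
    have "f \<in> restrict_space borel (sphere 0 1) \<rightarrow>\<^sub>M restrict_space borel (sphere 0 1)"
      by (rule measurable_restrict_space3) (use orthogonal_transformation_norm[OF f] in auto)
    then show ?thesis using measurable_cong_sets[OF sets_sphere_measure sets_sphere_measure] by blast
  qed
  fix A assume "A \<in> sets (distr sphere_measure sphere_measure f)"
  then have A: "A \<in> sets sphere_measure" by simp
  then obtain A' where A': "A' \<in> sets borel" "A = A' \<inter> sphere 0 1"
    by (auto simp: sets_sphere_measure sets_restrict_space)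
  have sgn_meas: "{x \<in> ball 0 1 - {0}. sgn x \<in> A} \<in> sets borel"
  proof -
    have "sgn \<in> borel_measurable (borel :: 'a measure)" unfolding sgn_div_norm[abs_def] by measurable
    from measurable_sets[OF this A'(1)] have "sgn -` A' \<in> sets borel" by simp
    moreover have "{x \<in> ball 0 1 - {0}. sgn x \<in> A} = sgn -` A' \<inter> (ball 0 1 - {0})"
      unfolding A' by (auto simp: norm_sgn)
    ultimately show ?thesis by auto
  qed
  have fsgn: "f (sgn x) = sgn (f x)" for x
    unfolding sgn_div_norm orthogonal_transformation_norm[OF f] by (rule orthogonal_transformation_scaleR[OF f])
  have "emeasure (distr sphere_measure sphere_measure f) A = emeasure sphere_measure (f -` A \<inter> sphere 0 1)"
    using A f_S by (simp add: emeasure_distr)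
  also have "\<dots> = of_nat DIM('a) * emeasure lborel {x \<in> ball 0 1 - {0}. sgn x \<in> f -` A \<inter> sphere 0 1}"
    using measurable_sets[OF f_S A] by (intro emeasure_sphere_measure) simp
  also have "{x \<in> ball 0 1 - {0}. sgn x \<in> f -` A \<inter> sphere 0 1} = f -` {x \<in> ball 0 1 - {0}. sgn x \<in> A}"
  proof -
    have "norm (f x) = norm x" "f x = 0 \<longleftrightarrow> x = 0" for x
      using orthogonal_transformation_norm[OF f] by (simp, metis norm_eq_zero)
    then show ?thesis by (auto simp: fsgn norm_sgn)
  qed
  also have "emeasure lborel \<dots> = emeasure (distr lborel borel f) {x \<in> ball 0 1 - {0}. sgn x \<in> A}"
    using sgn_meas by (simp add: emeasure_distr)
  also have "of_nat DIM('a) * \<dots> = emeasure sphere_measure A"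
    unfolding lborel_distr_orthogonal_transformation[OF f] using A by (simp add: emeasure_sphere_measure)
  finally show "emeasure (distr sphere_measure sphere_measure f) A = emeasure sphere_measure A" .
qed simp

lemma integral_sphere_orthogonal_transformation:
  fixes f :: "'a::euclidean_space \<Rightarrow> 'a" and g :: "'a \<Rightarrow> real"
  assumes f: "orthogonal_transformation f" and g: "continuous_on (sphere 0 1) g"
  shows "(\<integral>q. g (f q) \<partial>sphere_measure) = (\<integral>q. g q \<partial>sphere_measure)"
proof -
  have "f \<in> restrict_space borel (sphere 0 1) \<rightarrow>\<^sub>M restrict_space borel (sphere 0 1)"
    by (rule measurable_restrict_space3)
      (use orthogonal_transformation_norm[OF f] borel_measurable_orthogonal_transformation[OF f] in auto)
  then have "f \<in> sphere_measure \<rightarrow>\<^sub>M sphere_measure"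
    using measurable_cong_sets[OF sets_sphere_measure sets_sphere_measure] by blast
  from integral_distr[OF this borel_measurable_sphere[OF g]]
  show ?thesis unfolding sphere_measure_orthogonal_transformation[OF f] by simp
qed

subsection \<open>The Poisson kernel as an approximate identity\<close>

text \<open>By rotation invariance one arbitrary basis vector represents all unit vectors; the type
  argument carries the space.\<close>

definition sphere_moment :: "'a::euclidean_space itself \<Rightarrow> nat \<Rightarrow> real" where
  "sphere_moment _ k = (\<integral>q. (q \<bullet> (SOME b. b \<in> Basis)) ^ k \<partial>(sphere_measure :: 'a measure))"

lemma sphere_moment_unit:
  fixes p :: "'a::euclidean_space"
  assumes "norm p = 1"
  shows "(\<integral>q. (q \<bullet> p) ^ k \<partial>sphere_measure) = sphere_moment TYPE('a) k"
proof -
  define b :: 'a where "b = (SOME b. b \<in> Basis)"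
  have b: "b \<in> Basis" unfolding b_def by (rule someI_ex) (use nonempty_Basis in blast)
  obtain f where f: "orthogonal_transformation f" "f p = b"
    using orthogonal_transformation_exists_euclidean[of p b] assms b by auto
  have "(\<integral>q. (f q \<bullet> b) ^ k \<partial>sphere_measure) = (\<integral>q. (q \<bullet> b) ^ k \<partial>sphere_measure)"
    by (rule integral_sphere_orthogonal_transformation[OF f(1)]) (intro continuous_intros)
  moreover have "f q \<bullet> b = q \<bullet> p" for q
    using f by (metis orthogonal_transformation_def)
  ultimately show ?thesis unfolding sphere_moment_def b_def by simp
qed

lemma sphere_moment_scaled:
  fixes p :: "'a::euclidean_space"
  shows "(\<integral>q. (q \<bullet> p) ^ k \<partial>sphere_measure) = norm p ^ k * sphere_moment TYPE('a) k"
proof (cases "p = 0")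
  case True
  \<comment> \<open>The case \<open>k = 0\<close> is special: there 0 ^ 0 = 1 and both sides are the
    total mass.\<close>
  show ?thesis
  proof (cases k)
    case 0
    obtain b :: 'a where "b \<in> Basis" using nonempty_Basis by blast
    then show ?thesis using sphere_moment_unit[of b 0] 0 by simp
  qed (use True in simp)
next
  case False
  have "q \<bullet> p = norm p * (q \<bullet> sgn p)" for q
    using False by (simp add: sgn_div_norm)
  then have "(q \<bullet> p) ^ k = norm p ^ k * (q \<bullet> sgn p) ^ k" for q
    by (simp add: power_mult_distrib)
  then show ?thesis using sphere_moment_unit[of "sgn p" k] False by (simp add: norm_sgn)
qed

lemma sphere_moment_odd:
  assumes "odd k"
  shows "sphere_moment TYPE('a::euclidean_space) k = 0"
proof -
  obtain b :: 'a where "b \<in> Basis" using nonempty_Basis by blast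
  then have b: "norm b = 1" by simp
  have "(\<integral>q. (q \<bullet> b) ^ k \<partial>sphere_measure) = (\<integral>q. (q \<bullet> (- b)) ^ k \<partial>sphere_measure)"
    unfolding sphere_moment_unit[OF b] by (rule sphere_moment_unit[symmetric]) (use b in simp)
  also have "\<dots> = - (\<integral>q. (q \<bullet> b) ^ k \<partial>sphere_measure)"
    using assms by (simp add: power_minus_odd)
  finally show ?thesis unfolding sphere_moment_unit[OF b] by simp
qed

lemma coeff_one_plus_X2_power:
  "coeff ([:1, 0, 1 :: real:] ^ i) 0 = 1" "coeff ([:1, 0, 1 :: real:] ^ i) 1 = 0"
  "coeff ([:1, 0, 1 :: real:] ^ i) 2 = real i"
proof -
  have "coeff ([:1, 0, 1 :: real:] ^ i) 0 = 1 \<and> coeff ([:1, 0, 1 :: real:] ^ i) 1 = 0 \<and>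
     coeff ([:1, 0, 1 :: real:] ^ i) 2 = real i"
    by (induction i) (auto simp: mult_pCons_left coeff_pCons numeral_2_eq_2 split: nat.splits)
  then show "coeff ([:1, 0, 1 :: real:] ^ i) 0 = 1" "coeff ([:1, 0, 1 :: real:] ^ i) 1 = 0"
    "coeff ([:1, 0, 1 :: real:] ^ i) 2 = real i" by blast+
qed

text \<open>Compare the coefficients of \<open>\<tau>^2\<close> in the moments of \<open>q \<bullet> (p + \<tau> u)\<close>.\<close>

lemma sphere_mixed_moment:
  fixes p u :: "'a::euclidean_space"
  assumes p: "norm p = 1" and u: "norm u = 1" and pu: "p \<bullet> u = 0" and k: "even k"
  shows "(real k + 1) * (\<integral>q. (q \<bullet> p) ^ k * (q \<bullet> u)^2 \<partial>sphere_measure) = sphere_moment TYPE('a) (k + 2)"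
proof -
  obtain i where i: "k + 2 = 2 * Suc i" using k by (auto elim!: evenE)
  define J where "J j = (\<integral>q. (q \<bullet> p) ^ (k + 2 - j) * (q \<bullet> u) ^ j \<partial>sphere_measure)" for j
  define P where "P = (\<Sum>j\<le>k + 2. monom (real ((k + 2) choose j) * J j) j)"
  define I where "I = sphere_moment TYPE('a) (k + 2)"
  have "poly P \<tau> = poly (smult I ([:1, 0, 1:] ^ Suc i)) \<tau>" for \<tau>
  proof -
    have "(norm (p + \<tau> *\<^sub>R u))^2 = 1 + \<tau>^2"
      using p u pu unfolding power2_norm_eq_inner
      by (simp add: inner_add_left inner_add_right inner_commute norm_eq_1 power2_eq_square)
    then have "norm (p + \<tau> *\<^sub>R u) ^ (k + 2) = (1 + \<tau>^2) ^ Suc i" unfolding i power_mult by simp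
    then have "(1 + \<tau>^2) ^ Suc i * I = (\<integral>q. (q \<bullet> (p + \<tau> *\<^sub>R u)) ^ (k + 2) \<partial>sphere_measure)"
      unfolding sphere_moment_scaled I_def by simp
    also have "\<dots> = (\<integral>q. (\<Sum>j\<le>k + 2. real ((k + 2) choose j) * \<tau> ^ j * ((q \<bullet> p) ^ (k + 2 - j) * (q \<bullet> u) ^ j)) \<partial>sphere_measure)"
    proof (rule Bochner_Integration.integral_cong[OF refl])
      fix q :: 'a
      have "q \<bullet> (p + \<tau> *\<^sub>R u) = \<tau> * (q \<bullet> u) + q \<bullet> p" by (simp add: inner_add_right)
      then show "(q \<bullet> (p + \<tau> *\<^sub>R u)) ^ (k + 2) =
         (\<Sum>j\<le>k + 2. real ((k + 2) choose j) * \<tau> ^ j * ((q \<bullet> p) ^ (k + 2 - j) * (q \<bullet> u) ^ j))"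
        by (simp only: binomial_ring) (simp add: power_mult_distrib mult_ac)
    qed
    also have "\<dots> = (\<Sum>j\<le>k + 2. real ((k + 2) choose j) * \<tau> ^ j * J j)"
      unfolding J_def
      by (subst Bochner_Integration.integral_sum)
        (auto intro!: integrable_sphere continuous_intros simp del: sum.atMost_Suc)
    also have "\<dots> = poly P \<tau>" by (simp add: P_def poly_sum poly_monom mult_ac)
    finally show ?thesis by (simp add: power2_eq_square algebra_simps)
  qed
  then have "P = smult I ([:1, 0, 1:] ^ Suc i)" by (simp add: poly_eq_poly_eq_iff[symmetric] ext)
  then have "coeff P 2 = I * real (Suc i)" using coeff_one_plus_X2_power(3)[of "Suc i"] by simp
  moreover have "coeff P 2 = real ((k + 2) choose 2) * J 2"
    unfolding P_def by (simp add: coeff_sum coeff_monom del: sum.atMost_Suc add_2_eq_Suc')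
  moreover have "real ((k + 2) choose 2) = real (Suc i) * (real k + 1)"
  proof -
    have "k = 2 * i" using i by simp
    then have "(k + 2) choose 2 = Suc i * (k + 1)" unfolding choose_two by (simp add: algebra_simps)
    then show ?thesis by (simp only: of_nat_mult of_nat_add of_nat_1)
  qed
  ultimately have "real (Suc i) * ((real k + 1) * J 2) = real (Suc i) * I" by (simp add: mult_ac)
  then show ?thesis by (simp add: J_def I_def del: of_nat_Suc)
qed

text \<open>Summing the mixed moments over the basis vectors other than p, with all squared
  coordinates adding up to 1, gives (k + 1) (I_k - I_(k+2)) = (d - 1) I_(k+2), where d is the
  dimension.\<close>

lemma sphere_moment_rec:
  "(real k + 1) * sphere_moment TYPE('a::euclidean_space) k =
   (real k + real DIM('a)) * sphere_moment TYPE('a) (k + 2)"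
proof (cases "even k")
  case True
  define I where "I = sphere_moment TYPE('a)"
  obtain p :: 'a where p: "p \<in> Basis" using nonempty_Basis by blast
  have "(\<Sum>u\<in>Basis - {p}. (real k + 1) * (\<integral>q. (q \<bullet> p) ^ k * (q \<bullet> u)^2 \<partial>sphere_measure)) =
      (\<Sum>u\<in>Basis - {p}. I (k + 2))"
    unfolding I_def using p
    by (intro sum.cong refl sphere_mixed_moment[OF _ _ _ True]) (auto simp: inner_Basis)
  also have "\<dots> = (real DIM('a) - 1) * I (k + 2)"
    using p by (simp add: card_Diff_singleton of_nat_diff Suc_leI DIM_positive)
  also have "(\<Sum>u\<in>Basis - {p}. (real k + 1) * (\<integral>q. (q \<bullet> p) ^ k * (q \<bullet> u)^2 \<partial>sphere_measure)) =
      (real k + 1) * (\<integral>q. (\<Sum>u\<in>Basis - {p}. (q \<bullet> p) ^ k * (q \<bullet> u)^2) \<partial>sphere_measure)"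
    unfolding sum_distrib_left[symmetric, of "real k + 1"]
    by (subst Bochner_Integration.integral_sum) (auto intro!: integrable_sphere continuous_intros)
  also have "(\<integral>q. (\<Sum>u\<in>Basis - {p}. (q \<bullet> p) ^ k * (q \<bullet> u)^2) \<partial>sphere_measure) =
      (\<integral>q. (q \<bullet> p) ^ k - (q \<bullet> p) ^ (k + 2) \<partial>sphere_measure)"
  proof (rule Bochner_Integration.integral_cong[OF refl])
    fix q :: 'a assume "q \<in> space sphere_measure"
    then have "(\<Sum>u\<in>Basis. (q \<bullet> u)^2) = 1"
      by (simp add: norm_eq_1 euclidean_inner[of q q] power2_eq_square)
    then have "(q \<bullet> p)^2 + (\<Sum>u\<in>Basis - {p}. (q \<bullet> u)^2) = 1" using p by (simp add: sum.remove)
    then have e: "(\<Sum>u\<in>Basis - {p}. (q \<bullet> u)^2) = 1 - (q \<bullet> p)\<^sup>2" by simp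
    show "(\<Sum>u\<in>Basis - {p}. (q \<bullet> p) ^ k * (q \<bullet> u)^2) = (q \<bullet> p) ^ k - (q \<bullet> p) ^ (k + 2)"
      unfolding sum_distrib_left[symmetric] e by (simp only: right_diff_distrib power_add mult_1_right)
  qed
  also have "\<dots> = I k - I (k + 2)"
    unfolding I_def using p
    by (subst Bochner_Integration.integral_diff)
      (auto intro!: integrable_sphere continuous_intros simp: sphere_moment_unit simp del: power_Suc)
  finally show ?thesis by (simp add: I_def algebra_simps)
qed (simp add: sphere_moment_odd)

text \<open>The coefficient equation and the moment recursion turn m (m + 2 l) a_i I_i into h_i -
  h_(i+2), and the sum telescopes. The two recursions match precisely because 2 l + 2 is the
  dimension.\<close>

lemma integral_gegenbauer_sphere:
  fixes p :: "'a::euclidean_space"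
  assumes p: "norm p = 1" and l: "2 * l + 2 = real DIM('a)" and l0: "l > 0" and m: "m > 0"
  shows "(\<integral>q. gegenbauer l m (q \<bullet> p) \<partial>sphere_measure) = 0"
proof -
  define I where "I = sphere_moment TYPE('a)"
  define a where "a = geg_coeff l m"
  define h where "h i = real i * (real i + 2 * l) * a i * I i" for i
  have "(\<integral>q. gegenbauer l m (q \<bullet> p) \<partial>sphere_measure) =
      (\<integral>q. (\<Sum>i\<le>m. a i * (q \<bullet> p) ^ i) \<partial>sphere_measure)"
    by (simp add: a_def gegenbauer_eq_hgegenbauer hgegenbauer_expansion)
  also have "\<dots> = (\<Sum>i\<le>m. a i * I i)"
    unfolding I_def using sphere_moment_unit[OF p]
    by (subst Bochner_Integration.integral_sum) (auto intro!: integrable_sphere continuous_intros)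
  finally have eq: "(\<integral>q. gegenbauer l m (q \<bullet> p) \<partial>sphere_measure) = (\<Sum>i\<le>m. a i * I i)" .
  have step: "real m * (real m + 2 * l) * (a i * I i) = h i - h (i + 2)" for i
  proof -
    have 1: "(real i + 2) * (real i + 1) * a (i + 2) = (real i * (real i + 2 * l) - real m * (real m + 2 * l)) * a i"
      unfolding a_def by (rule geg_coeff_ODE)
    have 2: "(real i + 1) * I i = (real i + 2 + 2 * l) * I (i + 2)"
      using sphere_moment_rec[of i, where 'a = 'a] l by (simp add: I_def algebra_simps)
    have "h (i + 2) = (real i + 2) * a (i + 2) * ((real i + 2 + 2 * l) * I (i + 2))"
      by (simp add: h_def add_ac mult_ac)
    also have "\<dots> = (real i + 2) * (real i + 1) * a (i + 2) * I i" unfolding 2[symmetric] by simp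
    also have "\<dots> = h i - real m * (real m + 2 * l) * (a i * I i)" unfolding 1 h_def by (simp add: algebra_simps)
    finally show ?thesis by simp
  qed
  have tele: "(\<Sum>i\<le>N. h i - h (i + 2)) = h 0 + h 1 - h (N + 1) - h (N + 2)" for N
    by (induction N) simp_all
  have "real m * (real m + 2 * l) * (\<Sum>i\<le>m. a i * I i) = h 0 + h 1 - h (m + 1) - h (m + 2)"
    unfolding sum_distrib_left step by (rule tele)
  \<comment> \<open>\<open>h 0\<close> has the factor 0, \<open>h 1\<close> an odd moment, and the
    last two have coefficients beyond the degree.\<close>
  also have "\<dots> = 0"
    by (simp add: h_def a_def geg_coeff_simps(2) I_def sphere_moment_odd)
  finally show ?thesis unfolding eq using l0 m by auto
qed


text \<open>For fixed r < 1 the polynomial bounds on C_m dominate the series uniformly on the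
  sphere, which permits integration term by term.\<close>

lemma poisson_integral_sums:
  fixes p :: "'a::euclidean_space" and L :: nat
  assumes p: "norm p = 1" and L: "2 * L + 2 = DIM('a)" "L > 0" and r: "0 \<le> r" "r < 1"
    and g: "continuous_on (sphere 0 1) g"
  shows "(\<lambda>m. (real m + real L) * r ^ m * (\<integral>q. g q * gegenbauer (real L) m (q \<bullet> p) \<partial>sphere_measure)) sums
     (real L * (\<integral>q. g q * poisson_kernel L r (q \<bullet> p) \<partial>sphere_measure))"
proof -
  obtain M where M: "M \<ge> 0" "\<And>x. x \<in> sphere 0 1 \<Longrightarrow> \<bar>g x\<bar> \<le> M"
    using continuous_on_sphere_bounded[OF g] by metis
  define F where "F m q = (real m + real L) * r ^ m * (g q * gegenbauer (real L) m (q \<bullet> p))" for m q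
  define \<omega> where "\<omega> = measure (sphere_measure :: 'a measure) (sphere 0 1)"
  define D where "D m = real L * M * ((real m + 1) ^ Suc (2 * L) * r ^ m)" for m
  have geg_cont: "continuous_on (sphere 0 1) (\<lambda>q. gegenbauer (real L) m (q \<bullet> p))" for m
    unfolding gegenbauer_eq_hgegenbauer hgegenbauer_expansion by (intro continuous_intros)
  have F_int: "integrable sphere_measure (F m)" for m
    unfolding F_def by (intro integrable_sphere continuous_intros g geg_cont)
  have qp: "\<bar>q \<bullet> p\<bar> \<le> 1" if "norm q = 1" for q
    using Cauchy_Schwarz_ineq2[of q p] that p by simp
  have F_bound: "norm (F m q) \<le> D m" if "norm q = 1" for m q
  proof -
    have "real m * 1 \<le> real m * real L" using L by (intro mult_left_mono) auto
    then have "real m + real L \<le> real L * (real m + 1)" by (simp add: algebra_simps)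
    then have "\<bar>(real m + real L) * r ^ m * (g q * gegenbauer (real L) m (q \<bullet> p))\<bar> \<le>
        (real L * (real m + 1)) * r ^ m * (M * (real m + 1) ^ (2 * L))"
      unfolding abs_mult using r M that gegenbauer_bound[OF qp[OF that], of L m]
      by (intro mult_mono) auto
    then show ?thesis by (simp add: F_def D_def mult_ac)
  qed
  have D_sum: "summable D"
  proof (cases "r = 0")
    case True
    then have "D m = (if m = 0 then real L * M else 0)" for m by (simp add: D_def)
    then show ?thesis by (intro summable_finite[of "{0}"]) auto
  next
    case False
    then show ?thesis unfolding D_def using r by (intro summable_mult summable_poly_power) auto
  qed
  interpret finite_measure "sphere_measure :: 'a measure" by (rule finite_measure_sphere_measure)
  have "(\<lambda>m. integral\<^sup>L sphere_measure (F m)) sums (\<integral>q. (\<Sum>m. F m q) \<partial>sphere_measure)"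
  proof (rule sums_integral)
    show "integrable sphere_measure (F m)" for m by (rule F_int)
    show "AE q in sphere_measure. summable (\<lambda>m. norm (F m q))"
      by (rule AE_I2) (use F_bound in \<open>auto intro!: summable_comparison_test'[OF D_sum]\<close>)
    show "summable (\<lambda>m. \<integral>q. norm (F m q) \<partial>sphere_measure)"
    proof (rule summable_comparison_test')
      show "summable (\<lambda>m. \<omega> * D m)" by (intro summable_mult D_sum)
      fix m :: nat
      have "(\<integral>q. norm (F m q) \<partial>sphere_measure) \<le> (\<integral>q. D m \<partial>(sphere_measure :: 'a measure))"
        using F_bound by (intro integral_mono integrable_norm F_int) auto
      also have "\<dots> = \<omega> * D m" by (simp add: \<omega>_def)
      finally show "norm (\<integral>q. norm (F m q) \<partial>sphere_measure) \<le> \<omega> * D m" by simp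
    qed
  qed
  moreover have "(\<integral>q. (\<Sum>m. F m q) \<partial>sphere_measure) =
     (\<integral>q. real L * (g q * poisson_kernel L r (q \<bullet> p)) \<partial>sphere_measure)"
  proof (rule Bochner_Integration.integral_cong[OF refl])
    fix q :: 'a assume "q \<in> space sphere_measure"
    then have q: "norm q = 1" by simp
    have "(\<lambda>m. g q * ((real m + real L) * gegenbauer (real L) m (q \<bullet> p) * r ^ m)) sums
        (g q * (real L * poisson_kernel L r (q \<bullet> p)))"
      using r by (intro sums_mult poisson_kernel_sums qp q) auto
    then show "(\<Sum>m. F m q) = real L * (g q * poisson_kernel L r (q \<bullet> p))"
      by (simp add: sums_iff F_def mult_ac)
  qed
  moreover have "integral\<^sup>L sphere_measure (F m) =
     (real m + real L) * r ^ m * (\<integral>q. g q * gegenbauer (real L) m (q \<bullet> p) \<partial>sphere_measure)" for m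
    unfolding F_def by simp
  ultimately show ?thesis by simp
qed

lemma poisson_kernel_approximate_identity:
  fixes p :: "'a::euclidean_space" and L :: nat
  assumes p: "norm p = 1" and L: "2 * L + 2 = DIM('a)" "L > 0"
    and g: "continuous_on (sphere 0 1) g"
  shows "((\<lambda>r. \<integral>q. g q * poisson_kernel L r (q \<bullet> p) \<partial>sphere_measure)
     \<longlongrightarrow> measure (sphere_measure :: 'a measure) (sphere 0 1) * g p) (at_left 1)"
proof -
  define \<omega> where "\<omega> = measure (sphere_measure :: 'a measure) (sphere 0 1)"
  define K where "K r q = poisson_kernel L r (q \<bullet> p)" for r and q :: 'a
  interpret finite_measure "sphere_measure :: 'a measure" by (rule finite_measure_sphere_measure)
  \<comment> \<open>This form shows the positivity of the denominator and, as r tends to 1, a lower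
    bound for it away from p.\<close>
  have den: "1 - 2 * r * (q \<bullet> p) + r^2 = (1 - r)^2 + r * (norm (q - p))^2" if "norm q = 1" for r and q :: 'a
  proof -
    have e: "(norm (q - p))^2 = 2 - 2 * (q \<bullet> p)"
      unfolding power2_norm_eq_inner using p that
      by (simp add: inner_diff inner_commute norm_eq_1)
    show ?thesis unfolding e by (simp add: power2_eq_square algebra_simps)
  qed
  have den_pos: "1 - 2 * r * (q \<bullet> p) + r^2 > 0" if "norm q = 1" "0 \<le> r" "r < 1" for r and q :: 'a
    unfolding den[OF that(1)] using that by (intro add_pos_nonneg) auto
  have K_nonneg: "K r q \<ge> 0" if "norm q = 1" "0 \<le> r" "r < 1" for r q
    unfolding K_def poisson_kernel_def using den_pos[OF that] that power_le_one[of r 2] by simp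
  have K_cont: "continuous_on (sphere 0 1) (K r)" if "0 \<le> r" "r < 1" for r
    unfolding K_def poisson_kernel_def using den_pos[OF _ that] by (intro continuous_intros) force
  \<comment> \<open>For the constant function 1 only the term m = 0 of the expansion
    survives.\<close>
  have mass: "(\<integral>q. K r q \<partial>sphere_measure) = \<omega>" if r: "0 \<le> r" "r < 1" for r
  proof -
    have "(\<lambda>m. (real m + real L) * r ^ m * (\<integral>q. 1 * gegenbauer (real L) m (q \<bullet> p) \<partial>sphere_measure)) sums
      (real L * (\<integral>q. 1 * K r q \<partial>sphere_measure))"
      unfolding K_def by (rule poisson_integral_sums[OF p L r]) (intro continuous_intros)
    moreover have "(real m + real L) * r ^ m * (\<integral>q. 1 * gegenbauer (real L) m (q \<bullet> p) \<partial>sphere_measure) =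
        (if m = 0 then real L * \<omega> else 0)" for m
      using integral_gegenbauer_sphere[OF p, of "real L" m] L by (auto simp: \<omega>_def)
    ultimately have "(\<lambda>m. if m = 0 then real L * \<omega> else 0) sums (real L * (\<integral>q. K r q \<partial>sphere_measure))"
      by simp
    from sums_unique2[OF this sums_single[of 0 "\<lambda>_. real L * \<omega>"]] show ?thesis using L by simp
  qed
  have \<omega>: "\<omega> \<ge> 0" by (simp add: \<omega>_def)
  obtain M where M: "M \<ge> 0" "\<And>x. x \<in> sphere 0 1 \<Longrightarrow> \<bar>g x\<bar> \<le> M"
    using continuous_on_sphere_bounded[OF g] by metis
  show ?thesis unfolding K_def[symmetric] \<omega>_def[symmetric]
  proof (rule tendstoI)
    fix \<epsilon> :: real assume \<epsilon>: "\<epsilon> > 0"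
    \<comment> \<open>The summand 1 keeps the divisor positive; one half of \<epsilon> serves the
      points near p, the other the points far from p.\<close>
    define \<epsilon>' where "\<epsilon>' = \<epsilon> / (2 * (\<omega> + 1))"
    have \<epsilon>': "\<epsilon>' > 0" using \<epsilon> \<omega> by (simp add: \<epsilon>'_def)
    obtain d where d: "d > 0" "\<And>q. norm q = 1 \<Longrightarrow> dist q p < d \<Longrightarrow> dist (g q) (g p) < \<epsilon>'"
      using g p \<epsilon>' unfolding continuous_on_iff by (metis mem_sphere_0)
    define B where "B r = (1 - r\<^sup>2) / (r * d^2) ^ (L + 1)" for r
    have "(B \<longlongrightarrow> (1 - 1\<^sup>2) / (1 * d^2) ^ (L + 1)) (at_left 1)"
      unfolding B_def using d by (intro tendsto_intros) auto
    then have "((\<lambda>r. 2 * M * \<omega> * B r) \<longlongrightarrow> 2 * M * \<omega> * 0) (at_left 1)"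
      by (intro tendsto_intros) simp
    then have "\<forall>\<^sub>F r in at_left 1. 2 * M * \<omega> * B r < \<epsilon> / 2"
      using \<epsilon> by (intro order_tendstoD) auto
    moreover have "\<forall>\<^sub>F r in at_left (1::real). r \<in> {0<..<1}"
      by (rule eventually_at_left_real) simp
    ultimately show "\<forall>\<^sub>F r in at_left 1. dist (\<integral>q. g q * K r q \<partial>sphere_measure) (\<omega> * g p) < \<epsilon>"
    proof eventually_elim
      case (elim r)
      then have r: "0 < r" "0 \<le> r" "r < 1" by auto
      have int: "integrable sphere_measure (K r)" "integrable sphere_measure (\<lambda>q. g q * K r q)"
        by (intro integrable_sphere continuous_intros g K_cont r)+
      have "(\<integral>q. g q * K r q \<partial>sphere_measure) - \<omega> * g p =
          (\<integral>q. g q * K r q - g p * K r q \<partial>sphere_measure)"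
        using int mass[OF r(2,3)] by simp
      also have "\<bar>\<dots>\<bar> \<le> (\<integral>q. \<epsilon>' * K r q + 2 * M * B r \<partial>sphere_measure)"
      proof (rule order_trans[OF integral_abs_bound integral_mono])
        show "integrable sphere_measure (\<lambda>q. \<bar>g q * K r q - g p * K r q\<bar>)"
          "integrable sphere_measure (\<lambda>q. \<epsilon>' * K r q + 2 * M * B r)"
          using int by auto
        fix q :: 'a assume "q \<in> space sphere_measure"
        then have q: "norm q = 1" by simp
        have Kq: "K r q \<ge> 0" by (rule K_nonneg[OF q r(2,3)])
        have Bn: "B r \<ge> 0" unfolding B_def using r power_le_one[of r 2] by simp
        have "\<bar>g q - g p\<bar> * K r q \<le> \<epsilon>' * K r q + 2 * M * B r"
        proof (cases "dist q p < d")
          case True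
          then have "\<bar>g q - g p\<bar> \<le> \<epsilon>'" using d(2)[OF q] by (simp add: dist_real_def less_imp_le)
          then have "\<bar>g q - g p\<bar> * K r q \<le> \<epsilon>' * K r q" using Kq by (rule mult_right_mono)
          then show ?thesis using M(1) Bn by (simp add: add_increasing2)
        next
          case False
          then have "d^2 \<le> (norm (q - p))^2" using d(1) by (intro power_mono) (auto simp: dist_norm)
          then have "r * d^2 \<le> 1 - 2 * r * (q \<bullet> p) + r^2"
            unfolding den[OF q] using r by (intro add_increasing mult_left_mono) auto
          then have "K r q \<le> B r"
            unfolding K_def poisson_kernel_def B_def using r d(1) power_le_one[of r 2]
            by (intro divide_left_mono power_mono mult_pos_pos zero_less_power) (auto intro: den_pos[OF q])
          moreover have "\<bar>g q - g p\<bar> \<le> 2 * M" using M(2)[of q] M(2)[of p] p q by simp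
          ultimately have "\<bar>g q - g p\<bar> * K r q \<le> 2 * M * B r" using Kq M(1) by (intro mult_mono) auto
          then show ?thesis using Kq \<epsilon>' by (simp add: add_increasing)
        qed
        then show "\<bar>g q * K r q - g p * K r q\<bar> \<le> \<epsilon>' * K r q + 2 * M * B r"
          using Kq by (simp add: left_diff_distrib[symmetric] abs_mult)
      qed
      also have "\<dots> = \<epsilon>' * \<omega> + 2 * M * \<omega> * B r"
        using int mass[OF r(2,3)] by (simp add: \<omega>_def)
      also have "\<epsilon>' * \<omega> \<le> \<epsilon> / 2" using \<epsilon> \<omega> by (simp add: \<epsilon>'_def field_simps)
      also have "\<epsilon> / 2 + 2 * M * \<omega> * B r < \<epsilon>" using elim by simp
      finally show ?case by (simp add: dist_real_def)
    qed
  qed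
qed

subsection \<open>The horizontal Laplacian of zonal functions\<close>

lemma left_act_add: "left_act g (x + y) = left_act g x + left_act g y"
  by (simp add: left_act_def vec_eq_iff prod_eq_iff qmult_def algebra_simps)

lemma left_act_scaleR: "left_act g (c *\<^sub>R x) = c *\<^sub>R left_act g x"
  by (simp add: left_act_def vec_eq_iff prod_eq_iff qmult_def scaleR_conv_of_real algebra_simps)

lemma left_act_left_act: "left_act g (left_act h x) = left_act (qmult g h) x"
  by (simp add: left_act_def vec_eq_iff prod_eq_iff qmult_def algebra_simps)

lemma left_act_decompose:
  "left_act g x = Re (fst g) *\<^sub>R x + Im (fst g) *\<^sub>R left_act (\<i>, 0) x +
     Re (snd g) *\<^sub>R left_act (0, 1) x + Im (snd g) *\<^sub>R left_act (0, \<i>) x"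
  by (simp add: left_act_def vec_eq_iff prod_eq_iff qmult_def complex_eq_iff)

lemma left_act_uminus: "left_act (- a, - b) x = - left_act (a, b) x"
  by (simp add: left_act_def vec_eq_iff prod_eq_iff qmult_def)

lemma left_act_one: "left_act (1, 0) x = x"
  by (simp add: left_act_def vec_eq_iff prod_eq_iff qmult_def)

text \<open>The adjoint of multiplication by a quaternion is multiplication by its conjugate, and
  the conjugate of a + bJ is \<open>cnj a\<close> - bJ.\<close>

lemma left_act_inner:
  fixes x y :: "'n::finite qspace"
  shows "left_act (a, b) x \<bullet> y = x \<bullet> left_act (cnj a, - b) y"
proof -
  have q: "qmult (a, b) u \<bullet> v = u \<bullet> qmult (cnj a, - b) v" for u v
    by (cases u; cases v) (simp add: qmult_def inner_complex_def algebra_simps)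
  show ?thesis by (cases x; cases y) (simp add: left_act_def inner_vec_def q)
qed

abbreviation (input) qI :: "'n::finite qspace \<Rightarrow> 'n qspace" where "qI \<equiv> left_act (\<i>, 0)"
abbreviation (input) qJ :: "'n::finite qspace \<Rightarrow> 'n qspace" where "qJ \<equiv> left_act (0, 1)"
abbreviation (input) qK :: "'n::finite qspace \<Rightarrow> 'n qspace" where "qK \<equiv> left_act (0, \<i>)"

lemma quaternion_units:
  "qI (qI x) = - x" "qJ (qJ x) = - x" "qK (qK x) = - x"
  "qI (qJ x) = qK x" "qJ (qK x) = qI x" "qK (qI x) = qJ x"
  "qJ (qI x) = - qK x" "qK (qJ x) = - qI x" "qI (qK x) = - qJ x"
  using left_act_uminus[of 1 0 x] left_act_uminus[of \<i> 0 x] left_act_uminus[of 0 1 x] left_act_uminus[of 0 \<i> x]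
  unfolding left_act_left_act qmult_def by (simp_all add: left_act_one)

lemma quaternion_units_skew:
  "qI x \<bullet> y = - (x \<bullet> qI y)" "qJ x \<bullet> y = - (x \<bullet> qJ y)" "qK x \<bullet> y = - (x \<bullet> qK y)"
  using left_act_uminus[of \<i> 0 y] left_act_uminus[of 0 1 y] left_act_uminus[of 0 \<i> y]
  unfolding left_act_inner by simp_all

lemma quaternion_units_orthogonal:
  "q \<bullet> qI q = 0" "q \<bullet> qJ q = 0" "q \<bullet> qK q = 0"
proof -
  show "q \<bullet> qI q = 0" using quaternion_units_skew(1)[of q q] by (simp add: inner_commute)
  show "q \<bullet> qJ q = 0" using quaternion_units_skew(2)[of q q] by (simp add: inner_commute)
  show "q \<bullet> qK q = 0" using quaternion_units_skew(3)[of q q] by (simp add: inner_commute)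
qed

lemma horizontal_space_iff:
  "v \<in> horizontal_space q \<longleftrightarrow> v \<bullet> q = 0 \<and> v \<bullet> qI q = 0 \<and> v \<bullet> qJ q = 0 \<and> v \<bullet> qK q = 0"
proof
  assume "v \<in> horizontal_space q"
  then have "v \<bullet> q = 0" "\<And>u. Re (fst u) = 0 \<Longrightarrow> v \<bullet> left_act u q = 0"
    by (auto simp: horizontal_space_def)
  then show "v \<bullet> q = 0 \<and> v \<bullet> qI q = 0 \<and> v \<bullet> qJ q = 0 \<and> v \<bullet> qK q = 0" by simp
next
  assume "v \<bullet> q = 0 \<and> v \<bullet> qI q = 0 \<and> v \<bullet> qJ q = 0 \<and> v \<bullet> qK q = 0"
  moreover from this have "v \<bullet> left_act u q = 0" if "Re (fst u) = 0" for u
    using that by (subst left_act_decompose) (simp add: inner_add_right)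
  ultimately show "v \<in> horizontal_space q" by (simp add: horizontal_space_def)
qed

lemma horizontal_frame:
  fixes q :: "'n::finite qspace"
  shows "pairwise orthogonal (horizontal_frame q)" "\<And>v. v \<in> horizontal_frame q \<Longrightarrow> norm v = 1"
    "span (horizontal_frame q) = horizontal_space q" "finite (horizontal_frame q)"
    "\<And>v. v \<in> horizontal_frame q \<Longrightarrow> v \<in> horizontal_space q"
proof -
  have "subspace (horizontal_space q)"
    by (rule subspaceI) (auto simp: horizontal_space_iff inner_add_left)
  then obtain B where "B \<subseteq> horizontal_space q" "pairwise orthogonal B" "\<And>x. x \<in> B \<Longrightarrow> norm x = 1"
     "independent B" "card B = dim (horizontal_space q)" "span B = horizontal_space q"
    by (rule orthonormal_basis_subspace) blast
  then have ex: "\<exists>B. pairwise orthogonal B \<and> (\<forall>v\<in>B. norm v = 1) \<and> span B = horizontal_space q" by blast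
  have *: "pairwise orthogonal (horizontal_frame q) \<and> (\<forall>v\<in>horizontal_frame q. norm v = 1) \<and>
      span (horizontal_frame q) = horizontal_space q"
    unfolding horizontal_frame_def by (rule someI_ex[OF ex])
  then show "pairwise orthogonal (horizontal_frame q)" "\<And>v. v \<in> horizontal_frame q \<Longrightarrow> norm v = 1"
    "span (horizontal_frame q) = horizontal_space q" by auto
  from * have "0 \<notin> horizontal_frame q" by force
  with * show "finite (horizontal_frame q)"
    using pairwise_orthogonal_independent independent_imp_finite by blast
  show "\<And>v. v \<in> horizontal_frame q \<Longrightarrow> v \<in> horizontal_space q" using * span_base by blast
qed

lemma quaternion_frame_norms:
  fixes q :: "'n::finite qspace"
  assumes "norm q = 1"
  shows "q \<bullet> q = 1" "qI q \<bullet> qI q = 1" "qJ q \<bullet> qJ q = 1" "qK q \<bullet> qK q = 1"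
  using assms by (simp_all add: quaternion_units_skew quaternion_units norm_eq_1)

text \<open>The vectors q, Iq, Jq, Kq are orthonormal and complete the horizontal frame to a basis
  of the whole space. Thus sums over the frame picked by \<open>SOME\<close> have a value that does
  not depend on the choice.\<close>

lemma horizontal_frame_parseval:
  fixes q x y :: "'n::finite qspace"
  assumes q: "norm q = 1"
  shows "(\<Sum>v\<in>horizontal_frame q. (v \<bullet> x) * (v \<bullet> y)) =
     x \<bullet> y - (x \<bullet> q) * (y \<bullet> q) - (x \<bullet> qI q) * (y \<bullet> qI q) - (x \<bullet> qJ q) * (y \<bullet> qJ q) - (x \<bullet> qK q) * (y \<bullet> qK q)"
proof -
  define B where "B = horizontal_frame q"
  define y' where "y' = y - (y \<bullet> q) *\<^sub>R q - (y \<bullet> qI q) *\<^sub>R qI q - (y \<bullet> qJ q) *\<^sub>R qJ q - (y \<bullet> qK q) *\<^sub>R qK q"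
  have orth: "qI q \<bullet> q = 0" "qJ q \<bullet> q = 0" "qK q \<bullet> q = 0"
    "qI q \<bullet> qJ q = 0" "qI q \<bullet> qK q = 0" "qJ q \<bullet> qK q = 0" "qJ q \<bullet> qI q = 0" "qK q \<bullet> qI q = 0" "qK q \<bullet> qJ q = 0"
    by (simp_all add: quaternion_units_skew quaternion_units quaternion_units_orthogonal)
  have "y' \<in> horizontal_space q"
    using quaternion_frame_norms[OF q] orth quaternion_units_orthogonal[of q]
    unfolding horizontal_space_iff y'_def by (simp add: inner_diff_left)
  then have "(\<Sum>v\<in>B. (y' \<bullet> v) *\<^sub>R v) = y'"
    unfolding B_def
    by (intro orthonormal_basis_expand horizontal_frame(1,4)) (simp_all add: horizontal_frame(2)[of _ q] horizontal_frame(3))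
  then have "x \<bullet> y' = (\<Sum>v\<in>B. (y' \<bullet> v) * (x \<bullet> v))" by (metis (no_types, lifting) inner_scaleR_right inner_sum_right sum.cong)
  also have "\<dots> = (\<Sum>v\<in>B. (v \<bullet> x) * (v \<bullet> y))"
  proof (rule sum.cong[OF refl])
    fix v assume "v \<in> B"
    then have "v \<bullet> q = 0" "v \<bullet> qI q = 0" "v \<bullet> qJ q = 0" "v \<bullet> qK q = 0"
      using horizontal_frame(5)[of v q] by (auto simp: B_def horizontal_space_iff)
    then have "v \<bullet> y' = v \<bullet> y" by (simp add: y'_def inner_diff_right)
    then have "y' \<bullet> v = v \<bullet> y" by (simp add: inner_commute)
    then show "(y' \<bullet> v) * (x \<bullet> v) = (v \<bullet> x) * (v \<bullet> y)" by (simp add: inner_commute)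
  qed
  finally show ?thesis by (simp add: B_def y'_def inner_diff_right mult.commute)
qed

text \<open>The number of frame vectors is the trace of the projection onto the horizontal
  space.\<close>

lemma card_horizontal_frame:
  fixes q :: "'n::finite qspace"
  assumes q: "norm q = 1"
  shows "real (card (horizontal_frame q)) = 4 * real CARD('n)"
proof -
  have par: "(\<Sum>b\<in>Basis. (z \<bullet> b)^2) = z \<bullet> z" for z :: "'n qspace"
    by (simp add: euclidean_inner[of z z] power2_eq_square)
  have "real (card (horizontal_frame q)) = (\<Sum>v\<in>horizontal_frame q. v \<bullet> v)"
    using horizontal_frame(2)[of _ q] by (simp add: norm_eq_1)
  also have "\<dots> = (\<Sum>v\<in>horizontal_frame q. \<Sum>b\<in>Basis. (v \<bullet> b) * (v \<bullet> b))"
    by (simp add: euclidean_inner[symmetric])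
  also have "\<dots> = (\<Sum>b\<in>Basis. \<Sum>v\<in>horizontal_frame q. (v \<bullet> b) * (v \<bullet> b))" by (rule sum.swap)
  also have "\<dots> = (\<Sum>b\<in>Basis. 1 - (q \<bullet> b)\<^sup>2 - (qI q \<bullet> b)\<^sup>2 - (qJ q \<bullet> b)\<^sup>2 - (qK q \<bullet> b)\<^sup>2)"
    unfolding horizontal_frame_parseval[OF q] by (intro sum.cong refl) (simp add: power2_eq_square inner_commute)
  also have "\<dots> = real DIM('n qspace) - 4"
    unfolding sum_subtractf par quaternion_frame_norms[OF q] by simp
  finally show ?thesis by simp
qed

text \<open>With \<open>w = \<langle>q, p\<rangle>\<close> the quaternionic inner product, \<open>zY p q = |w|^2\<close> and \<open>zS p q\<close> is the squared
  modulus of the first complex component of \<open>w\<close>.\<close>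

definition zS :: "'n::finite qspace \<Rightarrow> 'n qspace \<Rightarrow> real" where
  "zS p q = (q \<bullet> p)^2 + (q \<bullet> qI p)^2"

definition zY :: "'n::finite qspace \<Rightarrow> 'n qspace \<Rightarrow> real" where
  "zY p q = zS p q + (q \<bullet> qJ p)^2 + (q \<bullet> qK p)^2"

text \<open>The \<open>\<xi> a\<close> are the differentials of the four real components of w. Their
  horizontal parts are mutually orthogonal and equally long, which is why the horizontal Laplacian
  maps functions of \<open>zS\<close> and \<open>zY\<close> to such functions.\<close>

lemma horizontal_frame_orthogonality:
  fixes q p :: "'n::finite qspace"
  assumes q: "norm q = 1" and p: "norm p = 1"
  defines "\<xi> \<equiv> (\<lambda>a v. v \<bullet> (if a = 0 then p else if a = 1 then qI p else if a = 2 then qJ p else qK p))"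
  assumes ab: "a < 4" "b < (4::nat)"
  shows "(\<Sum>v\<in>horizontal_frame q. \<xi> a v * \<xi> b v) = (if a = b then 1 - zY p q else 0)"
proof -
  define w0 w1 w2 w3 where w: "w0 = q \<bullet> p" "w1 = q \<bullet> qI p" "w2 = q \<bullet> qJ p" "w3 = q \<bullet> qK p"
  have *: "p \<bullet> q = w0" "p \<bullet> qI q = - w1" "p \<bullet> qJ q = - w2" "p \<bullet> qK q = - w3"
    "qI p \<bullet> q = w1" "qI p \<bullet> qI q = w0" "qI p \<bullet> qJ q = w3" "qI p \<bullet> qK q = - w2"
    "qJ p \<bullet> q = w2" "qJ p \<bullet> qI q = - w3" "qJ p \<bullet> qJ q = w0" "qJ p \<bullet> qK q = w1"
    "qK p \<bullet> q = w3" "qK p \<bullet> qI q = w2" "qK p \<bullet> qJ q = - w1" "qK p \<bullet> qK q = w0"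
    by (subst inner_commute, simp add: w quaternion_units_skew quaternion_units)+
  have orth: "p \<bullet> p = 1" "qI p \<bullet> qI p = 1" "qJ p \<bullet> qJ p = 1" "qK p \<bullet> qK p = 1"
    "p \<bullet> qI p = 0" "p \<bullet> qJ p = 0" "p \<bullet> qK p = 0" "qI p \<bullet> p = 0" "qJ p \<bullet> p = 0" "qK p \<bullet> p = 0"
    "qI p \<bullet> qJ p = 0" "qI p \<bullet> qK p = 0" "qJ p \<bullet> qK p = 0" "qJ p \<bullet> qI p = 0" "qK p \<bullet> qI p = 0" "qK p \<bullet> qJ p = 0"
    using quaternion_frame_norms[OF p]
    by (simp_all add: quaternion_units_skew quaternion_units quaternion_units_orthogonal)
  have "zY p q = w0\<^sup>2 + w1\<^sup>2 + w2\<^sup>2 + w3\<^sup>2" by (simp add: zY_def zS_def w)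
  moreover have "a = 0 \<or> a = 1 \<or> a = 2 \<or> a = 3" "b = 0 \<or> b = 1 \<or> b = 2 \<or> b = 3" using ab by auto
  ultimately show ?thesis
    unfolding \<xi>_def horizontal_frame_parseval[OF q]
    by (elim disjE) (simp_all add: * orth power2_eq_square)
qed

lemma circle_action: "left_act (cis \<theta>, 0) x = cos \<theta> *\<^sub>R x + sin \<theta> *\<^sub>R qI x"
  by (subst left_act_decompose) simp

lemma circle_action_inner:
  "left_act (cis \<theta>, 0) q \<bullet> p = cos \<theta> * (q \<bullet> p) - sin \<theta> * (q \<bullet> qI p)"
  "left_act (cis \<theta>, 0) q \<bullet> qI p = cos \<theta> * (q \<bullet> qI p) + sin \<theta> * (q \<bullet> p)"
  "left_act (cis \<theta>, 0) q \<bullet> qJ p = cos \<theta> * (q \<bullet> qJ p) - sin \<theta> * (q \<bullet> qK p)"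
  "left_act (cis \<theta>, 0) q \<bullet> qK p = cos \<theta> * (q \<bullet> qK p) + sin \<theta> * (q \<bullet> qJ p)"
  unfolding circle_action by (simp_all add: inner_add_left quaternion_units_skew quaternion_units)

lemma rotation_sum_squares:
  "(cos \<theta> * a - sin \<theta> * b)^2 + (cos \<theta> * b + sin \<theta> * a)^2 = a^2 + (b::real)^2"
proof -
  have "(cos \<theta> * a - sin \<theta> * b)^2 + (cos \<theta> * b + sin \<theta> * a)^2 = ((sin \<theta>)^2 + (cos \<theta>)^2) * (a^2 + b^2)"
    by (simp only: power2_eq_square algebra_simps)
  then show ?thesis by simp
qed

lemma z_circle_invariant:
  "zS p (left_act (cis \<theta>, 0) q) = zS p q" "zY p (left_act (cis \<theta>, 0) q) = zY p q"
  using rotation_sum_squares[of \<theta> "q \<bullet> p" "q \<bullet> qI p"] rotation_sum_squares[of \<theta> "q \<bullet> qJ p" "q \<bullet> qK p"]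
  unfolding zY_def zS_def circle_action_inner[of \<theta> q p] by simp_all

text \<open>The horizontal Laplacian of S^a Y^b in terms of S and Y. The truncated exponents
  \<open>a - 1\<close> and \<open>b - 1\<close> come with a factor that vanishes for a = 0 and b =
  0, respectively.\<close>

definition mono_lap :: "real \<Rightarrow> nat \<Rightarrow> nat \<Rightarrow> real \<Rightarrow> real \<Rightarrow> real" where
  "mono_lap n a b S Y =
     (1 - Y) * (4 * (real a)^2 * S ^ (a - 1) * Y ^ b + 4 * real b * (2 * real a + real b + 1) * S ^ a * Y ^ (b - 1))
       - 8 * n * (real a + real b) * S ^ a * Y ^ b"

lemma second_deriv_sum_monomials:
  fixes S Y S' Y' :: "real \<Rightarrow> real"
  assumes S: "\<And>s. (S has_real_derivative S' s) (at s)" and Y: "\<And>s. (Y has_real_derivative Y' s) (at s)"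
    and S'': "(S' has_real_derivative S'') (at 0)" and Y'': "(Y' has_real_derivative Y'') (at 0)"
  shows "(deriv ^^ 2) (\<lambda>s. \<Sum>i\<in>I. c i * S s ^ a i * Y s ^ b i) 0 =
     (\<Sum>i\<in>I. c i *
        (real (a i) * real (a i - 1) * S 0 ^ (a i - 2) * Y 0 ^ b i * (S' 0)^2 +
         2 * real (a i) * real (b i) * S 0 ^ (a i - 1) * Y 0 ^ (b i - 1) * (S' 0 * Y' 0) +
         real (b i) * real (b i - 1) * S 0 ^ a i * Y 0 ^ (b i - 2) * (Y' 0)^2 +
         real (a i) * S 0 ^ (a i - 1) * Y 0 ^ b i * S'' + real (b i) * S 0 ^ a i * Y 0 ^ (b i - 1) * Y''))"
  (is "_ = ?R")
proof -
  define f' where "f' s = (\<Sum>i\<in>I. c i * (real (a i) * (S s ^ (a i - 1) * S' s) * Y s ^ b i +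
      real (b i) * (Y s ^ (b i - 1) * Y' s) * S s ^ a i))" for s
  have pw: "((\<lambda>s. f s ^ k) has_real_derivative real k * (f s ^ (k - 1) * d)) (at s)"
    if "(f has_real_derivative d) (at s)" for f :: "real \<Rightarrow> real" and d s k
    using DERIV_power[OF that, of k] by (simp add: mult_ac)
  have "((\<lambda>s. \<Sum>i\<in>I. c i * S s ^ a i * Y s ^ b i) has_real_derivative f' s) (at s)" for s
    unfolding f'_def mult.assoc
    by (intro DERIV_sum DERIV_cmult DERIV_cong[OF DERIV_mult[OF pw[OF S] pw[OF Y]]]) (simp add: mult_ac)
  then have d1: "deriv (\<lambda>s. \<Sum>i\<in>I. c i * S s ^ a i * Y s ^ b i) = f'"
    by (intro ext DERIV_imp_deriv)
  have "(f' has_real_derivative ?R) (at 0)"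
    unfolding f'_def
    by (intro DERIV_sum DERIV_cmult
       DERIV_cong[OF DERIV_add[OF
          DERIV_mult[OF DERIV_cmult[OF DERIV_mult[OF pw[OF S] S'']] pw[OF Y]]
          DERIV_mult[OF DERIV_cmult[OF DERIV_mult[OF pw[OF Y] Y'']] pw[OF S]]]])
      (simp add: algebra_simps power2_eq_square numeral_2_eq_2)
  then show ?thesis by (simp add: numeral_2_eq_2 d1 DERIV_imp_deriv)
qed

lemma horizontal_laplacian_sum_monomials:
  fixes q p :: "'n::finite qspace" and c :: "'i \<Rightarrow> real" and a b :: "'i \<Rightarrow> nat"
  assumes q: "norm q = 1" and p: "norm p = 1"
  shows "horizontal_laplacian (\<lambda>x. \<Sum>i\<in>I. c i * zS p x ^ a i * zY p x ^ b i) q =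
    (\<Sum>i\<in>I. c i * mono_lap (real CARD('n)) (a i) (b i) (zS p q) (zY p q))"
proof -
  define w where "w k = q \<bullet> (if k = 0 then p else if k = 1 then qI p else if k = 2 then qJ p else qK p)" for k :: nat
  define \<xi> where "\<xi> k v = v \<bullet> (if k = 0 then p else if k = 1 then qI p else if k = 2 then qJ p else qK p)"
    for k :: nat and v :: "'n qspace"
  define S Y where "S = zS p q" and "Y = zY p q"
  define n where "n = real CARD('n)"
  have zS: "zS p x = (\<Sum>k<2. (\<xi> k x)^2)" and zY: "zY p x = (\<Sum>k<4. (\<xi> k x)^2)" for x
    by (simp_all add: zS_def zY_def \<xi>_def numeral_2_eq_2 eval_nat_numeral)
  have S: "S = (\<Sum>k<2. (w k)^2)" and Y: "Y = (\<Sum>k<4. (w k)^2)"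
    unfolding S_def Y_def zS zY by (simp_all add: \<xi>_def w_def)
  define D where "D k s v = (w k * cos s + \<xi> k v * sin s) * (\<xi> k v * cos s - w k * sin s)"
    for k and s :: real and v
  have curve: "\<xi> k (cos s *\<^sub>R q + sin s *\<^sub>R v) = w k * cos s + \<xi> k v * sin s" for k s v
    by (simp add: \<xi>_def w_def inner_add_left mult.commute)
  \<comment> \<open>\<open>T\<close> and \<open>U\<close> are half the first and half the second
    derivative, at s = 0 along the great circle, of the sum of the first N squared components; N = 2
    belongs to S and N = 4 to Y.\<close>
  define T where "T N v = (\<Sum>k<N. w k * \<xi> k v)" for N v
  define U where "U N v = (\<Sum>k<N. (\<xi> k v)^2 - (w k)\<^sup>2)" for N v
  have d1: "((\<lambda>s. \<Sum>k<N. (\<xi> k (cos s *\<^sub>R q + sin s *\<^sub>R v))^2) has_real_derivative (\<Sum>k<N. 2 * D k s v)) (at s)"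
    for N :: nat and s v
    unfolding curve D_def by (intro DERIV_sum) (auto intro!: derivative_eq_intros simp: power2_eq_square algebra_simps)
  have d2: "((\<lambda>s. \<Sum>k<N. 2 * D k s v) has_real_derivative 2 * U N v) (at 0)" for N :: nat and v
    unfolding D_def U_def sum_distrib_left
    by (intro DERIV_sum) (auto intro!: derivative_eq_intros simp: power2_eq_square algebra_simps)
  define A2 A1 A0 where "A2 i = real (a i) * real (a i - 1) * S ^ (a i - 2)"
    and "A1 i = real (a i) * S ^ (a i - 1)" and "A0 i = S ^ a i" for i
  define B2 B1 B0 where "B2 i = real (b i) * real (b i - 1) * Y ^ (b i - 2)"
    and "B1 i = real (b i) * Y ^ (b i - 1)" and "B0 i = Y ^ b i" for i
  note AB = A2_def A1_def A0_def B2_def B1_def B0_def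
  define G where "G i v = A2 i * B0 i * (2 * T 2 v)^2 + 2 * A1 i * B1 i * (2 * T 2 v * (2 * T 4 v)) +
      A0 i * B2 i * (2 * T 4 v)^2 + A1 i * B0 i * (2 * U 2 v) + A0 i * B1 i * (2 * U 4 v)" for i v
  have at0: "(\<Sum>k<N. 2 * D k 0 v) = 2 * T N v" "(\<Sum>k<N. (\<xi> k (cos 0 *\<^sub>R q + sin 0 *\<^sub>R v))^2) = (\<Sum>k<N. (w k)^2)" for N v
    using curve[of _ 0] by (simp_all add: D_def T_def sum_distrib_left)
  have deriv2: "(deriv ^^ 2) (\<lambda>s. \<Sum>i\<in>I. c i * zS p (cos s *\<^sub>R q + sin s *\<^sub>R v) ^ a i *
      zY p (cos s *\<^sub>R q + sin s *\<^sub>R v) ^ b i) 0 = (\<Sum>i\<in>I. c i * G i v)" for v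
    unfolding zS zY
    by (subst second_deriv_sum_monomials[OF d1 d1 d2 d2]) (simp only: at0 G_def S Y AB mult_ac)
  have orth: "(\<Sum>v\<in>horizontal_frame q. \<xi> k v * \<xi> l v) = (if k = l then 1 - Y else 0)" if "k < 4" "l < 4" for k l
    using horizontal_frame_orthogonality[OF q p that] unfolding \<xi>_def Y_def by (simp cong: if_cong)
  \<comment> \<open>S is a partial sum of Y, so the product of their gradients sees the smaller
    index range only.\<close>
  have TT: "(\<Sum>v\<in>horizontal_frame q. T N v * T M v) = (1 - Y) * (\<Sum>k<N. (w k)^2)" if "N \<le> M" "M \<le> 4" for N M
  proof -
    have "(\<Sum>v\<in>horizontal_frame q. T N v * T M v) = (\<Sum>k<N. \<Sum>l<M. \<Sum>v\<in>horizontal_frame q. w k * w l * (\<xi> k v * \<xi> l v))"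
      unfolding T_def sum_product
      by (subst sum.swap, rule sum.cong[OF refl], subst sum.swap, intro sum.cong refl) (simp only: mult_ac)
    also have "\<dots> = (\<Sum>k<N. \<Sum>l<M. if l = k then (1 - Y) * (w k)^2 else 0)"
      unfolding sum_distrib_left[symmetric] using that
      by (intro sum.cong refl) (auto simp: orth power2_eq_square)
    also have "\<dots> = (1 - Y) * (\<Sum>k<N. (w k)^2)"
      unfolding sum_distrib_left using that by (intro sum.cong refl) auto
    finally show ?thesis .
  qed
  \<comment> \<open>The summand - (w k)^2 stems from the second derivative of cos s and is counted
    once for each of the 4 n frame vectors.\<close>
  have UU: "(\<Sum>v\<in>horizontal_frame q. U N v) = real N * (1 - Y) - 4 * n * (\<Sum>k<N. (w k)^2)" if "N \<le> 4" for N
  proof -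
    have "(\<Sum>v\<in>horizontal_frame q. U N v) =
       (\<Sum>k<N. (\<Sum>v\<in>horizontal_frame q. \<xi> k v * \<xi> k v) - real (card (horizontal_frame q)) * (w k)^2)"
      unfolding U_def by (subst sum.swap) (simp add: sum_subtractf power2_eq_square)
    also have "\<dots> = (\<Sum>k<N. (1 - Y) - 4 * n * (w k)^2)"
      using that card_horizontal_frame[OF q] by (intro sum.cong refl) (auto simp: orth n_def)
    finally show ?thesis by (simp add: sum_subtractf sum_distrib_left)
  qed
  have G: "(\<Sum>v\<in>horizontal_frame q. G i v) = mono_lap n (a i) (b i) S Y" for i
  proof -
    \<comment> \<open>These also hold for the exponents 0 and 1, where the truncated powers have
      coefficient zero.\<close>
    have s: "A2 i * S = (real (a i) - 1) * A1 i" "A1 i * S = real (a i) * A0 i"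
      "B2 i * Y = (real (b i) - 1) * B1 i" "B1 i * Y = real (b i) * B0 i"
      unfolding AB by (cases "a i"; cases "a i - 1"; simp; fail | cases "b i"; cases "b i - 1"; simp; fail)+
    have "(\<Sum>v\<in>horizontal_frame q. G i v) =
         4 * (A2 i * B0 i) * (\<Sum>v\<in>horizontal_frame q. T 2 v * T 2 v) +
         8 * (A1 i * B1 i) * (\<Sum>v\<in>horizontal_frame q. T 2 v * T 4 v) +
         4 * (A0 i * B2 i) * (\<Sum>v\<in>horizontal_frame q. T 4 v * T 4 v) +
         2 * (A1 i * B0 i) * (\<Sum>v\<in>horizontal_frame q. U 2 v) +
         2 * (A0 i * B1 i) * (\<Sum>v\<in>horizontal_frame q. U 4 v)"
      unfolding G_def sum.distrib sum_distrib_left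
      by (intro arg_cong2[where f = "(+)"] sum.cong refl) (simp_all add: power2_eq_square)
    also have "\<dots> = 4 * (A2 i * B0 i) * ((1 - Y) * S) + 8 * (A1 i * B1 i) * ((1 - Y) * S) +
         4 * (A0 i * B2 i) * ((1 - Y) * Y) + 2 * (A1 i * B0 i) * (2 * (1 - Y) - 4 * n * S) +
         2 * (A0 i * B1 i) * (4 * (1 - Y) - 4 * n * Y)"
      using TT[of 2 2] TT[of 2 4] TT[of 4 4] UU[of 2] UU[of 4] by (simp add: S[symmetric] Y[symmetric])
    also have "\<dots> = (1 - Y) * (4 * B0 i * (A2 i * S + A1 i) + 8 * B1 i * (A1 i * S) + 4 * A0 i * (B2 i * Y + 2 * B1 i))
        - 8 * n * (B0 i * (A1 i * S) + A0 i * (B1 i * Y))"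
      by (simp only: algebra_simps)
    also have "\<dots> = (1 - Y) * (4 * real (a i) * A1 i * B0 i + 4 * (2 * real (a i) + real (b i) + 1) * A0 i * B1 i)
        - 8 * n * (real (a i) + real (b i)) * A0 i * B0 i"
      unfolding s by (simp only: algebra_simps)
    also have "\<dots> = mono_lap n (a i) (b i) S Y"
      unfolding mono_lap_def AB by (simp add: power2_eq_square mult_ac)
    finally show ?thesis .
  qed
  have "horizontal_laplacian (\<lambda>x. \<Sum>i\<in>I. c i * zS p x ^ a i * zY p x ^ b i) q =
      (\<Sum>v\<in>horizontal_frame q. \<Sum>i\<in>I. c i * G i v)"
    unfolding horizontal_laplacian_def deriv2 ..
  also have "\<dots> = (\<Sum>i\<in>I. c i * (\<Sum>v\<in>horizontal_frame q. G i v))"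
    by (subst sum.swap) (simp add: sum_distrib_left)
  finally show ?thesis unfolding G n_def S_def Y_def .
qed

text \<open>Legendre's recursion turns the terms with S^(p-1) into terms with S^p, so that
  \<open>chebAvg\<close> factors out: the fibre variable separates and a problem in the exponent of
  Y alone is left.\<close>

lemma sum_leg_coeff_mono_lap:
  "(\<Sum>p\<le>J. leg_coeff J p * mono_lap n p (k + (J - p)) S Y) =
     4 * real k * (real k + 2 * real J + 1) * (1 - Y) * Y ^ (k - 1) * chebAvg (2 * J) S Y
     - 8 * n * (real k + real J) * Y ^ k * chebAvg (2 * J) S Y"
proof -
  define L where "L = leg_coeff J"
  let ?U = "\<Sum>p\<le>J. L p * (4 * (real p)^2 * S ^ (p - 1) * Y ^ (k + (J - p)))"
  let ?W = "\<lambda>p. - 4 * (real J - real p) * (real J + real p + 1) * L p * S ^ p * Y ^ (k + (J - p) - 1)"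
  let ?V = "\<lambda>p. L p * (4 * real (k + (J - p)) * (2 * real p + real (k + (J - p)) + 1) * S ^ p * Y ^ (k + (J - p) - 1))"
  \<comment> \<open>The index shift loses nothing: the term p = 0 on the left carries the factor
    p^2, the term p = J on the right the factor J - p.\<close>
  have A: "?U =
      (\<Sum>p\<le>J. ?W p)"
  proof (cases J)
    case (Suc J')
    have "?U =
        (\<Sum>p\<le>J'. 4 * ((real p + 1)^2 * L (Suc p)) * S ^ p * Y ^ (k + (J - Suc p)))"
      unfolding Suc by (subst sum.atMost_Suc_shift) (simp add: algebra_simps)
    also have "\<dots> = (\<Sum>p\<le>J'. ?W p)"
    proof (rule sum.cong[OF refl])
      fix p assume "p \<in> {..J'}"
      then have p: "p < J" using Suc by simp
      have e: "k + (J - p) - 1 = k + (J - Suc p)" using p by simp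
      show "4 * ((real p + 1)^2 * L (Suc p)) * S ^ p * Y ^ (k + (J - Suc p)) =
          ?W p"
        unfolding e leg_coeff_Suc[OF p, folded L_def] by simp
    qed
    finally show ?thesis unfolding Suc by simp
  qed simp
  have "(\<Sum>p\<le>J. L p * mono_lap n p (k + (J - p)) S Y) =
      (1 - Y) * (?U +
        (\<Sum>p\<le>J. ?V p))
      - (\<Sum>p\<le>J. L p * (8 * n * (real p + real (k + (J - p))) * S ^ p * Y ^ (k + (J - p))))"
    unfolding mono_lap_def sum.distrib[symmetric] sum_distrib_left sum_subtractf[symmetric]
    by (intro sum.cong refl) (simp only: algebra_simps)
  also have "(\<Sum>p\<le>J. L p * (8 * n * (real p + real (k + (J - p))) * S ^ p * Y ^ (k + (J - p)))) =
      8 * n * (real k + real J) * Y ^ k * chebAvg (2 * J) S Y"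
    unfolding chebAvg_even sum_distrib_left L_def[symmetric]
  proof (rule sum.cong[OF refl])
    fix p assume "p \<in> {..J}"
    then have e: "real p + real (k + (J - p)) = real k + real J" by simp
    show "L p * (8 * n * (real p + real (k + (J - p))) * S ^ p * Y ^ (k + (J - p))) =
        8 * n * (real k + real J) * Y ^ k * (L p * S ^ p * Y ^ (J - p))"
      unfolding e by (simp only: power_add mult_ac)
  qed
  also have "?U +
        (\<Sum>p\<le>J. ?V p) =
      4 * real k * (real k + 2 * real J + 1) * Y ^ (k - 1) * chebAvg (2 * J) S Y"
    unfolding A unfolding chebAvg_even sum_distrib_left L_def[symmetric] sum.distrib[symmetric]
  proof (rule sum.cong[OF refl])
    fix p assume "p \<in> {..J}"
    then have p: "real (J - p) = real J - real p" by (simp add: of_nat_diff)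
    have "?W p +
        ?V p =
        4 * (real k + 2 * real J + 1) * L p * S ^ p * (real k * Y ^ (k + (J - p) - 1))"
      unfolding of_nat_add p by (simp only: algebra_simps)
    also have "real k * Y ^ (k + (J - p) - 1) = real k * (Y ^ (k - 1) * Y ^ (J - p))"
      by (cases k) (auto simp: power_add)
    finally show "?W p +
        ?V p =
        4 * real k * (real k + 2 * real J + 1) * Y ^ (k - 1) * (L p * S ^ p * Y ^ (J - p))"
      by (simp only: mult_ac)
  qed
  finally show ?thesis unfolding L_def by (simp only: mult_ac)
qed

text \<open>The j-th component of C_m(Re w) averaged over the circle. As Y is invariant, the average
  affects only the factor \<open>chebH j\<close>.\<close>

definition zonal :: "nat \<Rightarrow> nat \<Rightarrow> nat \<Rightarrow> real \<Rightarrow> real \<Rightarrow> real" where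
  "zonal n m j S Y = rad_coeff (2 * real n + 1) m j Y * chebAvg j S Y"

definition eigval :: "nat \<Rightarrow> nat \<Rightarrow> nat \<Rightarrow> real" where
  "eigval n m j = real m * (real m + 4 * real n + 2) - real j * (real j + 2)"

lemma sum_telescope_two:
  fixes h :: "nat \<Rightarrow> 'a::ab_group_add"
  shows "(\<Sum>i\<le>N. h i - h (i + 2)) = h 0 + h 1 - h (N + 1) - h (N + 2)"
  by (induction N) simp_all

lemma zonal_eq_sum:
  "zonal n m (2 * J) S Y = (\<Sum>(i, p)\<in>{..m} \<times> {..J}.
     (geg_coeff (2 * real n + 1) m i * ballot i (2 * J) * leg_coeff J p) * S ^ p * Y ^ ((i - 2 * J) div 2 + (J - p)))"
  unfolding zonal_def rad_coeff_def chebAvg_even sum_product sum.cartesian_product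
  by (intro sum.cong refl) (auto simp: power_add)

text \<open>Once the fibre variable is separated, the sum over i equals the claimed multiple plus a
  telescoping sum, built from \<open>geg_coeff_ODE\<close> and \<open>ballot_step\<close>, whose
  ends vanish.\<close>

lemma horizontal_laplacian_zonal:
  fixes q p :: "'n::finite qspace"
  assumes q: "norm q = 1" and p: "norm p = 1"
  shows "horizontal_laplacian (\<lambda>x. zonal CARD('n) m j (zS p x) (zY p x)) q =
     - eigval CARD('n) m j * zonal CARD('n) m j (zS p q) (zY p q)"
proof (cases "even j")
  case False
  then have "zonal CARD('n) m j S Y = 0" for S Y by (simp add: zonal_def chebAvg_odd)
  then show ?thesis by (simp add: horizontal_laplacian_def numeral_2_eq_2)
next
  case True
  then obtain J where j: "j = 2 * J" by blast
  define n where "n = real CARD('n)"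
  define l where "l = 2 * n + 1"
  define a where "a = geg_coeff l m"
  define d where "d i = ballot i j" for i
  define k where "k i = (i - j) div 2" for i
  define S Y where "S = zS p q" and "Y = zY p q"
  define C where "C = chebAvg j S Y"
  have ballot_zero: "d i = 0" if "i < j \<or> odd (i + j)" for i using that by (auto simp: d_def ballot_simps)
  have ki: "real i = real j + 2 * real (k i)" if "j \<le> i" "even (i + j)" for i
  proof -
    from that have "i = j + 2 * k i" unfolding k_def by presburger
    then show ?thesis by (metis of_nat_add of_nat_mult of_nat_numeral)
  qed
  \<comment> \<open>The part with the lowered power of Y: for i = j + 2 k the factor 4 k (k + j + 1)
    equals (i - j) (i + j + 2).\<close>
  define g where "g i = a i * d i * (real i - real j) * (real i + real j + 2) * Y ^ (k i - 1)" for i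
  have step: "a i * d i * (real i * (real i + 2 * l) - real m * (real m + 2 * l)) * Y ^ k i = g (i + 2)" for i
  proof -
    have "a i * d i * (real i * (real i + 2 * l) - real m * (real m + 2 * l)) =
        (real i + 2) * (real i + 1) * a (i + 2) * d i"
      unfolding a_def geg_coeff_ODE by simp
    also have "\<dots> = a (i + 2) * ((real i + 2 - real j) * (real i + real j + 4) * d (i + 2))"
      unfolding d_def ballot_step by simp
    finally have e: "a i * d i * (real i * (real i + 2 * l) - real m * (real m + 2 * l)) =
        a (i + 2) * d (i + 2) * (real (i + 2) - real j) * (real (i + 2) + real j + 2)" by (simp add: algebra_simps)
    \<comment> \<open>In the middle case \<open>d (i + 2)\<close> is not zero, but the factor i + 2
      - j is.\<close>
    have "j \<le> i \<and> even (i + j) \<or> i + 2 = j \<or> (i + 2 < j \<or> odd (i + 2 + j))" by presburger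
    then show ?thesis
    proof (elim disjE)
      assume "j \<le> i \<and> even (i + j)"
      then have "k (i + 2) - 1 = k i" unfolding k_def by simp
      then show ?thesis unfolding e by (simp add: g_def)
    qed (simp_all add: e g_def ballot_zero)
  qed
  have summand: "a i * d i * (4 * real (k i) * (real (k i) + 2 * real J + 1) * (1 - Y) * Y ^ (k i - 1) * C
      - 8 * n * (real (k i) + real J) * Y ^ k i * C) =
      C * (g i - g (i + 2)) - eigval CARD('n) m j * (a i * d i * Y ^ k i * C)" for i
  proof (cases "j \<le> i \<and> even (i + j)")
    case False
    then have "d i = 0" using ballot_zero[of i] by auto
    then show ?thesis unfolding step[symmetric] by (simp add: g_def)
  next
    case True
    define P where "P = Y ^ (k i - 1)"
    have i: "real i = real j + 2 * real (k i)" using ki True by blast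
    have PY: "real (k i) * (Y * P) = real (k i) * Y ^ k i" by (cases "k i") (auto simp: P_def)
    have jJ: "real j = 2 * real J" using j by simp
    have "a i * d i * (4 * real (k i) * (real (k i) + 2 * real J + 1) * (1 - Y) * P * C
      - 8 * n * (real (k i) + real J) * Y ^ k i * C) =
      a i * d i * C * (4 * (real (k i) + 2 * real J + 1) * (real (k i) * P - real (k i) * (Y * P))
      - 8 * n * (real (k i) + real J) * Y ^ k i)" by (simp add: algebra_simps)
    also have "\<dots> = C * (g i - a i * d i * (real i * (real i + 2 * l) - real m * (real m + 2 * l)) * Y ^ k i)
       - eigval CARD('n) m j * (a i * d i * Y ^ k i * C)"
      unfolding PY g_def P_def[symmetric] eigval_def n_def[symmetric] i jJ l_def
      by (simp add: algebra_simps)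
    finally show ?thesis unfolding step P_def .
  qed
  have "horizontal_laplacian (\<lambda>x. zonal CARD('n) m j (zS p x) (zY p x)) q =
     (\<Sum>(i, r)\<in>{..m} \<times> {..J}. a i * d i * leg_coeff J r * mono_lap n r (k i + (J - r)) S Y)"
    unfolding j zonal_eq_sum case_prod_unfold
    by (subst horizontal_laplacian_sum_monomials[OF q p])
      (simp add: a_def d_def k_def l_def n_def S_def Y_def j)
  also have "\<dots> = (\<Sum>i\<le>m. a i * d i * (\<Sum>r\<le>J. leg_coeff J r * mono_lap n r (k i + (J - r)) S Y))"
    unfolding sum.cartesian_product[symmetric] sum_distrib_left by (simp only: mult.assoc)
  also have "\<dots> = (\<Sum>i\<le>m. C * (g i - g (i + 2)) - eigval CARD('n) m j * (a i * d i * Y ^ k i * C))"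
    unfolding sum_leg_coeff_mono_lap C_def[unfolded j, symmetric] summand ..
  also have "\<dots> = C * (g 0 + g 1 - g (m + 1) - g (m + 2)) - eigval CARD('n) m j * (\<Sum>i\<le>m. a i * d i * Y ^ k i * C)"
    unfolding sum_telescope_two[symmetric] by (simp only: sum_subtractf sum_distrib_left right_diff_distrib)
  also have "g 0 + g 1 - g (m + 1) - g (m + 2) = 0"
  proof -
    have "g 0 = 0" using ballot_zero[of 0] by (cases "j = 0") (auto simp: g_def)
    moreover have "g 1 = 0"
    proof (cases "j = 1")
      case False
      then have "1 < j \<or> odd (1 + j)" by presburger
      then show ?thesis using ballot_zero[of 1] by (simp add: g_def)
    qed (simp add: g_def)
    moreover have "g (m + 1) = 0" "g (m + 2) = 0" by (simp_all add: g_def a_def geg_coeff_simps(2))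
    ultimately show ?thesis by simp
  qed
  also have "(\<Sum>i\<le>m. a i * d i * Y ^ k i * C) = zonal CARD('n) m j (zS p q) (zY p q)"
    unfolding zonal_def rad_coeff_def sum_distrib_right
    by (simp add: a_def d_def k_def C_def S_def Y_def l_def n_def)
  finally show ?thesis by simp
qed

section \<open>Smoothness of the zonal functions\<close>

lemma real_polynomial_function_has_derivative:
  fixes g :: "'a::euclidean_space \<Rightarrow> real"
  assumes "real_polynomial_function g"
  shows "\<exists>g'. (\<forall>x. (g has_derivative g' x) (at x)) \<and> (\<forall>v. real_polynomial_function (\<lambda>x. g' x v))"
  using assms
proof induction
  case (linear f)
  then show ?case
    by (intro exI[of _ "\<lambda>x. f"]) (auto intro: bounded_linear_imp_has_derivative)
next
  case (const c)
  show ?case by (intro exI[of _ "\<lambda>x v. 0"]) auto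
next
  case (add f g)
  then obtain f' g' where "\<forall>x. (f has_derivative f' x) (at x)" "\<forall>v. real_polynomial_function (\<lambda>x. f' x v)"
    "\<forall>x. (g has_derivative g' x) (at x)" "\<forall>v. real_polynomial_function (\<lambda>x. g' x v)" by blast
  then show ?case
    by (intro exI[of _ "\<lambda>x v. f' x v + g' x v"]) (auto intro: has_derivative_add)
next
  case (mult f g)
  then obtain f' g' where "\<forall>x. (f has_derivative f' x) (at x)" "\<forall>v. real_polynomial_function (\<lambda>x. f' x v)"
    "\<forall>x. (g has_derivative g' x) (at x)" "\<forall>v. real_polynomial_function (\<lambda>x. g' x v)" by blast
  then show ?case using mult(1,2)
    by (intro exI[of _ "\<lambda>x v. f x * g' x v + f' x v * g x"]) (auto intro!: has_derivative_mult real_polynomial_function.intros(3,4))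
qed

text \<open>The derivative of a polynomial in a fixed direction is again a polynomial, so the
  recursion in \<open>Ck_on\<close> never stops.\<close>

lemma real_polynomial_function_Ck_on:
  assumes "real_polynomial_function g"
  shows "Ck_on k S g"
  using assms
proof (induction k arbitrary: g)
  case 0
  then show ?case
    using continuous_on_polymonial_function real_polynomial_function_eq by (metis Ck_on.simps(1))
next
  case (Suc k)
  then show ?case using real_polynomial_function_has_derivative[OF Suc.prems] by (metis Ck_on.simps(2))
qed

lemma real_polynomial_function_zonal:
  "real_polynomial_function (\<lambda>x. zonal n m j (zS p x) (zY p x))"
proof -
  have i: "real_polynomial_function (\<lambda>x. x \<bullet> u)" for u :: "'a qspace"
    by (intro real_polynomial_function.intros(1) bounded_linear_inner_left)
  have pw: "real_polynomial_function (\<lambda>x. f x ^ k)" if "real_polynomial_function f" for f :: "'a qspace \<Rightarrow> real" and k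
    using that by (induction k) auto
  have S: "real_polynomial_function (zS p)" unfolding zS_def[abs_def] by (intro real_polynomial_function.intros pw i)
  have Y: "real_polynomial_function (zY p)" unfolding zY_def[abs_def] by (intro real_polynomial_function.intros pw i S)
  show ?thesis unfolding zonal_def rad_coeff_def chebAvg_def
    by (intro real_polynomial_function.intros real_polynomial_function_sum pw S Y finite_atMost)
qed

subsection \<open>The heat semigroup on eigenfunctions\<close>

lemma orthogonal_transformation_circle_action:
  "orthogonal_transformation (left_act (cis \<theta>, 0) :: 'n::finite qspace \<Rightarrow> 'n qspace)"
proof -
  have "left_act (cis \<theta>, 0) v \<bullet> left_act (cis \<theta>, 0) w = v \<bullet> w" for v w :: "'n qspace"
    unfolding left_act_inner left_act_left_act by (simp add: qmult_def cis_mult cis_cnj left_act_one)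
  then show ?thesis
    by (simp add: orthogonal_transformation_def linear_iff left_act_add left_act_scaleR)
qed

lemma circle_orbit_action: "circle_orbit (left_act (cis \<theta>, 0) q) = circle_orbit q"
proof -
  have "left_act (cis a, 0) (left_act (cis b, 0) q) = left_act (cis (a + b), 0) q" for a b
    unfolding left_act_left_act by (simp add: qmult_def cis_mult)
  then have "circle_orbit (left_act (cis \<theta>, 0) q) = {left_act (cis (a + \<theta>), 0) q |a. True}"
    by (simp add: circle_orbit_def)
  also have "\<dots> = circle_orbit q"
    unfolding circle_orbit_def by (metis (no_types, opaque_lifting) diff_add_cancel)
  finally show ?thesis .
qed

lemma circle_orbit_self: "q \<in> circle_orbit q"
proof -
  have "left_act (cis 0, 0) q = q" by (simp add: left_act_one)
  then show ?thesis unfolding circle_orbit_def by (metis (mono_tags, lifting) mem_Collect_eq)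
qed

definition cp_fun :: "('n::finite qspace \<Rightarrow> real) \<Rightarrow> 'n cp_point \<Rightarrow> real" where
  "cp_fun G x = G (SOME q. q \<in> x)"

lemma cp_representative:
  obtains \<theta> where "(SOME x. x \<in> circle_orbit q) = left_act (cis \<theta>, 0) q"
proof -
  have "(SOME x. x \<in> circle_orbit q) \<in> circle_orbit q"
    by (rule someI[of "\<lambda>x. x \<in> circle_orbit q", OF circle_orbit_self])
  then show thesis using that unfolding circle_orbit_def by blast
qed

lemma cp_fun_circle_orbit:
  assumes "\<And>\<theta> x. G (left_act (cis \<theta>, 0) x) = G x"
  shows "cp_fun G (circle_orbit q) = G q"
  unfolding cp_fun_def using cp_representative[of q] assms by metis

lemma cp_smooth_imp_continuous: "cp_smooth f \<Longrightarrow> cp_continuous f"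
proof -
  assume "cp_smooth f"
  then obtain U g where U: "sphere 0 1 \<subseteq> U" "Ck_on 0 U g" "\<forall>q\<in>sphere 0 1. g q = f (circle_orbit q)"
    unfolding cp_smooth_def by blast
  then have "continuous_on (sphere 0 1) g" using continuous_on_subset by auto
  then show "cp_continuous f" unfolding cp_continuous_def using U(3) by (auto intro: continuous_on_eq)
qed

lemma cp_continuous_bounded:
  assumes "cp_continuous f"
  obtains M where "M \<ge> 0" "\<And>x. x \<in> cp_space \<Longrightarrow> \<bar>f x\<bar> \<le> M"
proof -
  obtain M where M: "M \<ge> 0" "\<And>q. q \<in> sphere 0 1 \<Longrightarrow> \<bar>f (circle_orbit q)\<bar> \<le> M"
    using continuous_on_sphere_bounded[OF assms[unfolded cp_continuous_def]] by blast
  show thesis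
  proof (rule that[OF M(1)])
    fix x :: "'a cp_point" assume "x \<in> cp_space"
    then obtain q where "q \<in> sphere 0 1" "x = circle_orbit q" unfolding cp_space_def by blast
    then show "\<bar>f x\<bar> \<le> M" using M(2)[of q] by simp
  qed
qed

text \<open>The hypothesis concerns the derivative at t = 0, so t is cut into N steps of length s.
  On one step T s f differs from exp (- \<mu> s) f by at most \<eta> s. As T contracts and exp (-
  \<mu> s) \<le> 1, the errors merely add up to \<eta> t, with \<eta> arbitrary.\<close>

lemma heat_semigroup_eigenfunction:
  fixes f :: "'n::finite cp_point \<Rightarrow> real"
  assumes T: "is_heat_semigroup T" and f: "cp_smooth f"
    and eigen: "\<And>x. x \<in> cp_space \<Longrightarrow> sub_laplacian f x = - \<mu> * f x" and \<mu>: "\<mu> \<ge> 0"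
    and t: "t > 0" and x: "x \<in> cp_space"
  shows "T t f x = exp (- \<mu> * t) * f x"
proof -
  note TT = T[unfolded is_heat_semigroup_def]
  have cont: "\<And>t f. t \<ge> 0 \<Longrightarrow> cp_continuous f \<Longrightarrow> cp_continuous (T t f)"
    and lin: "\<And>t f g a b x. t \<ge> 0 \<Longrightarrow> cp_continuous f \<Longrightarrow> cp_continuous g \<Longrightarrow> x \<in> cp_space \<Longrightarrow>
        T t (\<lambda>y. a * f y + b * g y) x = a * T t f x + b * T t g x"
    and contr: "\<And>t f c x. t \<ge> 0 \<Longrightarrow> cp_continuous f \<Longrightarrow> (\<forall>x\<in>cp_space. \<bar>f x\<bar> \<le> c) \<Longrightarrow> x \<in> cp_space \<Longrightarrow> \<bar>T t f x\<bar> \<le> c"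
    and init: "\<And>f x. cp_continuous f \<Longrightarrow> x \<in> cp_space \<Longrightarrow> T 0 f x = f x"
    and semi: "\<And>s t f x. s \<ge> 0 \<Longrightarrow> t \<ge> 0 \<Longrightarrow> cp_continuous f \<Longrightarrow> x \<in> cp_space \<Longrightarrow> T (s + t) f x = T s (T t f) x"
    and gen: "uniform_limit cp_space (\<lambda>t x. (T t f x - f x) / t) (sub_laplacian f) (at_right 0)"
    using TT f by simp_all
  have fc: "cp_continuous f" using f by (rule cp_smooth_imp_continuous)
  obtain M where M: "M \<ge> 0" "\<And>x. x \<in> cp_space \<Longrightarrow> \<bar>f x\<bar> \<le> M" using cp_continuous_bounded[OF fc] by blast
  have "\<bar>T t f x - exp (- \<mu> * t) * f x\<bar> \<le> \<eta> * t" if \<eta>: "\<eta> > 0" for \<eta>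
  proof -
    \<comment> \<open>One share for the difference quotient of T, and M shares for that of the
      exponential, which gets multiplied by f.\<close>
    define \<eta>' where "\<eta>' = \<eta> / (M + 1)"
    have \<eta>': "\<eta>' > 0" using \<eta> M by (simp add: \<eta>'_def)
    have \<eta>'_eq: "\<eta>' * (M + 1) = \<eta>" using M(1) by (simp add: \<eta>'_def)
    have "\<forall>\<^sub>F s in at_right 0. \<forall>x\<in>cp_space. dist ((T s f x - f x) / s) (sub_laplacian f x) < \<eta>'"
      using gen \<eta>' by (rule uniform_limitD)
    moreover have "\<forall>\<^sub>F s in at_right 0. dist ((exp (- \<mu> * s) - 1) / s) (- \<mu>) < \<eta>'"
    proof -
      have "((\<lambda>s. exp (- \<mu> * s)) has_real_derivative - \<mu>) (at 0 within {0<..})"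
        by (auto intro!: derivative_eq_intros)
      then have "((\<lambda>s. (exp (- \<mu> * s) - 1) / s) \<longlongrightarrow> - \<mu>) (at_right 0)"
        by (simp add: has_field_derivative_iff)
      then show ?thesis using \<eta>' by (rule tendstoD)
    qed
    moreover have "\<forall>\<^sub>F s in at_right (0::real). s > 0" by (simp add: eventually_at_right_less)
    ultimately have "\<forall>\<^sub>F s in at_right 0. s > 0 \<and> (\<forall>x\<in>cp_space. \<bar>T s f x - exp (- \<mu> * s) * f x\<bar> \<le> \<eta> * s)"
    proof eventually_elim
      case (elim s)
      have "\<bar>T s f x - exp (- \<mu> * s) * f x\<bar> \<le> \<eta> * s" if x: "x \<in> cp_space" for x
      proof -
        have 1: "\<bar>(T s f x - f x) / s + \<mu> * f x\<bar> \<le> \<eta>'"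
          using elim(1) x eigen[OF x] by (force simp: dist_real_def)
        have "\<bar>(exp (- \<mu> * s) - 1) / s + \<mu>\<bar> * \<bar>f x\<bar> \<le> \<eta>' * M"
          using elim(2) M(2)[OF x] \<eta>' by (intro mult_mono) (auto simp: dist_real_def)
        then have 2: "\<bar>((exp (- \<mu> * s) - 1) / s + \<mu>) * f x\<bar> \<le> \<eta>' * M" by (simp add: abs_mult)
        have "T s f x - exp (- \<mu> * s) * f x =
            s * (((T s f x - f x) / s + \<mu> * f x) - ((exp (- \<mu> * s) - 1) / s + \<mu>) * f x)"
          using elim(3) by (simp add: field_simps)
        also have "\<bar>\<dots>\<bar> \<le> s * (\<eta>' + \<eta>' * M)"
          using elim(3) order_trans[OF abs_triangle_ineq4 add_mono[OF 1 2]]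
          unfolding abs_mult[of s] by (intro mult_mono) simp_all
        also have "\<eta>' + \<eta>' * M = \<eta>" using \<eta>'_eq by (simp add: algebra_simps)
        finally show ?thesis by (simp add: mult.commute)
      qed
      with elim(3) show ?case by blast
    qed
    then obtain s0 where s0: "s0 > 0"
      "\<And>s. 0 < s \<Longrightarrow> s < s0 \<Longrightarrow> \<forall>x\<in>cp_space. \<bar>T s f x - exp (- \<mu> * s) * f x\<bar> \<le> \<eta> * s"
      unfolding eventually_at_right_field by (metis)
    obtain N :: nat where N: "t / s0 < real N" using reals_Archimedean2 by blast
    have "0 < t / s0" using t s0(1) by simp
    with N have Np: "real N > 0" by linarith
    define s where "s = t / real N"
    have s: "0 < s" "s < s0" using t Np N s0(1) by (auto simp: s_def field_simps)
    define e where "e = exp (- \<mu> * s)"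
    have "\<bar>T (real k * s) f x - e ^ k * f x\<bar> \<le> real k * (\<eta> * s)" if "x \<in> cp_space" for k x
      using that
    proof (induction k)
      case 0
      then show ?case using init[OF fc] by simp
    next
      case (Suc k)
      have ks: "real k * s \<ge> 0" using s by simp
      have Tsc: "cp_continuous (T s f)" using cont[OF _ fc] s by simp
      have dc: "cp_continuous (\<lambda>y. 1 * T s f y + (- e) * f y)"
        using Tsc fc unfolding cp_continuous_def by (intro continuous_intros)
      have "T (real (Suc k) * s) f x = T (real k * s) (T s f) x"
        using semi[OF ks _ fc Suc.prems, of s] s by (simp add: algebra_simps)
      \<comment> \<open>The error of one step carried on by T, plus the earlier error damped by
        e.\<close>
      then have "T (real (Suc k) * s) f x - e ^ Suc k * f x =
          T (real k * s) (\<lambda>y. 1 * T s f y + (- e) * f y) x + e * (T (real k * s) f x - e ^ k * f x)"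
        unfolding lin[OF ks Tsc fc Suc.prems] by (simp add: algebra_simps)
      also have "\<bar>\<dots>\<bar> \<le> \<bar>T (real k * s) (\<lambda>y. 1 * T s f y + (- e) * f y) x\<bar> + \<bar>e * (T (real k * s) f x - e ^ k * f x)\<bar>"
        by (rule abs_triangle_ineq)
      also have "\<bar>T (real k * s) (\<lambda>y. 1 * T s f y + (- e) * f y) x\<bar> \<le> \<eta> * s"
        using s0(2)[OF s] by (intro contr[OF ks dc _ Suc.prems]) (simp add: e_def)
      also have "\<bar>e * (T (real k * s) f x - e ^ k * f x)\<bar> \<le> 1 * (real k * (\<eta> * s))"
        unfolding abs_mult using Suc \<mu> s by (intro mult_mono) (auto simp: e_def)
      finally show ?case by (simp add: algebra_simps)
    qed
    from this[OF x, of N] show ?thesis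
      using Np by (simp add: s_def e_def exp_of_nat_mult[symmetric])
  qed
  then have "\<bar>T t f x - exp (- \<mu> * t) * f x\<bar> \<le> 0 + \<eta>" if "\<eta> > 0" for \<eta>
    using that t divide_pos_pos[OF that t] by (metis add_0 less_irrefl nonzero_eq_divide_eq)
  then have "\<bar>T t f x - exp (- \<mu> * t) * f x\<bar> \<le> 0" by (rule field_le_epsilon)
  then show ?thesis by simp
qed

lemma integral_scale_measure:
  fixes f :: "'a \<Rightarrow> real"
  assumes "f \<in> borel_measurable M" "c \<ge> 0"
  shows "(\<integral>x. f x \<partial>scale_measure (ennreal c) M) = c * (\<integral>x. f x \<partial>M)"
  unfolding scale_measure_eq_density using assms by (subst integral_density) auto

text \<open>The factor 2 is 4 pi times 1 / (2 pi). Measurability on the quotient holds because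
  preimages of open sets under a continuous F are among the generators of its
  \<sigma>-algebra.\<close>

lemma integral_cp_measure:
  fixes F :: "'n::finite cp_point \<Rightarrow> real"
  assumes F: "cp_continuous F"
  shows "(\<integral>x. F x \<partial>cp_measure) = 2 * (\<integral>q. F (circle_orbit q) \<partial>sphere_measure)"
proof -
  define \<U> :: "'n cp_point set set" where
    "\<U> = {U. U \<subseteq> cp_space \<and> openin (top_of_set (sphere 0 1)) {q \<in> sphere 0 1. circle_orbit q \<in> U}}"
  have U: "\<U> \<subseteq> Pow cp_space" by (auto simp: \<U>_def)
  have orb: "circle_orbit \<in> sphere_measure \<rightarrow>\<^sub>M sigma cp_space \<U>"
  proof (rule measurable_measure_of[OF U])
    show "circle_orbit \<in> space sphere_measure \<rightarrow> (cp_space :: 'n cp_point set)" by (auto simp: cp_space_def)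
    fix V assume "V \<in> \<U>"
    then have "openin (top_of_set (sphere 0 1)) {q \<in> sphere 0 1. circle_orbit q \<in> V}" by (simp add: \<U>_def)
    then obtain W where "open W" "{q \<in> sphere 0 1. circle_orbit q \<in> V} = sphere 0 1 \<inter> W"
      unfolding openin_open by blast
    moreover have "circle_orbit -` V \<inter> space sphere_measure = {q \<in> sphere 0 1. circle_orbit q \<in> V}" by auto
    ultimately show "circle_orbit -` V \<inter> space sphere_measure \<in> sets sphere_measure"
      by (auto simp: sets_sphere_measure sets_restrict_space)
  qed
  have Fm: "F \<in> borel_measurable (sigma cp_space \<U>)"
  proof (rule borel_measurableI)
    fix S :: "real set" assume S: "open S"
    have "openin (top_of_set (sphere 0 1)) (sphere 0 1 \<inter> (\<lambda>q. F (circle_orbit q)) -` S)"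
      using F S unfolding cp_continuous_def by (rule continuous_openin_preimage_gen)
    moreover have "{q \<in> sphere 0 1. circle_orbit q \<in> F -` S \<inter> cp_space} = sphere 0 1 \<inter> (\<lambda>q. F (circle_orbit q)) -` S"
      by (auto simp: cp_space_def)
    ultimately have "F -` S \<inter> cp_space \<in> \<U>" by (simp add: \<U>_def)
    then show "F -` S \<inter> space (sigma cp_space \<U>) \<in> sets (sigma cp_space \<U>)"
      using U by (simp add: sets_measure_of space_measure_of sigma_sets.Basic)
  qed
  have "(\<integral>x. F x \<partial>cp_measure) = 4 * pi * (1 / (2 * pi) * (\<integral>x. F x \<partial>distr sphere_measure (sigma cp_space \<U>) circle_orbit))"
    unfolding cp_measure_def cp_riemannian_measure_def \<U>_def[symmetric] using Fm
    by (subst integral_scale_measure, simp, simp, subst integral_scale_measure) simp_all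
  also have "(\<integral>x. F x \<partial>distr sphere_measure (sigma cp_space \<U>) circle_orbit) = (\<integral>q. F (circle_orbit q) \<partial>sphere_measure)"
    by (rule integral_distr[OF orb Fm])
  finally show ?thesis by simp
qed

subsection \<open>The heat kernel as a series\<close>

lemma chebH_scale: "chebH j (\<rho> * x) (\<rho>^2) = \<rho> ^ j * gegenbauer 1 j x"
proof (induction j rule: induct_nat_012)
  case (ge2 j)
  have G: "gegenbauer 1 (Suc (Suc j)) x = 2 * x * gegenbauer 1 (Suc j) x - gegenbauer 1 j x" by (simp add: field_simps)
  show ?case unfolding chebH_Suc_Suc ge2 G
    by (simp only: power_Suc power2_eq_square algebra_simps)
qed simp_all

text \<open>The worst case is j = m, where the quadratic terms cancel and equality holds.\<close>

lemma eigval_ge: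
  assumes "j \<le> m"
  shows "eigval n m j \<ge> 4 * real n * real m"
proof -
  have "real j * (real j + 2) \<le> real m * (real m + 2)" using assms by (intro mult_mono) auto
  then show ?thesis by (simp add: eigval_def algebra_simps)
qed

definition heat_term :: "nat \<Rightarrow> real \<Rightarrow> nat \<Rightarrow> real \<Rightarrow> real \<Rightarrow> real" where
  "heat_term n t m S Y = (\<Sum>j\<le>m. exp (- eigval n m j * t) * zonal n m j S Y)"

text \<open>\<open>heat_term\<close> before the average over the circle; that average is the
  integral over \<theta> in the theorem.\<close>

definition heat_zonal :: "nat \<Rightarrow> real \<Rightarrow> nat \<Rightarrow> real \<Rightarrow> real \<Rightarrow> real" where
  "heat_zonal n t m x Y =
     (\<Sum>j\<le>m. exp (- eigval n m j * t) * rad_coeff (2 * real n + 1) m j Y * chebH j x Y)"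

text \<open>The power 4 n + 4 collects 2 (2 n + 1) from the bound on C_m, one from the bound on U_j
  and one from the number of indices j \<le> m.\<close>

definition heat_dom :: "nat \<Rightarrow> real \<Rightarrow> nat \<Rightarrow> real" where
  "heat_dom n t m =
     (real m + (2 * real n + 1)) * (2 * (real m + 1) ^ (4 * n + 4)) * exp (- (4 * real n * t) * real m)"

lemma summable_heat_dom:
  assumes "n > 0" "t > 0"
  shows "summable (heat_dom n t)"
proof (rule summable_comparison_test')
  let ?l = "2 * real n + 1"
  show "summable (\<lambda>m. 2 * ?l * ((real m + 1) ^ Suc (4 * n + 4) * exp (- (4 * real n * t) * real m)))"
    using assms by (intro summable_mult summable_poly_exp) auto
  fix m :: nat
  have "real m * 1 \<le> real m * ?l" by (intro mult_left_mono) auto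
  then have "real m + ?l \<le> ?l * (real m + 1)" by (simp add: algebra_simps)
  then have "heat_dom n t m \<le> ?l * (real m + 1) * (2 * (real m + 1) ^ (4 * n + 4)) * exp (- (4 * real n * t) * real m)"
    unfolding heat_dom_def by (intro mult_right_mono) auto
  also have "\<dots> = 2 * ?l * ((real m + 1) ^ Suc (4 * n + 4) * exp (- (4 * real n * t) * real m))"
    by (simp only: power_Suc mult_ac)
  finally have "heat_dom n t m \<le> 2 * ?l * ((real m + 1) ^ Suc (4 * n + 4) * exp (- (4 * real n * t) * real m))" .
  moreover have "heat_dom n t m \<ge> 0" by (simp add: heat_dom_def)
  ultimately show "norm (heat_dom n t m) \<le> 2 * ?l * ((real m + 1) ^ Suc (4 * n + 4) * exp (- (4 * real n * t) * real m))"
    by (simp only: real_norm_def abs_of_nonneg)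
qed

text \<open>By \<open>chebH_scale\<close> a factor \<rho>^j splits off from \<open>chebH j\<close>
  and completes \<open>rad_coeff\<close> to the quantity estimated in
  \<open>rad_coeff_bound\<close>.\<close>

lemma heat_zonal_bound:
  assumes x: "\<bar>x\<bar> \<le> 1" and \<rho>: "\<bar>\<rho>\<bar> \<le> 1" and t: "t \<ge> 0"
  shows "(real m + (2 * real n + 1)) * \<bar>heat_zonal n t m (\<rho> * x) (\<rho>^2)\<bar> \<le> heat_dom n t m"
proof -
  define l where "l = 2 * real n + 1"
  have "\<bar>exp (- eigval n m j * t) * rad_coeff l m j (\<rho>^2) * chebH j (\<rho> * x) (\<rho>^2)\<bar> \<le>
      exp (- (4 * real n * t) * real m) * (2 * (real m + 1) ^ (4 * n + 2)) * (real m + 1)" if j: "j \<le> m" for j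
  proof -
    have "4 * real n * real m * t \<le> eigval n m j * t" using eigval_ge[OF j, of n] t by (intro mult_right_mono)
    then have 1: "exp (- eigval n m j * t) \<le> exp (- (4 * real n * t) * real m)" by (simp add: mult_ac)
    have l: "l = real (2 * n + 1)" by (simp add: l_def)
    have 2: "\<bar>rad_coeff l m j (\<rho>^2) * \<rho> ^ j\<bar> \<le> 2 * (real m + 1) ^ (4 * n + 2)"
      using rad_coeff_bound[OF gegenbauer_bound \<rho> j, of "2 * n + 1"] unfolding l by simp
    have 3: "\<bar>gegenbauer 1 j x\<bar> \<le> real m + 1" using gegenbauer_1_bound[OF x, of j] j by linarith
    have "\<bar>exp (- eigval n m j * t) * rad_coeff l m j (\<rho>^2) * chebH j (\<rho> * x) (\<rho>^2)\<bar> =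
        exp (- eigval n m j * t) * \<bar>rad_coeff l m j (\<rho>^2) * \<rho> ^ j\<bar> * \<bar>gegenbauer 1 j x\<bar>"
      unfolding chebH_scale by (simp add: abs_mult mult_ac)
    then show ?thesis using 1 2 3 by (simp only:) (intro mult_mono, auto)
  qed
  then have "\<bar>heat_zonal n t m (\<rho> * x) (\<rho>^2)\<bar> \<le>
      (\<Sum>j\<le>m. exp (- (4 * real n * t) * real m) * (2 * (real m + 1) ^ (4 * n + 2)) * (real m + 1))"
    unfolding heat_zonal_def l_def[symmetric] by (intro order_trans[OF sum_abs sum_mono]) auto
  also have "\<dots> = 2 * (real m + 1) ^ (4 * n + 4) * exp (- (4 * real n * t) * real m)"
  proof -
    have e: "4 * n + 4 = Suc (Suc (4 * n + 2))" by simp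
    show ?thesis unfolding e by (simp only: sum_constant card_atMost power_Suc of_nat_Suc add.commute[of 1] mult_ac)
  qed
  finally show ?thesis unfolding heat_dom_def mult.assoc by (intro mult_left_mono) auto
qed

lemma heat_term_average:
  "((\<lambda>\<theta>. heat_zonal n t m (\<rho> * (c * cos \<theta>)) (\<rho>^2)) has_integral pi * heat_term n t m ((\<rho> * c)^2) (\<rho>^2)) {0..pi}"
proof -
  have "((\<lambda>\<theta>. heat_zonal n t m (\<rho> * (c * cos \<theta>)) (\<rho>^2)) has_integral
      (\<Sum>j\<le>m. exp (- eigval n m j * t) * rad_coeff (2 * real n + 1) m j (\<rho>^2) * (pi * chebAvg j ((\<rho> * c)^2) (\<rho>^2)))) {0..pi}"
    unfolding heat_zonal_def mult.assoc[of \<rho> c, symmetric]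
    by (intro has_integral_mult_right has_integral_sum finite_atMost circle_average_chebH)
  then show ?thesis by (simp add: heat_term_def zonal_def sum_distrib_left mult_ac)
qed

lemma heat_term_bound:
  assumes c: "\<bar>c\<bar> \<le> 1" and \<rho>: "\<bar>\<rho>\<bar> \<le> 1" and t: "t \<ge> 0"
  shows "\<bar>(real m + (2 * real n + 1)) * heat_term n t m ((\<rho> * c)^2) (\<rho>^2)\<bar> \<le> heat_dom n t m"
proof -
  let ?l = "real m + (2 * real n + 1)"
  have "norm (?l * (pi * heat_term n t m ((\<rho> * c)^2) (\<rho>^2))) \<le> heat_dom n t m * measure lborel (cbox 0 pi)"
  proof (rule has_integral_bound)
    show "((\<lambda>\<theta>. ?l * heat_zonal n t m (\<rho> * (c * cos \<theta>)) (\<rho>^2)) has_integral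
        ?l * (pi * heat_term n t m ((\<rho> * c)^2) (\<rho>^2))) (cbox 0 pi)"
      unfolding cbox_interval by (intro has_integral_mult_right heat_term_average)
    fix \<theta> :: real
    have "\<bar>c * cos \<theta>\<bar> \<le> 1" using c by (simp add: abs_mult mult_le_one)
    from heat_zonal_bound[OF this \<rho> t]
    show "norm (?l * heat_zonal n t m (\<rho> * (c * cos \<theta>)) (\<rho>^2)) \<le> heat_dom n t m"
      by (simp add: abs_mult)
  qed (simp add: heat_dom_def)
  then show ?thesis by (simp add: abs_mult mult_ac)
qed

text \<open>For each \<theta> the integral is unchanged when q is rotated, and the binomial formula
  expresses this as a finite sum of moments \<open>J r\<close> with coefficients depending on
  \<theta>. Averaging over \<theta> then acts on scalar coefficients only, while the sphere integral
  stays inside \<open>J r\<close>.\<close>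

lemma sphere_circle_average_power:
  fixes p :: "'n::finite qspace"
  assumes g: "continuous_on (sphere 0 1) g" and inv: "\<And>\<theta> q. q \<in> sphere 0 1 \<Longrightarrow> g (left_act (cis \<theta>, 0) q) = g q"
  shows "(\<integral>q. g q * (q \<bullet> p) ^ i \<partial>sphere_measure) = avg_coeff i * (\<integral>q. g q * zS p q ^ (i div 2) \<partial>sphere_measure)"
proof -
  let ?G = "\<lambda>r q. g q * ((q \<bullet> p) ^ r * (q \<bullet> qI p) ^ (i - r))"
  define J where "J r = (\<integral>q. ?G r q \<partial>sphere_measure)" for r
  define I where "I = (\<integral>q. g q * (q \<bullet> p) ^ i \<partial>sphere_measure)"
  define a where "a r \<theta> = real (i choose r) * (cos \<theta> ^ r * (- sin \<theta>) ^ (i - r))" for r and \<theta> :: real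
  let ?A = "\<lambda>r. integral {0..2 * pi} (a r)"
  have a_int: "(a r has_integral ?A r) {0..2 * pi}" for r
    unfolding a_def by (intro integrable_integral integrable_continuous_real continuous_intros)
  have binom: "(\<Sum>r\<le>i. a r \<theta> * (x ^ r * y ^ (i - r))) = (x * cos \<theta> + (- y) * sin \<theta>) ^ i" for \<theta> x y
    unfolding binomial_ring a_def
    by (intro sum.cong refl) (simp add: power_mult_distrib[symmetric] mult_ac)
  have cont: "continuous_on (sphere 0 1) (\<lambda>q. g q * ((q \<bullet> p) ^ r * (q \<bullet> qI p) ^ s))" for r s
    by (intro continuous_intros g)
  have I_eq: "I = (\<Sum>r\<le>i. a r \<theta> * J r)" for \<theta>
  proof -
    have "I = (\<integral>q. g (left_act (cis \<theta>, 0) q) * (left_act (cis \<theta>, 0) q \<bullet> p) ^ i \<partial>sphere_measure)"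
      unfolding I_def
      by (rule integral_sphere_orthogonal_transformation[OF orthogonal_transformation_circle_action, symmetric])
        (intro continuous_intros g)
    also have "\<dots> = (\<integral>q. (\<Sum>r\<le>i. a r \<theta> * ?G r q) \<partial>sphere_measure)"
    proof (rule Bochner_Integration.integral_cong[OF refl])
      fix q :: "'n qspace" assume "q \<in> space sphere_measure"
      then have "g (left_act (cis \<theta>, 0) q) = g q" using inv by simp
      moreover have "left_act (cis \<theta>, 0) q \<bullet> p = (q \<bullet> p) * cos \<theta> + (- (q \<bullet> qI p)) * sin \<theta>"
        unfolding circle_action_inner(1)[of \<theta> q p] by simp
      ultimately show "g (left_act (cis \<theta>, 0) q) * (left_act (cis \<theta>, 0) q \<bullet> p) ^ i =
          (\<Sum>r\<le>i. a r \<theta> * ?G r q)"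
        by (simp only: binom[symmetric]) (simp only: sum_distrib_left mult_ac)
    qed
    also have "\<dots> = (\<Sum>r\<le>i. a r \<theta> * J r)"
      unfolding J_def by (subst Bochner_Integration.integral_sum) (auto intro!: integrable_sphere cont)
    finally show ?thesis .
  qed
  have "((\<lambda>\<theta>. \<Sum>r\<le>i. a r \<theta> * J r) has_integral (\<Sum>r\<le>i. ?A r * J r)) {0..2 * pi}"
    by (intro has_integral_sum has_integral_mult_left a_int finite_atMost)
  then have "((\<lambda>\<theta>. I) has_integral (\<Sum>r\<le>i. ?A r * J r)) {0..2 * pi}"
    by (simp only: I_eq[symmetric])
  moreover have "((\<lambda>\<theta>. I) has_integral 2 * pi * I) {0..2 * pi}"
    by (rule has_integral_eq_rhs[OF has_integral_const_real]) simp
  ultimately have "2 * pi * I = (\<Sum>r\<le>i. ?A r * J r)" by (rule has_integral_unique[symmetric])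
  also have "\<dots> = (\<integral>q. (\<Sum>r\<le>i. ?A r * ?G r q) \<partial>sphere_measure)"
    unfolding J_def by (subst Bochner_Integration.integral_sum) (auto intro!: integrable_sphere cont)
  also have "\<dots> = (\<integral>q. (2 * pi * avg_coeff i) * (g q * zS p q ^ (i div 2)) \<partial>sphere_measure)"
  proof (rule Bochner_Integration.integral_cong[OF refl])
    fix q :: "'n qspace"
    \<comment> \<open>The same averaged coefficients, now for a fixed q, recombine to the circle
      average of a power.\<close>
    define x y where "x = q \<bullet> p" and "y = q \<bullet> qI p"
    have "((\<lambda>\<theta>. \<Sum>r\<le>i. a r \<theta> * (x ^ r * y ^ (i - r))) has_integral
        (\<Sum>r\<le>i. ?A r * (x ^ r * y ^ (i - r)))) {0..2 * pi}"
      by (intro has_integral_sum has_integral_mult_left a_int finite_atMost)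
    moreover have "((\<lambda>\<theta>. (x * cos \<theta> + (- y) * sin \<theta>) ^ i) has_integral 2 * pi * avg_coeff i * (x^2 + (- y)^2) ^ (i div 2)) {0..2 * pi}"
      by (rule circle_average_power) auto
    ultimately have "(\<Sum>r\<le>i. ?A r * (x ^ r * y ^ (i - r))) =
        2 * pi * avg_coeff i * (x^2 + y^2) ^ (i div 2)"
      unfolding binom by (simp add: has_integral_unique)
    then have "g q * (\<Sum>r\<le>i. ?A r * (x ^ r * y ^ (i - r))) =
        g q * (2 * pi * avg_coeff i * zS p q ^ (i div 2))" by (simp only: zS_def x_def y_def)
    then show "(\<Sum>r\<le>i. ?A r * ?G r q) =
        (2 * pi * avg_coeff i) * (g q * zS p q ^ (i div 2))"
      by (simp only: sum_distrib_left x_def y_def mult_ac)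
  qed
  also have "\<dots> = 2 * pi * avg_coeff i * (\<integral>q. g q * zS p q ^ (i div 2) \<partial>sphere_measure)" by simp
  finally show ?thesis by (simp add: I_def)
qed

lemma zS_zY_continuous [continuous_intros]:
  "continuous_on A (zS p)" "continuous_on A (zY p)"
  unfolding zS_def[abs_def] zY_def[abs_def] by (intro continuous_intros)+

text \<open>|w|^2 is invariant under the circle, so its powers can be counted as part of g and each
  power of \<open>q \<bullet> p\<close> is averaged separately.\<close>

lemma sphere_gegenbauer_decomposition:
  fixes p :: "'n::finite qspace" and n :: nat
  assumes g: "continuous_on (sphere 0 1) g" and inv: "\<And>\<theta> q. q \<in> sphere 0 1 \<Longrightarrow> g (left_act (cis \<theta>, 0) q) = g q"
  defines "l \<equiv> 2 * real n + 1"
  shows "(\<integral>q. g q * gegenbauer l m (q \<bullet> p) \<partial>sphere_measure) =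
    (\<Sum>j\<le>m. (\<integral>q. g q * zonal n m j (zS p q) (zY p q) \<partial>sphere_measure))"
proof -
  define G where "G j i q = g q * rad_coeff l m j (zY p q) * zY p q ^ ((j - i) div 2)" for j i q
  have G_cont: "continuous_on (sphere 0 1) (G j i)" for j i
    unfolding G_def rad_coeff_def by (intro continuous_intros g)
  have G_inv: "G j i (left_act (cis \<theta>, 0) q) = G j i q" if "q \<in> sphere 0 1" for j i \<theta> q
    unfolding G_def z_circle_invariant inv[OF that] ..
  have "(\<integral>q. g q * gegenbauer l m (q \<bullet> p) \<partial>sphere_measure) =
      (\<integral>q. (\<Sum>j\<le>m. \<Sum>i\<le>j. geg_coeff 1 j i * (G j i q * (q \<bullet> p) ^ i)) \<partial>sphere_measure)"
  proof (rule Bochner_Integration.integral_cong[OF refl])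
    fix q
    show "g q * gegenbauer l m (q \<bullet> p) = (\<Sum>j\<le>m. \<Sum>i\<le>j. geg_coeff 1 j i * (G j i q * (q \<bullet> p) ^ i))"
      unfolding gegenbauer_decomposition[of l m "q \<bullet> p" "zY p q"] hgegenbauer_expansion G_def sum_distrib_left
      by (simp only: mult_ac)
  qed
  also have "\<dots> = (\<Sum>j\<le>m. \<Sum>i\<le>j. geg_coeff 1 j i * (\<integral>q. G j i q * (q \<bullet> p) ^ i \<partial>sphere_measure))"
    by (subst Bochner_Integration.integral_sum; (subst Bochner_Integration.integral_sum)?)
      (auto intro!: integrable_sphere continuous_intros G_cont)
  also have "\<dots> = (\<Sum>j\<le>m. \<Sum>i\<le>j. (\<integral>q. geg_coeff 1 j i * avg_coeff i * (G j i q * zS p q ^ (i div 2)) \<partial>sphere_measure))"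
  proof -
    have "(\<integral>q. G j i q * (q \<bullet> p) ^ i \<partial>sphere_measure) = avg_coeff i * (\<integral>q. G j i q * zS p q ^ (i div 2) \<partial>sphere_measure)"
      for i j by (rule sphere_circle_average_power[OF G_cont G_inv])
    then show ?thesis by (simp add: mult.assoc)
  qed
  also have "\<dots> = (\<Sum>j\<le>m. (\<integral>q. (\<Sum>i\<le>j. geg_coeff 1 j i * avg_coeff i * (G j i q * zS p q ^ (i div 2))) \<partial>sphere_measure))"
    by (subst Bochner_Integration.integral_sum) (auto intro!: integrable_sphere continuous_intros G_cont)
  also have "\<dots> = (\<Sum>j\<le>m. (\<integral>q. g q * zonal n m j (zS p q) (zY p q) \<partial>sphere_measure))"
    unfolding zonal_def chebAvg_def G_def l_def sum_distrib_left by (simp only: mult_ac)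
  finally show ?thesis .
qed


lemma cp_zonal:
  fixes p :: "'n::finite qspace" and m j :: nat
  assumes p: "norm p = 1"
  defines "f \<equiv> cp_fun (\<lambda>x. zonal CARD('n) m j (zS p x) (zY p x))"
  shows "f (circle_orbit q) = zonal CARD('n) m j (zS p q) (zY p q)"
    and "cp_smooth f"
    and "x \<in> cp_space \<Longrightarrow> sub_laplacian f x = - eigval CARD('n) m j * f x"
proof -
  define Z where "Z x = zonal CARD('n) m j (zS p x) (zY p x)" for x
  have orb: "f (circle_orbit q) = Z q" for q
    unfolding f_def Z_def by (rule cp_fun_circle_orbit) (simp only: z_circle_invariant)
  then show "f (circle_orbit q) = zonal CARD('n) m j (zS p q) (zY p q)" by (simp add: Z_def)
  show "cp_smooth f"
    unfolding cp_smooth_def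
  proof (intro exI conjI allI ballI)
    show "Ck_on k UNIV Z" for k
      unfolding Z_def by (rule real_polynomial_function_Ck_on[OF real_polynomial_function_zonal])
  qed (use orb in auto)
  assume "x \<in> cp_space"
  then obtain q where q: "norm q = 1" "x = circle_orbit q" by (auto simp: cp_space_def)
  \<comment> \<open>The representative chosen by \<open>SOME\<close> is a rotation of q, under which
    the zonal function keeps its value.\<close>
  obtain \<theta> where \<theta>: "(SOME q. q \<in> x) = left_act (cis \<theta>, 0) q" unfolding q(2) by (rule cp_representative)
  define q' where "q' = left_act (cis \<theta>, 0) q"
  have q': "norm q' = 1"
    unfolding q'_def orthogonal_transformation_norm[OF orthogonal_transformation_circle_action] by (rule q(1))
  have "sub_laplacian f x = horizontal_laplacian Z q'"
    unfolding sub_laplacian_def \<theta> q'_def[symmetric] orb ..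
  also have "\<dots> = - eigval CARD('n) m j * Z q'" unfolding Z_def by (rule horizontal_laplacian_zonal[OF q' p])
  also have "Z q' = f x" unfolding orb[symmetric] q'_def circle_orbit_action q(2) ..
  finally show "sub_laplacian f x = - eigval CARD('n) m j * f x" .
qed

text \<open>The circle-averaged components with pole p are smooth eigenfunctions on the quotient, so
  T t multiplies each by a scalar; evaluation at the north pole turns this into integrals against h.
  The factor 2 is that of \<open>integral_cp_measure\<close>.\<close>

lemma heat_kernel_gegenbauer:
  fixes h :: "real \<Rightarrow> 'n::finite cp_point \<Rightarrow> real" and p :: "'n qspace"
  assumes h: "is_subelliptic_heat_kernel h" and t: "t > 0" and p: "norm p = 1"
  defines "N \<equiv> (0, (1, 0)) :: 'n qspace"
  shows "2 * (\<integral>q. h t (circle_orbit q) * gegenbauer (2 * real CARD('n) + 1) m (q \<bullet> p) \<partial>sphere_measure) =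
     heat_term CARD('n) t m (zS p N) (zY p N)"
proof -
  obtain T where T: "is_heat_semigroup T" and "is_heat_kernel_from cp_north T h"
    using h unfolding is_subelliptic_heat_kernel_def by blast
  then have hc: "cp_continuous (h t)" and hT: "\<And>f. cp_continuous f \<Longrightarrow> T t f cp_north = (\<integral>x. h t x * f x \<partial>cp_measure)"
    using t unfolding is_heat_kernel_from_def by blast+
  have N: "cp_north = circle_orbit N" by (simp add: cp_north_def N_def)
  have "norm N = 1" by (simp add: N_def norm_prod_def)
  then have N_in: "cp_north \<in> (cp_space :: 'n cp_point set)" unfolding N cp_space_def by auto
  have g: "continuous_on (sphere 0 1) (\<lambda>q. h t (circle_orbit q))" using hc by (simp add: cp_continuous_def)
  have "2 * (\<integral>q. h t (circle_orbit q) * zonal CARD('n) m j (zS p q) (zY p q) \<partial>sphere_measure) =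
      exp (- eigval CARD('n) m j * t) * zonal CARD('n) m j (zS p N) (zY p N)" if j: "j \<le> m" for j
  proof -
    define f where "f = cp_fun (\<lambda>x. zonal CARD('n) m j (zS p x) (zY p x))"
    note f = cp_zonal[OF p, where m = m and j = j, folded f_def]
    have fc: "cp_continuous f" by (rule cp_smooth_imp_continuous[OF f(2)])
    have "0 \<le> 4 * real CARD('n) * real m" by simp
    then have "eigval CARD('n) m j \<ge> 0" using eigval_ge[OF j, of "CARD('n)"] by linarith
    from heat_semigroup_eigenfunction[OF T f(2) f(3) this t N_in]
    have "exp (- eigval CARD('n) m j * t) * f cp_north = (\<integral>x. h t x * f x \<partial>cp_measure)"
      using hT[OF fc] by simp
    also have "\<dots> = 2 * (\<integral>q. h t (circle_orbit q) * f (circle_orbit q) \<partial>sphere_measure)"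
      by (rule integral_cp_measure) (use hc fc in \<open>auto simp: cp_continuous_def intro!: continuous_intros\<close>)
    finally show ?thesis unfolding N f(1) by simp
  qed
  then have "2 * (\<Sum>j\<le>m. (\<integral>q. h t (circle_orbit q) * zonal CARD('n) m j (zS p q) (zY p q) \<partial>sphere_measure)) =
      heat_term CARD('n) t m (zS p N) (zY p N)"
    unfolding heat_term_def sum_distrib_left by (intro sum.cong refl) simp
  then show ?thesis
    by (subst sphere_gegenbauer_decomposition[OF g]) (simp_all add: circle_orbit_action)
qed

lemma z_north:
  fixes p :: "'n::finite qspace"
  shows "zS p (0, (1, 0)) = (norm (fst (snd p)))^2" "zY p (0, (1, 0)) = (norm (snd p))^2"
  by (simp_all add: zS_def zY_def left_act_def qmult_def inner_prod_def inner_complex_def cmod_power2 norm_prod_def)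

text \<open>An Abel summation: the Abel means of the series are Poisson integrals of h_t and tend to
  its value at p, while by the dominating series \<open>heat_dom\<close> they also tend to the
  sum.\<close>

lemma heat_kernel_series:
  fixes h :: "real \<Rightarrow> 'n::finite cp_point \<Rightarrow> real" and p :: "'n qspace"
  assumes h: "is_subelliptic_heat_kernel h" and t: "t > 0" and p: "norm p = 1"
    and coords: "norm (snd p) = \<rho>" "norm (fst (snd p)) = \<rho> * c" and c: "\<bar>c\<bar> \<le> 1" and \<rho>: "\<bar>\<rho>\<bar> \<le> 1"
  defines "L \<equiv> 2 * CARD('n) + 1"
  shows "2 * (real L * (measure (sphere_measure :: 'n qspace measure) (sphere 0 1) * h t (circle_orbit p))) =
    (\<Sum>m. (real m + real L) * heat_term CARD('n) t m ((\<rho> * c)^2) (\<rho>^2))"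
proof -
  define n where "n = CARD('n)"
  have n: "n > 0" by (simp add: n_def)
  define b where "b m = (real m + real L) * heat_term n t m ((\<rho> * c)^2) (\<rho>^2)" for m
  define g where "g q = h t (circle_orbit q)" for q
  define F where "F r = (\<integral>q. g q * poisson_kernel L r (q \<bullet> p) \<partial>sphere_measure)" for r
  have Lr: "real L = 2 * real n + 1" and dim: "2 * L + 2 = DIM('n qspace)" and L0: "L > 0"
    by (simp_all add: L_def n_def)
  have gc: "continuous_on (sphere 0 1) g"
    using h t unfolding g_def is_subelliptic_heat_kernel_def is_heat_kernel_from_def cp_continuous_def by blast
  have b_bound: "\<bar>b m\<bar> \<le> heat_dom n t m" for m
    unfolding b_def Lr using heat_term_bound[OF c \<rho>] t by simp
  have sums: "(\<lambda>m. b m * r ^ m) sums (2 * (real L * F r))" if r: "0 \<le> r" "r < 1" for r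
  proof -
    have "(\<lambda>m. 2 * ((real m + real L) * r ^ m * (\<integral>q. g q * gegenbauer (real L) m (q \<bullet> p) \<partial>sphere_measure))) sums (2 * (real L * F r))"
      unfolding F_def by (intro sums_mult poisson_integral_sums p dim L0 r gc)
    moreover have "2 * ((real m + real L) * r ^ m * (\<integral>q. g q * gegenbauer (real L) m (q \<bullet> p) \<partial>sphere_measure)) = b m * r ^ m" for m
      using heat_kernel_gegenbauer[OF h t p, of m, folded n_def, folded Lr g_def, unfolded z_north coords]
      unfolding b_def by simp
    ultimately show ?thesis by simp
  qed
  have lim_F: "((\<lambda>r. 2 * (real L * F r)) \<longlongrightarrow> 2 * (real L * (measure (sphere_measure :: 'n qspace measure) (sphere 0 1) * g p))) (at_left 1)"
    unfolding F_def by (intro tendsto_mult tendsto_const poisson_kernel_approximate_identity p dim L0 gc)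
  have lim_b: "((\<lambda>r. \<Sum>m. b m * r ^ m) \<longlongrightarrow> (\<Sum>m. b m)) (at_left 1)"
  proof (rule tannerys_theorem[THEN conjunct2, THEN conjunct2])
    show "((\<lambda>r. b m * r ^ m) \<longlongrightarrow> b m) (at_left 1)" for m
      by (rule tendsto_eq_intros refl)+ simp
    show "\<forall>\<^sub>F (m, r) in at_top \<times>\<^sub>F at_left 1. norm (b m * r ^ m) \<le> heat_dom n t m"
    proof -
      have "\<forall>\<^sub>F r in at_left (1::real). r \<in> {0<..<1}" by (rule eventually_at_left_real) simp
      then have "\<forall>\<^sub>F r in at_left (1::real). \<forall>m. norm (b m * r ^ m) \<le> heat_dom n t m"
      proof eventually_elim
        case (elim r)
        have "\<bar>b m\<bar> * \<bar>r ^ m\<bar> \<le> heat_dom n t m * 1" for m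
          using elim b_bound[of m] by (intro mult_mono) (auto simp: power_le_one)
        then show ?case by (simp add: abs_mult)
      qed
      then show ?thesis unfolding eventually_prod_filter
        by (intro exI[of _ "\<lambda>_. True"] exI[of _ "\<lambda>r. \<forall>m. norm (b m * r ^ m) \<le> heat_dom n t m"]) simp
    qed
    show "summable (heat_dom n t)" by (rule summable_heat_dom[OF n t])
  qed simp
  have ev: "\<forall>\<^sub>F r in at_left 1. 2 * (real L * F r) = (\<Sum>m. b m * r ^ m)"
  proof -
    have "\<forall>\<^sub>F r in at_left (1::real). r \<in> {0<..<1}" by (rule eventually_at_left_real) simp
    then show ?thesis by eventually_elim (use sums in \<open>auto simp: sums_iff\<close>)
  qed
  have "2 * (real L * (measure (sphere_measure :: 'n qspace measure) (sphere 0 1) * g p)) = (\<Sum>m. b m)"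
    by (rule tendsto_unique[OF trivial_limit_at_left_real tendsto_cong[OF ev, THEN iffD1, OF lim_F] lim_b])
  then show ?thesis by (simp add: b_def g_def L_def n_def)
qed

subsection \<open>The integral formula\<close>

text \<open>Real and imaginary part of the characteristic function of the standard normal
  distribution.\<close>

lemma std_normal_trig:
  "has_bochner_integral lborel (\<lambda>x. std_normal_density x * cos (u * x)) (exp (- u\<^sup>2 / 2))"
  "has_bochner_integral lborel (\<lambda>x. std_normal_density x * sin (u * x)) 0"
proof -
  interpret prob_space std_normal_distribution by (rule prob_space_normal_density) simp
  have char: "(\<integral>x. exp (\<i> * complex_of_real (u * x)) \<partial>std_normal_distribution) = complex_of_real (exp (- u\<^sup>2 / 2))"
    using char_std_normal_distribution unfolding char_def by (simp add: fun_eq_iff)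
  have int: "integrable std_normal_distribution (\<lambda>x. exp (\<i> * complex_of_real (u * x)))"
    by (rule integrable_const_bound[of _ 1]) auto
  have dens: "has_bochner_integral lborel (\<lambda>x. std_normal_density x * f x) (\<integral>x. f x \<partial>std_normal_distribution)"
    if "integrable std_normal_distribution f" "f \<in> borel_measurable lborel" for f :: "real \<Rightarrow> real"
    using that by (simp add: has_bochner_integral_iff integrable_density integral_density)
  have "(\<integral>x. cos (u * x) \<partial>std_normal_distribution) = exp (- u\<^sup>2 / 2)"
    "integrable std_normal_distribution (\<lambda>x. cos (u * x))"
    using integral_bounded_linear[OF bounded_linear_Re int] integrable_bounded_linear[OF bounded_linear_Re int]
    unfolding char by (simp_all add: Re_exp)
  then show "has_bochner_integral lborel (\<lambda>x. std_normal_density x * cos (u * x)) (exp (- u\<^sup>2 / 2))"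
    using dens[of "\<lambda>x. cos (u * x)"] by simp
  have "(\<integral>x. sin (u * x) \<partial>std_normal_distribution) = 0"
    "integrable std_normal_distribution (\<lambda>x. sin (u * x))"
    using integral_bounded_linear[OF bounded_linear_Im int] integrable_bounded_linear[OF bounded_linear_Im int]
    unfolding char by (simp_all add: Im_exp)
  then show "has_bochner_integral lborel (\<lambda>x. std_normal_density x * sin (u * x)) 0"
    using dens[of "\<lambda>x. sin (u * x)"] by simp
qed

text \<open>Completing the square: under y = 2 t k + sqrt (2 t) z the exponent k y - y^2 / (4 t)
  becomes k^2 t - z^2 / 2.\<close>

lemma gaussian_shift_eq:
  assumes "t > (0::real)"
  shows "exp (k * (2 * t * k + sqrt (2 * t) * z) - (2 * t * k + sqrt (2 * t) * z)^2 / (4 * t)) =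
     exp (k^2 * t) * sqrt (2 * pi) * std_normal_density z"
proof -
  have "(sqrt (2 * t))^2 = 2 * t" using assms by simp
  then have "(2 * t * k + sqrt (2 * t) * z)^2 = 4 * t * (k * (2 * t * k + sqrt (2 * t) * z) - k\<^sup>2 * t + z^2 / 2)"
    by (simp add: power2_sum power_mult_distrib) (simp add: algebra_simps power2_eq_square)
  then have "k * (2 * t * k + sqrt (2 * t) * z) - (2 * t * k + sqrt (2 * t) * z)^2 / (4 * t) = k^2 * t + (- z\<^sup>2 / 2)"
    using assms by simp
  then show ?thesis by (simp only: exp_add std_normal_density_def) simp
qed

lemma gaussian_exp_sin:
  assumes t: "t > (0::real)"
  shows "has_bochner_integral lborel (\<lambda>y. exp (k * y - y\<^sup>2 / (4 * t)) * sin (b * y))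
     (sqrt (4 * pi * t) * exp (k^2 * t) * exp (- b\<^sup>2 * t) * sin (2 * t * k * b))"
proof -
  define u where "u = b * sqrt (2 * t)"
  have u: "exp (- u\<^sup>2 / 2) = exp (- b\<^sup>2 * t)" using t by (simp add: u_def power_mult_distrib)
  have "has_bochner_integral lborel
      (\<lambda>z. exp (k^2 * t) * sqrt (2 * pi) * (sin (2 * t * k * b) * (std_normal_density z * cos (u * z)) +
         cos (2 * t * k * b) * (std_normal_density z * sin (u * z))))
      (exp (k^2 * t) * sqrt (2 * pi) * (sin (2 * t * k * b) * exp (- u\<^sup>2 / 2) + cos (2 * t * k * b) * 0))"
    (is "has_bochner_integral _ ?f ?x")
    by (intro has_bochner_integral_mult_right has_bochner_integral_add std_normal_trig)
  also have "?f = (\<lambda>z. exp (k * (2 * t * k + sqrt (2 * t) * z) - (2 * t * k + sqrt (2 * t) * z)^2 / (4 * t)) *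
         sin (b * (2 * t * k + sqrt (2 * t) * z)))"
  proof
    fix z
    have "b * (2 * t * k + sqrt (2 * t) * z) = 2 * t * k * b + u * z" by (simp add: u_def algebra_simps)
    then have "sin (b * (2 * t * k + sqrt (2 * t) * z)) =
        sin (2 * t * k * b) * cos (u * z) + cos (2 * t * k * b) * sin (u * z)"
      by (simp only: sin_add)
    then show "?f z = exp (k * (2 * t * k + sqrt (2 * t) * z) - (2 * t * k + sqrt (2 * t) * z)^2 / (4 * t)) *
         sin (b * (2 * t * k + sqrt (2 * t) * z))"
      unfolding gaussian_shift_eq[OF t] by (simp add: algebra_simps)
  qed
  also have "?x =
      (sqrt (4 * pi * t) * exp (k^2 * t) * exp (- b\<^sup>2 * t) * sin (2 * t * k * b)) /\<^sub>R \<bar>sqrt (2 * t)\<bar>"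
  proof -
    have "sqrt (4 * pi * t) = sqrt (2 * pi) * sqrt (2 * t)" by (simp add: real_sqrt_mult[symmetric])
    then show ?thesis unfolding u using t by simp
  qed
  finally show ?thesis
    using t by (subst lborel_has_bochner_integral_real_affine_iff[of "sqrt (2 * t)" _ _ "2 * t * k"]) auto
qed

lemma gaussian_exp_integrable:
  assumes t: "t > (0::real)"
  shows "has_bochner_integral lborel (\<lambda>y. exp (k * y - y\<^sup>2 / (4 * t))) (sqrt (4 * pi * t) * exp (k^2 * t))"
proof -
  have "has_bochner_integral lborel (\<lambda>z. exp (k^2 * t) * sqrt (2 * pi) * (std_normal_density z * cos (0 * z)))
      (exp (k^2 * t) * sqrt (2 * pi) * exp (- 0\<^sup>2 / 2))"
    (is "has_bochner_integral _ ?f ?x")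
    by (intro has_bochner_integral_mult_right std_normal_trig)
  also have "?f = (\<lambda>z. exp (k * (2 * t * k + sqrt (2 * t) * z) - (2 * t * k + sqrt (2 * t) * z)^2 / (4 * t)))"
    unfolding gaussian_shift_eq[OF t] by simp
  also have "?x = (sqrt (4 * pi * t) * exp (k^2 * t)) /\<^sub>R \<bar>sqrt (2 * t)\<bar>"
  proof -
    have "sqrt (4 * pi * t) = sqrt (2 * pi) * sqrt (2 * t)" by (simp add: real_sqrt_mult[symmetric])
    then show ?thesis using t by simp
  qed
  finally show ?thesis
    using t by (subst lborel_has_bochner_integral_real_affine_iff[of "sqrt (2 * t)" _ _ "2 * t * k"]) auto
qed

text \<open>The integrand is even in y, so the half line carries half of the integral over the whole
  line, where sinh splits into two Gaussian integrals. At frequency \<delta> / (2 t) these produce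
  exp (- \<delta>^2 / (4 t)), which the \<delta>-part of the weight cancels.\<close>

lemma gaussian_sinh_sin:
  fixes t k \<delta> :: real
  assumes t: "t > 0"
  defines "f \<equiv> (\<lambda>y. sinh (k * y) * sin (y * \<delta> / (2 * t)) * exp (- ((y^2 - \<delta>\<^sup>2) / (4 * t))))"
  shows "has_bochner_integral lborel (\<lambda>y. indicator {0..} y *\<^sub>R f y) (sqrt (pi * t) * exp (k^2 * t) * sin (k * \<delta>))"
proof -
  define b where "b = \<delta> / (2 * t)"
  have b: "2 * t * k * b = k * \<delta>" "b^2 * t = \<delta>^2 / (4 * t)" using t by (simp_all add: b_def field_simps power2_eq_square)
  have "has_bochner_integral lborel
     (\<lambda>y. exp (\<delta>^2 / (4 * t)) / 2 * (exp (k * y - y\<^sup>2 / (4 * t)) * sin (b * y) - exp (- k * y - y\<^sup>2 / (4 * t)) * sin (b * y)))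
     (exp (\<delta>^2 / (4 * t)) / 2 * (sqrt (4 * pi * t) * exp (k^2 * t) * exp (- b\<^sup>2 * t) * sin (2 * t * k * b) -
        sqrt (4 * pi * t) * exp ((- k)^2 * t) * exp (- b\<^sup>2 * t) * sin (2 * t * (- k) * b)))"
    (is "has_bochner_integral _ ?f ?x")
    by (intro has_bochner_integral_mult_right has_bochner_integral_diff gaussian_exp_sin t)
  also have "?f = f"
  proof
    fix y
    have "exp (- ((y^2 - \<delta>\<^sup>2) / (4 * t))) = exp (\<delta>^2 / (4 * t)) * exp (- (y^2 / (4 * t)))"
      by (simp add: exp_add[symmetric] diff_divide_distrib)
    then show "?f y = f y"
      unfolding f_def b_def sinh_def
      by (simp add: exp_diff exp_minus field_simps)
  qed
  also have "?x =
     2 *\<^sub>R (sqrt (pi * t) * exp (k^2 * t) * sin (k * \<delta>))"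
  proof -
    have "sqrt (4 * pi * t) = 2 * sqrt (pi * t)"
      using real_sqrt_mult[of 4 "pi * t"] by (simp add: mult.assoc)
    moreover have "exp (\<delta>^2 / (4 * t)) * exp (- b\<^sup>2 * t) = 1" using b(2) by (simp add: exp_add[symmetric])
    moreover have "sin (2 * t * (- k) * b) = - sin (k * \<delta>)"
      using b(1) by (simp only: mult_minus_right mult_minus_left sin_minus)
    moreover define E1 E2 where "E1 = exp (\<delta>^2 / (4 * t))" and "E2 = exp (- b\<^sup>2 * t)"
    ultimately have *: "sqrt (4 * pi * t) = 2 * sqrt (pi * t)" "E1 * E2 = 1" "sin (2 * t * (- k) * b) = - sin (k * \<delta>)"
      by simp_all
    have "E1 / 2 * (sqrt (4 * pi * t) * exp (k^2 * t) * E2 * sin (2 * t * k * b) -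
        sqrt (4 * pi * t) * exp ((- k)^2 * t) * E2 * sin (2 * t * (- k) * b)) =
        (E1 * E2) * (2 * sqrt (pi * t) * exp (k^2 * t) * sin (k * \<delta>))"
      unfolding *(1,3) b by (simp add: algebra_simps)
    then show ?thesis unfolding * E1_def[symmetric] E2_def[symmetric] by simp
  qed
  finally have full: "has_bochner_integral lborel f (2 *\<^sub>R (sqrt (pi * t) * exp (k^2 * t) * sin (k * \<delta>)))" .
  then have "integrable lborel f" by (rule integrable.intros)
  then have "integrable lborel (\<lambda>y. indicator {0..} y *\<^sub>R f y)" by (intro integrable_mult_indicator) auto
  then have half: "has_bochner_integral lborel (\<lambda>y. indicator {0..} y *\<^sub>R f y) (\<integral>y. indicator {0..} y *\<^sub>R f y \<partial>lborel)"
    by (rule has_bochner_integral_integrable)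
  have "has_bochner_integral lborel f (2 *\<^sub>R (\<integral>y. indicator {0..} y *\<^sub>R f y \<partial>lborel))"
    by (rule has_bochner_integral_even_function[OF half]) (simp add: f_def)
  with full have "2 *\<^sub>R (\<integral>y. indicator {0..} y *\<^sub>R f y \<partial>lborel) = 2 *\<^sub>R (sqrt (pi * t) * exp (k^2 * t) * sin (k * \<delta>))"
    by (metis has_bochner_integral_integral_eq)
  with half show ?thesis by simp
qed


text \<open>By \<open>chebH_cosh\<close> the factor sinh y makes C_m(\<rho> cosh y) a sum of terms
  sinh ((j + 1) y). After integration \<open>chebH_cos\<close> reassembles the sines to
  \<open>chebH j (\<rho> * cos \<delta>) (\<rho>^2) * sin \<delta>\<close>, and sin \<delta>
  cancels.\<close>

lemma heat_inner_integral:
  fixes n :: nat and t \<rho> \<delta> :: real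
  assumes n: "n > 0" and t: "t > 0" and \<rho>: "0 < \<rho>" "\<rho> \<le> 1" and \<delta>: "sin \<delta> \<noteq> 0"
  defines "l \<equiv> 2 * real n + 1"
  shows "(LBINT y:{0..}. sinh y * sin (y * \<delta> / (2 * t)) / sin \<delta> * exp (- ((y^2 - \<delta>\<^sup>2) / (4 * t))) *
       sphere_heat_kernel n t (\<rho> * cosh y)) =
     Gamma (2 * real n + 1) / (2 * pi ^ (2 * n + 2)) * sqrt (pi * t) * exp t *
     (\<Sum>m. (real m + l) * heat_zonal n t m (\<rho> * cos \<delta>) (\<rho>^2))"
proof -
  let ?g = "\<lambda>m y. exp ((real m + 1) * y - y\<^sup>2 / (4 * t))" and ?e = "\<lambda>m. exp ((real m + 1)^2 * t)"
  define c0 where "c0 = Gamma (2 * real n + 1) / (2 * pi ^ (2 * n + 2))"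
  define a where "a m = (real m + l) * exp (- (real m * (real m + 4 * real n + 2) * t))" for m
  define f where "f m j = rad_coeff l m j (\<rho>^2) * \<rho> ^ j" for m j
  define E where "E k y = sinh (k * y) * sin (y * \<delta> / (2 * t)) * exp (- ((y^2 - \<delta>\<^sup>2) / (4 * t)))" for k y
  define F where "F m y = indicator {0..} y *\<^sub>R (a m * (\<Sum>j\<le>m. f m j * E (real (j + 1)) y))" for m and y :: real
  define K where "K = exp (\<delta>^2 / (4 * t))"
  have l: "l = real (2 * n + 1)" by (simp add: l_def)
  \<comment> \<open>The exponent 4 n + 2 is raised by one so that the sum over j \<le> m gives the
    power in \<open>heat_dom\<close>.\<close>
  have f_bound: "\<bar>f m j\<bar> \<le> 2 * (real m + 1) ^ (4 * n + 3)" if "j \<le> m" for m j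
    using rad_coeff_bound[OF gegenbauer_bound _ that, of \<rho> "2 * n + 1"] \<rho>
      power_increasing[of "4 * n + 2" "4 * n + 3" "real m + 1"] unfolding f_def l by simp
  have a_pos: "a m \<ge> 0" for m unfolding a_def l by simp
  define A where "A m = a m * (2 * (real m + 1) ^ (4 * n + 4))" for m
  have E_bound: "\<bar>E (real (j + 1)) y\<bar> \<le> K * ?g m y" if "y \<ge> 0" "j \<le> m" for m j y
  proof -
    have "\<bar>sinh (real (j + 1) * y)\<bar> = sinh (real (j + 1) * y)" using that by (simp add: sinh_real_nonneg_iff)
    also have "\<dots> \<le> exp (real (j + 1) * y)" by (simp add: sinh_def divide_le_eq) (smt (verit) exp_gt_zero)
    also have "\<dots> \<le> exp ((real m + 1) * y)" using that by (simp add: mult_right_mono)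
    finally have "\<bar>E (real (j + 1)) y\<bar> \<le> exp ((real m + 1) * y) * 1 * exp (- ((y^2 - \<delta>\<^sup>2) / (4 * t)))"
      unfolding E_def abs_mult by (intro mult_mono) auto
    also have "\<dots> = K * ?g m y"
      unfolding K_def by (simp add: exp_add[symmetric] diff_divide_distrib)
    finally show ?thesis .
  qed
  have F_bound: "norm (F m y) \<le> A m * (K * ?g m y)" for m y
  proof (cases "y \<ge> 0")
    case True
    have "\<bar>\<Sum>j\<le>m. f m j * E (real (j + 1)) y\<bar> \<le> (\<Sum>j\<le>m. \<bar>f m j * E (real (j + 1)) y\<bar>)" by (rule sum_abs)
    also have "\<dots> \<le> (\<Sum>j\<le>m. (2 * (real m + 1) ^ (4 * n + 3)) * (K * ?g m y))"
      unfolding abs_mult using True by (intro sum_mono mult_mono f_bound E_bound) auto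
    also have "\<dots> = (2 * (real m + 1) ^ (4 * n + 4)) * (K * ?g m y)"
    proof -
      have e: "4 * n + 4 = Suc (4 * n + 3)" by simp
      show ?thesis unfolding e by (simp only: sum_constant card_atMost power_Suc of_nat_Suc add.commute[of 1] mult_ac)
    qed
    finally have "a m * \<bar>\<Sum>j\<le>m. f m j * E (real (j + 1)) y\<bar> \<le>
        a m * ((2 * (real m + 1) ^ (4 * n + 4)) * (K * ?g m y))"
      using a_pos by (rule mult_left_mono)
    then show ?thesis using True a_pos by (simp add: F_def A_def abs_mult mult.assoc)
  next
    case False
    then show ?thesis using a_pos by (simp add: F_def A_def K_def)
  qed
  \<comment> \<open>(m + 1)^2 - m (m + 4 n + 2) = 1 - 4 n m.\<close>
  have "A m * ?e m = exp t * heat_dom n t m" for m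
  proof -
    have "A m * ?e m = (real m + l) * (2 * (real m + 1) ^ (4 * n + 4)) *
        exp (- (real m * (real m + 4 * real n + 2) * t) + (real m + 1)^2 * t)"
      unfolding A_def a_def exp_add by (simp add: mult_ac)
    also have "- (real m * (real m + 4 * real n + 2) * t) + (real m + 1)^2 * t = t + - (4 * real n * t) * real m"
      by (simp add: algebra_simps power2_eq_square)
    finally show ?thesis unfolding heat_dom_def l_def exp_add by (simp only: mult_ac)
  qed
  then have A_sum: "summable (\<lambda>m. A m * ?e m)"
    using summable_heat_dom[OF n t] by (simp add: summable_mult)
  \<comment> \<open>The exponent (m + 1) y - y^2 / (4 t) is at most (m + 1)^2 t, its value at y = 2
    t (m + 1). This gives summability at every y.\<close>
  have F_le: "norm (F m y) \<le> K * (A m * ?e m)" for m y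
  proof -
    have "0 \<le> ((real m + 1) * t - y / 2)^2 / t" using t by simp
    also have "\<dots> = (real m + 1)^2 * t - ((real m + 1) * y - y\<^sup>2 / (4 * t))"
      using t by (simp add: power2_eq_square field_simps)
    finally have "?g m y \<le> ?e m" by simp
    then have "A m * (K * ?g m y) \<le> A m * (K * ?e m)"
      using a_pos by (intro mult_left_mono) (auto simp: A_def K_def)
    then show ?thesis using F_bound[of m y] by (simp add: mult_ac)
  qed
  have F_bi: "has_bochner_integral lborel (F m)
      (a m * (\<Sum>j\<le>m. f m j * (sqrt (pi * t) * exp ((real (j + 1))^2 * t) * sin (real (j + 1) * \<delta>))))" for m
  proof -
    have "has_bochner_integral lborel (\<lambda>y. a m * (\<Sum>j\<le>m. f m j * (indicator {0..} y *\<^sub>R E (real (j + 1)) y)))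
      (a m * (\<Sum>j\<le>m. f m j * (sqrt (pi * t) * exp ((real (j + 1))^2 * t) * sin (real (j + 1) * \<delta>))))"
      unfolding E_def by (intro has_bochner_integral_mult_right has_bochner_integral_sum gaussian_sinh_sin t)
    also have "(\<lambda>y. a m * (\<Sum>j\<le>m. f m j * (indicator {0..} y *\<^sub>R E (real (j + 1)) y))) = F m"
      by (auto simp: F_def fun_eq_iff indicator_def)
    finally show ?thesis .
  qed
  have F_sums: "(\<lambda>m. integral\<^sup>L lborel (F m)) sums (\<integral>y. (\<Sum>m. F m y) \<partial>lborel)"
  proof (rule sums_integral)
    show "integrable lborel (F m)" for m using F_bi by (rule integrable.intros)
    show "AE y in lborel. summable (\<lambda>m. norm (F m y))"
      by (rule AE_I2) (rule summable_comparison_test'[OF summable_mult[OF A_sum]], use F_le in simp)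
    show "summable (\<lambda>m. \<integral>y. norm (F m y) \<partial>lborel)"
    proof (rule summable_comparison_test')
      show "summable (\<lambda>m. K * sqrt (4 * pi * t) * (A m * ?e m))" by (intro summable_mult A_sum)
      fix m :: nat
      have g: "has_bochner_integral lborel (\<lambda>y. A m * (K * ?g m y))
          (A m * (K * (sqrt (4 * pi * t) * ?e m)))"
        by (intro has_bochner_integral_mult_right gaussian_exp_integrable t)
      have "(\<integral>y. norm (F m y) \<partial>lborel) \<le> (\<integral>y. A m * (K * ?g m y) \<partial>lborel)"
        by (intro integral_mono integrable_norm integrable.intros[OF F_bi] integrable.intros[OF g] F_bound)
      also have "\<dots> = K * sqrt (4 * pi * t) * (A m * ?e m)"
        using has_bochner_integral_integral_eq[OF g] by (simp only: mult_ac)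
      finally show "norm (\<integral>y. norm (F m y) \<partial>lborel) \<le> K * sqrt (4 * pi * t) * (A m * ?e m)"
        by simp
    qed
  qed
  have integrand: "indicator {0..} y *\<^sub>R (sinh y * sin (y * \<delta> / (2 * t)) / sin \<delta> * exp (- ((y^2 - \<delta>\<^sup>2) / (4 * t))) *
       sphere_heat_kernel n t (\<rho> * cosh y)) = c0 / sin \<delta> * (\<Sum>m. F m y)" for y
  proof (cases "y > 0")
    case False
    have "F m y = 0" for m using False by (cases "y = 0") (auto simp: F_def E_def)
    then show ?thesis using False by (cases "y = 0") auto
  next
    case True
    define s where "s = sinh y * sin (y * \<delta> / (2 * t)) * exp (- ((y^2 - \<delta>\<^sup>2) / (4 * t)))"
    have F: "F m y = s * (a m * gegenbauer l m (\<rho> * cosh y))" for m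
    proof -
      have "sinh y * gegenbauer l m (\<rho> * cosh y) =
          (\<Sum>j\<le>m. rad_coeff l m j (\<rho>^2) * (chebH j (\<rho> * cosh y) (\<rho>^2) * sinh y))"
        unfolding gegenbauer_decomposition[of l m "\<rho> * cosh y" "\<rho>^2"] sum_distrib_left by (simp only: mult_ac)
      also have "\<dots> = (\<Sum>j\<le>m. f m j * sinh (real (j + 1) * y))"
        unfolding chebH_cosh f_def by (simp only: mult_ac)
      finally have e: "sinh y * gegenbauer l m (\<rho> * cosh y) = (\<Sum>j\<le>m. f m j * sinh (real (j + 1) * y))" .
      have "s * (a m * gegenbauer l m (\<rho> * cosh y)) = a m * ((sinh y * gegenbauer l m (\<rho> * cosh y)) *
          (sin (y * \<delta> / (2 * t)) * exp (- ((y^2 - \<delta>\<^sup>2) / (4 * t)))))"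
        by (simp add: s_def mult_ac)
      also have "\<dots> = a m * (\<Sum>j\<le>m. f m j * E (real (j + 1)) y)"
        unfolding e E_def sum_distrib_right by (simp only: mult_ac)
      finally show ?thesis using True by (simp only: F_def) simp
    qed
    have Fs: "summable (\<lambda>m. F m y)"
      by (rule summable_comparison_test'[OF summable_mult[OF A_sum] F_le])
    show ?thesis
    \<comment> \<open>If s = 0, summability of the \<open>F m y\<close> says nothing about the
      series of q_t, but then both sides vanish; otherwise s can be divided out.\<close>
    proof (cases "s = 0")
      case True
      then have "F m y = 0" for m by (simp add: F)
      moreover have "sinh y * sin (y * \<delta> / (2 * t)) = 0" using True by (simp add: s_def)
      ultimately show ?thesis by simp
    next
      case False
      have "sphere_heat_kernel n t (\<rho> * cosh y) = c0 * (\<Sum>m. a m * gegenbauer l m (\<rho> * cosh y))"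
        unfolding sphere_heat_kernel_def c0_def a_def l_def by (simp add: add.assoc)
      moreover have "(\<Sum>m. F m y) = s * (\<Sum>m. a m * gegenbauer l m (\<rho> * cosh y))"
        unfolding F using Fs[unfolded F] False by (intro suminf_mult) (simp add: summable_cmult_iff)
      ultimately show ?thesis using True by (simp add: s_def)
    qed
  qed
  have term_eq: "integral\<^sup>L lborel (F m) = sqrt (pi * t) * exp t * sin \<delta> * ((real m + l) * heat_zonal n t m (\<rho> * cos \<delta>) (\<rho>^2))" for m
  proof -
    \<comment> \<open>Here (j + 1)^2 = j (j + 2) + 1 yields the factor e^t and the
      eigenvalue.\<close>
    have ex: "exp (- (real m * (real m + 4 * real n + 2) * t)) * exp ((real (j + 1))^2 * t) = exp t * exp (- eigval n m j * t)" for j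
      unfolding exp_add[symmetric] eigval_def by (simp add: algebra_simps power2_eq_square)
    have "integral\<^sup>L lborel (F m) =
        a m * (\<Sum>j\<le>m. f m j * (sqrt (pi * t) * exp ((real (j + 1))^2 * t) * sin (real (j + 1) * \<delta>)))"
      by (rule has_bochner_integral_integral_eq[OF F_bi])
    also have "\<dots> = (\<Sum>j\<le>m. sqrt (pi * t) * (real m + l) *
        (exp (- (real m * (real m + 4 * real n + 2) * t)) * exp ((real (j + 1))^2 * t)) *
        (rad_coeff l m j (\<rho>^2) * (\<rho> ^ j * sin (real (j + 1) * \<delta>))))"
      unfolding sum_distrib_left a_def f_def by (simp only: mult_ac)
    also have "\<dots> = (\<Sum>j\<le>m. sqrt (pi * t) * (real m + l) * (exp t * exp (- eigval n m j * t)) *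
        (rad_coeff l m j (\<rho>^2) * (chebH j (\<rho> * cos \<delta>) (\<rho>^2) * sin \<delta>)))"
      unfolding ex chebH_cos ..
    also have "\<dots> = sqrt (pi * t) * exp t * sin \<delta> * ((real m + l) * heat_zonal n t m (\<rho> * cos \<delta>) (\<rho>^2))"
      unfolding heat_zonal_def sum_distrib_left l_def by (simp only: mult_ac)
    finally show ?thesis .
  qed
  define w where "w m = (real m + l) * heat_zonal n t m (\<rho> * cos \<delta>) (\<rho>^2)" for m
  define \<kappa> where "\<kappa> = sqrt (pi * t) * exp t * sin \<delta>"
  have \<kappa>: "\<kappa> \<noteq> 0" using t \<delta> by (simp add: \<kappa>_def)
  have Fw: "(\<lambda>m. \<kappa> * w m) sums (\<integral>y. (\<Sum>m. F m y) \<partial>lborel)"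
    using F_sums unfolding term_eq w_def[symmetric] \<kappa>_def[symmetric] .
  then have "(\<integral>y. (\<Sum>m. F m y) \<partial>lborel) = \<kappa> * (\<Sum>m. w m)"
    using \<kappa> by (metis sums_iff suminf_mult summable_cmult_iff)
  then have "(\<integral>y. c0 / sin \<delta> * (\<Sum>m. F m y) \<partial>lborel) = c0 * sqrt (pi * t) * exp t * (\<Sum>m. w m)"
    using \<delta> by (simp add: \<kappa>_def)
  then show ?thesis
    unfolding set_lebesgue_integral_def integrand w_def c0_def .
qed

text \<open>\<open>heat_dom\<close> bounds the terms uniformly in \<theta>, so sum and integral over
  the compact interval may be exchanged.\<close>

lemma heat_outer_integral:
  fixes n :: nat and t \<rho> c :: real
  assumes n: "n > 0" and t: "t > 0" and \<rho>: "\<bar>\<rho>\<bar> \<le> 1" and c: "\<bar>c\<bar> \<le> 1"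
  defines "l \<equiv> 2 * real n + 1"
  shows "(LBINT \<theta>:{0..pi}. (\<Sum>m. (real m + l) * heat_zonal n t m (\<rho> * (c * cos \<theta>)) (\<rho>^2))) =
     pi * (\<Sum>m. (real m + l) * heat_term n t m ((\<rho> * c)^2) (\<rho>^2))"
proof -
  let ?H = "\<lambda>m. (real m + l) * heat_term n t m ((\<rho> * c)^2) (\<rho>^2)"
  define w where "w m \<theta> = (real m + l) * heat_zonal n t m (\<rho> * (c * cos \<theta>)) (\<rho>^2)" for m \<theta>
  define F where "F m \<theta> = indicator {0..pi} \<theta> *\<^sub>R w m \<theta>" for m and \<theta> :: real
  note D_sum = summable_heat_dom[OF n t]
  have F_bound: "norm (F m \<theta>) \<le> indicator {0..pi} \<theta> *\<^sub>R heat_dom n t m" for m \<theta>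
  proof -
    have "\<bar>c * cos \<theta>\<bar> \<le> 1" using c by (simp add: abs_mult mult_le_one)
    from heat_zonal_bound[OF this \<rho>, of t m n] t show ?thesis
      by (simp add: F_def w_def l_def abs_mult indicator_def)
  qed
  have F_bound': "norm (F m \<theta>) \<le> heat_dom n t m" for m \<theta>
    using F_bound[of m \<theta>] by (rule order_trans) (simp add: indicator_def heat_dom_def)
  have w_cont: "continuous_on A (w m)" for A m
    unfolding w_def heat_zonal_def hgegenbauer_expansion by (intro continuous_intros)
  have F_int: "integrable lborel (F m)" for m
    using borel_integrable_atLeastAtMost'[OF w_cont, of 0 pi m] by (simp add: F_def[abs_def] set_integrable_def)
  have F_val: "integral\<^sup>L lborel (F m) = pi * ?H m" for m
  proof -
    have "integral\<^sup>L lborel (F m) = (LBINT \<theta>:{0..pi}. w m \<theta>)"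
      by (simp add: F_def[abs_def] set_lebesgue_integral_def)
    also have "\<dots> = integral {0..pi} (w m)"
      by (rule set_borel_integral_eq_integral(2)[OF borel_integrable_atLeastAtMost'[OF w_cont]])
    also have "\<dots> = (real m + l) * (pi * heat_term n t m ((\<rho> * c)^2) (\<rho>^2))"
      unfolding w_def by (intro integral_unique has_integral_mult_right heat_term_average)
    finally show ?thesis by (simp only: mult_ac)
  qed
  have "(\<lambda>m. integral\<^sup>L lborel (F m)) sums (\<integral>\<theta>. (\<Sum>m. F m \<theta>) \<partial>lborel)"
  proof (rule sums_integral)
    show "integrable lborel (F m)" for m by (rule F_int)
    show "AE \<theta> in lborel. summable (\<lambda>m. norm (F m \<theta>))"
      by (rule AE_I2) (rule summable_comparison_test'[OF D_sum], use F_bound' in simp)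
    show "summable (\<lambda>m. \<integral>\<theta>. norm (F m \<theta>) \<partial>lborel)"
    proof (rule summable_comparison_test')
      show "summable (\<lambda>m. pi * heat_dom n t m)" by (intro summable_mult D_sum)
      fix m :: nat
      have "(\<integral>\<theta>. norm (F m \<theta>) \<partial>lborel) \<le> (\<integral>\<theta>. indicator {0..pi} \<theta> *\<^sub>R heat_dom n t m \<partial>lborel)"
        by (intro integral_mono integrable_norm F_int F_bound borel_integrable_compact continuous_intros) auto
      also have "\<dots> = pi * heat_dom n t m" by simp
      finally show "norm (\<integral>\<theta>. norm (F m \<theta>) \<partial>lborel) \<le> pi * heat_dom n t m" by simp
    qed
  qed
  moreover have "(\<Sum>m. F m \<theta>) = indicator {0..pi} \<theta> *\<^sub>R (\<Sum>m. w m \<theta>)" for \<theta>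
    by (simp add: F_def indicator_def)
  ultimately have "(\<lambda>m. pi * ?H m) sums (LBINT \<theta>:{0..pi}. (\<Sum>m. w m \<theta>))"
    unfolding F_val set_lebesgue_integral_def by simp
  moreover have "summable ?H"
    using t by (intro summable_comparison_test'[OF D_sum]) (auto simp: l_def intro!: heat_term_bound c \<rho>)
  ultimately show ?thesis unfolding w_def[symmetric] by (simp add: sums_iff suminf_mult)
qed

text \<open>The volume of S^(4n+3) is 2 pi^(2n+2) / (2n+1)!; its reciprocal divided by 2 n + 1 is
  the constant in front of the series of q_t.\<close>

lemma sphere_measure_constant:
  "1 / (measure (sphere_measure :: 'n::finite qspace measure) (sphere 0 1) * real (2 * CARD('n) + 1)) =
     Gamma (2 * real CARD('n) + 1) / (2 * pi ^ (2 * CARD('n) + 2))"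
proof -
  define n where "n = CARD('n)"
  have dim: "DIM('n qspace) = 2 * (2 * n + 2)" by (simp add: n_def)
  define f where "f = (fact (2 * n) :: real)"
  have G: "Gamma (2 * real n + 1) = f"
    using Gamma_fact[of "2 * n", where 'a = real] by (simp add: f_def add.commute)
  have F: "(fact (2 * n + 2) :: real) = (2 * real n + 2) * ((2 * real n + 1) * f)"
    by (simp add: f_def algebra_simps)
  have R: "real (2 * (2 * n + 2)) = 2 * (2 * real n + 2)" "real (2 * n + 1) = 2 * real n + 1" by simp_all
  have nz: "2 * real n + 2 \<noteq> 0" "2 * real n + 1 \<noteq> 0" "f \<noteq> 0" by (simp_all add: f_def)
  have V: "unit_ball_vol (real (2 * (2 * n + 2))) = pi ^ (2 * n + 2) / ((2 * real n + 2) * ((2 * real n + 1) * f))"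
    unfolding unit_ball_vol_even F ..
  show ?thesis unfolding n_def[symmetric] measure_sphere_measure dim V
    unfolding G R using nz by (simp add: divide_simps)
qed

theorem theorem3p3:
  fixes h :: "real \<Rightarrow> 'n::finite cp_point \<Rightarrow> real"
    and t r \<phi> :: real and x :: "'n cp_point"
  assumes "is_subelliptic_heat_kernel h"
    and "t > 0" and "0 \<le> r" and "r < pi / 2" and "0 \<le> \<phi>" and "\<phi> \<le> pi / 2"
    and "has_coords x r \<phi>"
  shows "h t x =
    exp (- t) / (2 * pi * sqrt (pi * t)) *
    (LBINT \<theta>:{0..pi}. LBINT y:{0..}.
       sinh y * sin (y * arccos (cos \<phi> * cos \<theta>) / (2 * t))
         / sqrt (1 - (cos \<phi>)\<^sup>2 * (cos \<theta>)\<^sup>2)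
         * exp (- ((y\<^sup>2 - (arccos (cos \<phi> * cos \<theta>))\<^sup>2) / (4 * t)))
         * sphere_heat_kernel CARD('n) t (cos r * cosh y))"
proof -
  note t = \<open>t > 0\<close>
  define n where "n = CARD('n)"
  define l where "l = 2 * real n + 1"
  define \<rho> where "\<rho> = cos r"
  define c where "c = cos \<phi>"
  have n: "n > 0" by (simp add: n_def)
  have \<rho>: "0 < \<rho>" "\<rho> \<le> 1" "\<bar>\<rho>\<bar> \<le> 1" using assms(3,4) cos_gt_zero_pi[of r] by (auto simp: \<rho>_def)
  have c: "0 \<le> c" "c \<le> 1" "\<bar>c\<bar> \<le> 1" using assms(5,6) cos_ge_zero[of \<phi>] by (auto simp: c_def)
  obtain q :: "'n qspace" where "q \<in> sphere 0 1" and q: "x = circle_orbit q" "norm (snd q) = \<rho>"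
    "norm (fst (snd q /\<^sub>R norm (snd q))) = c"
    using assms(7) unfolding has_coords_def \<rho>_def c_def by blast
  then have q1: "norm q = 1" by simp
  have q': "norm (fst (snd q)) = \<rho> * c" using q(2,3) \<rho>(1) by (simp add: field_simps)
  define \<Sigma> where "\<Sigma> = (\<Sum>m. (real m + l) * heat_term n t m ((\<rho> * c)^2) (\<rho>^2))"
  define \<omega> where "\<omega> = measure (sphere_measure :: 'n qspace measure) (sphere 0 1)"
  define c0 where "c0 = Gamma (2 * real n + 1) / (2 * pi ^ (2 * n + 2))"
  have lr: "real (2 * n + 1) = l" by (simp add: l_def)
  have c0: "1 / (\<omega> * l) = c0"
    unfolding lr[symmetric] \<omega>_def c0_def n_def by (rule sphere_measure_constant)
  have "Gamma (2 * real n + 1) > 0" by (rule Gamma_real_pos) simp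
  then have "Gamma (2 * real n + 1) \<noteq> 0" by linarith
  then have "c0 \<noteq> 0" by (simp add: c0_def)
  then have \<omega>: "\<omega> \<noteq> 0" "l \<noteq> 0" using c0 by auto
  define w where "w m \<theta> = (real m + l) * heat_zonal n t m (\<rho> * (c * cos \<theta>)) (\<rho>^2)" for m \<theta>
  note outer = heat_outer_integral[OF n t \<rho>(3) c(3), folded l_def, folded w_def, folded \<Sigma>_def]
  \<comment> \<open>The 2 stems from the normalization of \<open>cp_measure\<close>, l from the
    expansion of the Poisson kernel, \<omega> from its total mass.\<close>
  have "2 * (l * (\<omega> * h t x)) = \<Sigma>"
    using heat_kernel_series[OF assms(1) t q1 q(2) q' c(3) \<rho>(3)]
    unfolding q(1) \<omega>_def n_def[symmetric] lr \<Sigma>_def .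
  then have h: "h t x = c0 * \<Sigma> / 2" using \<omega> by (simp add: c0[symmetric] field_simps)
  define G where "G \<theta> = (LBINT y:{0..}. sinh y * sin (y * arccos (c * cos \<theta>) / (2 * t))
         / sqrt (1 - c\<^sup>2 * (cos \<theta>)^2)
         * exp (- ((y^2 - (arccos (c * cos \<theta>))^2) / (4 * t)))
         * sphere_heat_kernel n t (\<rho> * cosh y))" for \<theta>
  \<comment> \<open>For \<phi> = 0 the denominator vanishes at the end points. In the interior |cos
    \<phi> cos \<theta>| < 1, so the arccosine has a nonzero sine.\<close>
  have G: "G \<theta> = c0 * sqrt (pi * t) * exp t * (\<Sum>m. w m \<theta>)" if \<theta>: "0 < \<theta>" "\<theta> < pi" for \<theta>
  proof -
    have "(sin \<theta>)^2 > 0" using sin_gt_zero[OF \<theta>] by simp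
    then have "(cos \<theta>)^2 < 1" using sin_cos_squared_add[of \<theta>] by linarith
    then have "\<bar>cos \<theta>\<bar> < 1" by (simp only: abs_square_less_1)
    moreover have "c * \<bar>cos \<theta>\<bar> \<le> \<bar>cos \<theta>\<bar>" using c by (intro mult_left_le_one_le) auto
    ultimately have "\<bar>c * cos \<theta>\<bar> < 1" using c by (simp add: abs_mult)
    then have b: "- 1 < c * cos \<theta>" "c * cos \<theta> < 1" by auto
    have cos: "cos (arccos (c * cos \<theta>)) = c * cos \<theta>" using b by (intro cos_arccos) auto
    have sin: "sin (arccos (c * cos \<theta>)) = sqrt (1 - c\<^sup>2 * (cos \<theta>)^2)"
      using b by (simp add: sin_arccos power_mult_distrib)
    have "sin (arccos (c * cos \<theta>)) \<noteq> 0" using sin_arccos_nonzero b by simp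
    from heat_inner_integral[OF n t \<rho>(1,2) this, folded l_def c0_def, unfolded cos sin]
    show ?thesis by (simp add: G_def w_def)
  qed
  \<comment> \<open>The two end points are discarded as a null set.\<close>
  have "(LBINT \<theta>:{0..pi}. G \<theta>) = (LBINT \<theta>:{0..pi}. c0 * sqrt (pi * t) * exp t * (\<Sum>m. w m \<theta>))"
    unfolding set_lebesgue_integral_def
    by (rule integral_discrete_difference[of "{0, pi}"]) (auto simp: indicator_def G)
  also have "\<dots> = c0 * sqrt (pi * t) * exp t * (LBINT \<theta>:{0..pi}. (\<Sum>m. w m \<theta>))"
    by (rule set_integral_mult_right)
  also have "\<dots> = c0 * sqrt (pi * t) * exp t * (pi * \<Sigma>)" unfolding outer ..
  finally have "exp (- t) / (2 * pi * sqrt (pi * t)) * (LBINT \<theta>:{0..pi}. G \<theta>) =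
      (exp (- t) * exp t) * (sqrt (pi * t) / sqrt (pi * t)) * (pi / pi) * (c0 * \<Sigma> / 2)"
    by simp
  also have "\<dots> = h t x" unfolding h using t by (simp add: exp_add[symmetric])
  finally show ?thesis unfolding G_def n_def c_def \<rho>_def by simp
qed

end
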